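(* Let $\gamma\in(0,2)$. There exist a constant $C>0$ (independent of $\varepsilon$ and of all the data below) and, for each $\varepsilon\in(0,e^{-3/\gamma})$, a construction assigning to every pair $f,g\in L^2(\mathbb{R}^2)$ of functions vanishing for $t<0$ a function $v_\varepsilon=v_\varepsilon[f,g]\in L^2(\mathbb{R}^2)$ (depending only on $f,g,\varepsilon,\gamma$, and not on the exact data or the exact solution), such that the following holds. Let $f_0,g_0\in L^2(\mathbb{R}^2)$ be exact data, vanishing for $t<0$, and let $v_0\in L^2(\mathbb{R}^2)$, vanishing for $t<0$, be the (unique) solution $v=v_0$ of $$S*v_0 = 2R*f_0 - S*g_0+4f_0 .$$ (i) There is a function $\eta:(0,e^{-3/\gamma})\to[0,\infty)$ with $\eta(\varepsilon)\to 0$ as $\varepsilon\downarrow 0$ such that, for every $\varepsilon\in(0,e^{-3/\gamma})$ and all measured data $f,g\in L^2(\mathbb{R}^2)$ (vanishing for $t<0$) with $\|f-f_0\|_2\le\varepsilon$ and $\|g-g_0\|_2\le\varepsilon$, $$\|v_\varepsilon[f,g]-v_0\|_2\le\sqrt{C\varepsilon^{2-\gamma}+\eta(\varepsilon)} .$$ (ii) If in addition $v_0\in H^m(\mathbb{R}^2)\cap L^1(\mathbb{R}^2)$ for some $m>0$, then there is a constant $D>0$, depending on $v_0$ (and possibly on $m,\gamma$) but not on $\varepsilon,f,g$, such that for every $\varepsilon\in(0,e^{-3/\gamma})$ with $0<\varepsilon<\min\{e^{-e^2},e^{-4m^2}\}$ and all $f,g$ as in (i), $$\|v_\varepsilon[f,g]-v_0\|_2<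 D\left(\ln\frac1\varepsilon\right)^{-m}.$$
   Context: Points of $\mathbb{R}^2$ are written $(x,t)$, and $\|\cdot\|_2$ is the $L^2(\mathbb{R}^2)$-norm. $H^m(\mathbb{R}^2)$ is the $L^2$-based Sobolev space of real order $m>0$. Define $R,S:\mathbb{R}^2\to\mathbb{R}$ by $$R(x,t)=\frac1{t^2}\exp\left(-\frac{x^2+4}{4t}\right),\qquad S(x,t)=\frac1{t^2}\exp\left(-\frac{x^2+1}{4t}\right)\quad\text{for }t>0,$$ and $R(x,t)=S(x,t)=0$ for $t\le 0$. Convolution on $\mathbb{R}^2$ is normalized as $$(h*k)(x,t)=\frac1{2\pi}\int_{-\infty}^{\infty}\int_{-\infty}^{\infty}h(x-\xi,t-\tau)\,k(\xi,\tau)\,d\xi\,d\tau .$$ With the unitary Fourier transform $\hat h(z,r)=\frac1{2\pi}\int_{\mathbb{R}^2}h(x,t)e^{-i(xz+tr)}\,dx\,dt$ this gives $\widehat{h*k}=\hat h\,\hat k$. Background: the equation $S*v=2R*f-S*g+4f$ is the convolution equation satisfied by the boundary temperature $v(x,t)=u(x,0,t)$ when $u$ solves $\Delta u-\partial_t u=0$ for $x\in\mathbb{R}$, $0<y<2$, $t>0$, with $u(x,2,t)=g(x,t)$, $u(x,1,t)=f(x,t)$, $u(x,y,0)=0$, and all functions are extended by $0$ to $t<0$. *)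

theory Defs
  imports "HOL-Analysis.Analysis"
begin

text \<open>Points of the plane are pairs \<open>(x, t)\<close>; on \<^typ>\<open>real \<times> real\<close> the measure \<^term>\<open>lborel\<close> is planar
  Lebesgue measure and \<^term>\<open>norm\<close> is the Euclidean norm. Elements of \<open>L\<^sup>2\<close> are represented by Borel
  functions, so equations between them are meant almost everywhere.\<close>

definition square_integrable :: "(real \<times> real \<Rightarrow> 'a::real_normed_vector) \<Rightarrow> bool" where
  "square_integrable h \<longleftrightarrow>
     h \<in> borel_measurable lborel \<and> integrable lborel (\<lambda>p. (norm (h p))\<^sup>2)"

definition L2_norm :: "(real \<times> real \<Rightarrow> 'a::real_normed_vector) \<Rightarrow> real" where
  "L2_norm h = sqrt (\<integral>p. (norm (h p))\<^sup>2 \<partial>lborel)"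

definition ae_eq :: "(real \<times> real \<Rightarrow> 'a) \<Rightarrow> (real \<times> real \<Rightarrow> 'a) \<Rightarrow> bool" where
  "ae_eq h k \<longleftrightarrow> (AE p in lborel. h p = k p)"

definition causal :: "(real \<times> real \<Rightarrow> real) \<Rightarrow> bool" where
  "causal h \<longleftrightarrow> (AE (x, t) in lborel. t < 0 \<longrightarrow> h (x, t) = 0)"

definition kernel_R :: "real \<times> real \<Rightarrow> real" where
  "kernel_R = (\<lambda>(x, t). if t > 0 then 1 / t\<^sup>2 * exp (- (x\<^sup>2 + 4) / (4 * t)) else 0)"

definition kernel_S :: "real \<times> real \<Rightarrow> real" where
  "kernel_S = (\<lambda>(x, t). if t > 0 then 1 / t\<^sup>2 * exp (- (x\<^sup>2 + 1) / (4 * t)) else 0)"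

definition conv :: "(real \<times> real \<Rightarrow> real) \<Rightarrow> (real \<times> real \<Rightarrow> real) \<Rightarrow> real \<times> real \<Rightarrow> real" where
  "conv h k = (\<lambda>(x, t). 1 / (2 * pi) * (\<integral>(\<xi>, \<tau>). h (x - \<xi>, t - \<tau>) * k (\<xi>, \<tau>) \<partial>lborel))"

definition causal_L2 :: "(real \<times> real \<Rightarrow> real) \<Rightarrow> bool" where
  "causal_L2 h \<longleftrightarrow> square_integrable h \<and> causal h"

definition exact_solution ::
    "(real \<times> real \<Rightarrow> real) \<Rightarrow> (real \<times> real \<Rightarrow> real) \<Rightarrow> (real \<times> real \<Rightarrow> real) \<Rightarrow> bool" where
  "exact_solution f g v \<longleftrightarrow>
     causal_L2 f \<and> causal_L2 g \<and> causal_L2 v \<and>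
     ae_eq (conv kernel_S v) (\<lambda>p. 2 * conv kernel_R f p - conv kernel_S g p + 4 * f p)"

text \<open>The Fourier integral; it is the Fourier transform only for integrable \<open>h\<close>.\<close>

definition fourier :: "(real \<times> real \<Rightarrow> complex) \<Rightarrow> real \<times> real \<Rightarrow> complex" where
  "fourier h = (\<lambda>(z, r). 1 / (2 * of_real pi) *
     (\<integral>(x, t). h (x, t) * exp (- \<i> * of_real (x * z + t * r)) \<partial>lborel))"

text \<open>\<open>H\<close> represents the Fourier--Plancherel transform of \<open>h \<in> L\<^sup>2\<close>: it is the \<open>L\<^sup>2\<close> limit of the
  Fourier integrals of \<open>h\<close> truncated to growing balls. The nonnegative integral is used because the
  Bochner integral would be 0 if the difference were not square integrable.\<close>

definition is_fourier_L2 :: "(real \<times> real \<Rightarrow> complex) \<Rightarrow> (real \<times> real \<Rightarrow> complex) \<Rightarrow> bool" where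
  "is_fourier_L2 h H \<longleftrightarrow> square_integrable H \<and>
     (\<lambda>n::nat. \<integral>\<^sup>+ \<zeta>. ennreal ((norm (H \<zeta> -
         fourier (\<lambda>p. indicator (ball 0 (real n)) p * h p) \<zeta>))\<^sup>2) \<partial>lborel) \<longlonglongrightarrow> 0"

definition sobolev :: "real \<Rightarrow> (real \<times> real \<Rightarrow> real) \<Rightarrow> bool" where
  "sobolev m h \<longleftrightarrow> square_integrable h \<and>
     (\<exists>H. is_fourier_L2 (\<lambda>p. complex_of_real (h p)) H \<and>
          square_integrable (\<lambda>\<zeta>. (1 + (norm \<zeta>)\<^sup>2) powr (m / 2) *\<^sub>R H \<zeta>))"

end

theory Submission
  imports Defs "HOL-Probability.Probability" "HOL-Complex_Analysis.Complex_Analysis"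
begin

text \<open>In terms of Fourier transforms the equation reads \<open>2 e\<^sup>-\<^sup>w v = 2 e\<^sup>-\<^sup>2\<^sup>w f - 2 e\<^sup>-\<^sup>w g + 4 f\<close> with
  \<open>w = \<surd>(z\<^sup>2 + \<i> r)\<close>, and \<open>Re w \<le> \<rho>\<close> on the disc of radius \<open>\<rho> \<ge> 1\<close>. The regularized
  solution keeps only the frequencies in that disc, with \<open>\<rho> = (\<gamma> / 2) ln (1 / \<epsilon>)\<close>: the data error is
  amplified by at most a multiple of \<open>e\<^sup>\<rho> = \<epsilon> powr (- \<gamma> / 2)\<close>, and the truncation error is the
  \<open>L\<^sup>2\<close> norm of the transform of \<open>v\<^sub>0\<close> outside the disc, which is \<open>O(\<rho> powr (- m))\<close> for
  \<open>v\<^sub>0 \<in> H\<^sup>m\<close>. The cutoff is a convolution with an explicit \<open>L\<^sup>2\<close> kernel, so no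
  Fourier--Plancherel transform on \<open>L\<^sup>2\<close> has to be constructed: all estimates are made for integrable
  functions and carried over to \<open>L\<^sup>2\<close> by Fatou's lemma.\<close>

section \<open>Bounds for the \<open>L\<^sup>2\<close> norm\<close>

text \<open>The error of the regularized solution splits into the truncated inverse applied to the
  data error and the defect of that inverse on the exact right-hand side, which the equation turns
  into \<open>S * v\<^sub>0\<close>. The first part pays the supremum \<open>exp \<rho> / 2\<close>
  of the truncated symbol. The second part must not pay it: on functions of the form S * h the
  truncated inverse acts as a sharp low-pass filter, with norm at most 1 for every \<rho>. This
  uniformity allows \<open>v\<^sub>0\<close> to be replaced by an integrable truncation that is
  fixed before \<rho> grows. The filter is handled by its symbol: on integrable data the Plancherel
  inequality, used once before and once after multiplication by the symbol, gives its operator norm.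
  Young's inequality serves for R, S and the Gaussian means. The truncated symbol is bounded only if
  the transform of S is known at complex Laplace parameters; the complex error function enters for
  this reason. The radius must be at least 1 because |w|^2 is the modulus of z^2 + i r, in which r
  is not squared: a pure time frequency r has |w|^2 = |r|, and |r| \<le> \<rho>^2 follows from |r|
  \<le> \<rho> only then.\<close>

lemma nn_integral_Cauchy_Schwarz:
  fixes f g :: "'a \<Rightarrow> real"
  assumes [measurable]: "f \<in> borel_measurable M" "g \<in> borel_measurable M"
    and f: "(\<integral>\<^sup>+x. ennreal ((f x)\<^sup>2) \<partial>M) \<le> ennreal (A\<^sup>2)"
    and g: "(\<integral>\<^sup>+x. ennreal ((g x)\<^sup>2) \<partial>M) \<le> ennreal (B\<^sup>2)"
    and "0 \<le> A" "0 \<le> B"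
  shows "(\<integral>\<^sup>+x. ennreal \<bar>f x * g x\<bar> \<partial>M) \<le> ennreal (A * B)"
proof -
  \<comment> \<open>Strict upper bounds are positive even if \<open>A\<close> or \<open>B\<close> is
    0, so the quotient below is defined; the claim itself follows by letting them decrease to
    \<open>A\<close> and \<open>B\<close>.\<close>
  have gen: "(\<integral>\<^sup>+x. ennreal \<bar>f x * g x\<bar> \<partial>M) \<le> ennreal (a * b)"
    if a: "A < a" and b: "B < b" for a b
  proof -
    have pos: "0 < a" "0 < b" using a b assms by auto
    \<comment> \<open>The minimizer of \<open>t/2 * a\<^sup>2 + 1/(2*t) * b\<^sup>2\<close>, where
      this sum equals \<open>a * b\<close>.\<close>
    define t where "t = b / a"
    have t: "0 < t" using pos by (simp add: t_def)
    have pt: "\<bar>f x * g x\<bar> \<le> t/2 * (f x)\<^sup>2 + 1/(2*t) * (g x)\<^sup>2" for x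
    proof -
      have "0 \<le> (t * \<bar>f x\<bar> - \<bar>g x\<bar>)\<^sup>2" by simp
      then have "2 * t * (\<bar>f x\<bar> * \<bar>g x\<bar>) \<le> t\<^sup>2 * (f x)\<^sup>2 + (g x)\<^sup>2"
        by (simp add: power2_eq_square algebra_simps)
      then show ?thesis using t by (simp add: field_simps abs_mult power2_eq_square)
    qed
    have "(\<integral>\<^sup>+x. ennreal \<bar>f x * g x\<bar> \<partial>M) \<le>
        (\<integral>\<^sup>+x. ennreal (t/2) * ennreal ((f x)\<^sup>2) + ennreal (1/(2*t)) * ennreal ((g x)\<^sup>2) \<partial>M)"
      using pt t by (intro nn_integral_mono) (simp add: ennreal_mult[symmetric] ennreal_plus[symmetric] del: ennreal_plus)
    also have "\<dots> = ennreal (t/2) * (\<integral>\<^sup>+x. ennreal ((f x)\<^sup>2) \<partial>M) + ennreal (1/(2*t)) * (\<integral>\<^sup>+x. ennreal ((g x)\<^sup>2) \<partial>M)"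
      by (subst nn_integral_add) (auto simp: nn_integral_cmult)
    also have "\<dots> \<le> ennreal (t/2) * ennreal (a\<^sup>2) + ennreal (1/(2*t)) * ennreal (b\<^sup>2)"
      using a b assms by (intro add_mono mult_left_mono order_trans[OF f] order_trans[OF g] ennreal_leI power_mono) auto
    also have "\<dots> = ennreal (t/2 * a\<^sup>2 + 1/(2*t) * b\<^sup>2)"
      using t by (simp add: ennreal_mult[symmetric] ennreal_plus[symmetric] del: ennreal_plus)
    also have "t/2 * a\<^sup>2 + 1/(2*t) * b\<^sup>2 = a * b"
      using pos by (simp add: t_def field_simps power2_eq_square)
    finally show ?thesis .
  qed
  have "(\<lambda>n. ennreal ((A + 1 / real (Suc n)) * (B + 1 / real (Suc n)))) \<longlonglongrightarrow> ennreal ((A + 0) * (B + 0))"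
    by (intro tendsto_intros LIMSEQ_Suc lim_1_over_n)
  moreover have "\<forall>n. (\<integral>\<^sup>+x. ennreal \<bar>f x * g x\<bar> \<partial>M) \<le> ennreal ((A + 1 / real (Suc n)) * (B + 1 / real (Suc n)))"
    by (intro allI gen) auto
  ultimately show ?thesis by (intro LIMSEQ_le_const) auto
qed

text \<open>Measurability and the sign of the bound are bundled in, so that bounds compose without
  side conditions. With the nonnegative integral the bound itself implies square
  integrability.\<close>

definition L2_le :: "(real \<times> real \<Rightarrow> 'a::{real_normed_vector,second_countable_topology}) \<Rightarrow> real \<Rightarrow> bool" where
  "L2_le h B \<longleftrightarrow> h \<in> borel_measurable borel \<and> 0 \<le> B \<and>
     (\<integral>\<^sup>+p. ennreal ((norm (h p))\<^sup>2) \<partial>lborel) \<le> ennreal (B\<^sup>2)"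

lemma L2_leD:
  assumes "L2_le h B"
  shows "h \<in> borel_measurable borel" "0 \<le> B"
    "(\<integral>\<^sup>+p. ennreal ((norm (h p))\<^sup>2) \<partial>lborel) \<le> ennreal (B\<^sup>2)"
  using assms by (auto simp: L2_le_def)

lemma L2_le_square_integrable:
  assumes "L2_le h B"
  shows "square_integrable h"
proof -
  have [measurable]: "h \<in> borel_measurable borel" using L2_leD[OF assms] by auto
  have "integrable lborel (\<lambda>p. (norm (h p))\<^sup>2)"
    using L2_leD(3)[OF assms] by (intro integrableI_bounded) (auto simp: less_top[symmetric] top_unique)
  then show ?thesis by (simp add: square_integrable_def)
qed

lemma nn_integral_square_integrable:
  assumes "square_integrable h"
  shows "(\<integral>\<^sup>+p. ennreal ((norm (h p))\<^sup>2) \<partial>lborel) = ennreal ((L2_norm h)\<^sup>2)"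
  using assms by (subst nn_integral_eq_integral) (auto simp: square_integrable_def L2_norm_def)

lemma L2_norm_nonneg [simp]: "0 \<le> L2_norm h"
  by (simp add: L2_norm_def)

lemma L2_le_iff: "L2_le h B \<longleftrightarrow> square_integrable h \<and> L2_norm h \<le> B"
proof
  assume h: "L2_le h B"
  have "ennreal ((L2_norm h)\<^sup>2) \<le> ennreal (B\<^sup>2)"
    using nn_integral_square_integrable[OF L2_le_square_integrable[OF h]] L2_leD(3)[OF h] by simp
  then have "(L2_norm h)\<^sup>2 \<le> B\<^sup>2" by (simp add: ennreal_le_iff)
  then show "square_integrable h \<and> L2_norm h \<le> B"
    using L2_leD(2)[OF h] L2_le_square_integrable[OF h] power2_le_imp_le by blast
next
  assume h: "square_integrable h \<and> L2_norm h \<le> B"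
  then have "0 \<le> B" using L2_norm_nonneg order_trans by blast
  with h nn_integral_square_integrable[of h] show "L2_le h B"
    by (auto simp: L2_le_def square_integrable_def intro!: ennreal_leI power_mono)
qed

lemma L2_le_norm: "square_integrable h \<Longrightarrow> L2_le h (L2_norm h)"
  by (simp add: L2_le_iff)

lemma L2_le_mono: "L2_le h A \<Longrightarrow> A \<le> B \<Longrightarrow> L2_le h B"
  by (auto simp: L2_le_iff)

lemma L2_le_dominated:
  assumes h: "L2_le h B" and [measurable]: "k \<in> borel_measurable borel"
    and le: "AE p in lborel. norm (k p) \<le> c * norm (h p)" and c: "0 \<le> c"
  shows "L2_le k (c * B)"
proof -
  have [measurable]: "h \<in> borel_measurable borel" using L2_leD[OF h] by auto
  have "(\<integral>\<^sup>+p. ennreal ((norm (k p))\<^sup>2) \<partial>lborel) \<le> (\<integral>\<^sup>+p. ennreal (c\<^sup>2) * ennreal ((norm (h p))\<^sup>2) \<partial>lborel)"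
  proof (intro nn_integral_mono_AE)
    show "AE p in lborel. ennreal ((norm (k p))\<^sup>2) \<le> ennreal (c\<^sup>2) * ennreal ((norm (h p))\<^sup>2)"
      using le
    proof eventually_elim
      case (elim p)
      then have "(norm (k p))\<^sup>2 \<le> (c * norm (h p))\<^sup>2" by (intro power_mono) auto
      then show ?case by (simp add: ennreal_mult[symmetric] power_mult_distrib)
    qed
  qed
  also have "\<dots> = ennreal (c\<^sup>2) * (\<integral>\<^sup>+p. ennreal ((norm (h p))\<^sup>2) \<partial>lborel)"
    by (rule nn_integral_cmult) auto
  also have "\<dots> \<le> ennreal (c\<^sup>2) * ennreal (B\<^sup>2)"
    using L2_leD(3)[OF h] by (intro mult_left_mono) auto
  finally show ?thesis using c L2_leD(2)[OF h]
    by (simp add: L2_le_def ennreal_mult[symmetric] power_mult_distrib)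
qed

lemma L2_le_AE_cong:
  assumes "L2_le h B" "k \<in> borel_measurable borel" "AE p in lborel. k p = h p"
  shows "L2_le k B"
proof -
  have "AE p in lborel. norm (k p) \<le> 1 * norm (h p)" using assms(3) by eventually_elim simp
  from L2_le_dominated[OF assms(1,2) this] show ?thesis by simp
qed

text \<open>Minkowski's inequality: the square is expanded and the cross term is controlled by
  Cauchy--Schwarz.\<close>

lemma L2_le_add:
  assumes h: "L2_le h A" and k: "L2_le k B"
  shows "L2_le (\<lambda>p. h p + k p) (A + B)"
proof -
  have [measurable]: "h \<in> borel_measurable borel" "k \<in> borel_measurable borel"
    using L2_leD[OF h] L2_leD[OF k] by auto
  have AB: "0 \<le> A" "0 \<le> B" using L2_leD[OF h] L2_leD[OF k] by auto
  have "(\<integral>\<^sup>+p. ennreal ((norm (h p + k p))\<^sup>2) \<partial>lborel) \<le>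
     (\<integral>\<^sup>+p. ennreal ((norm (h p))\<^sup>2) + (ennreal ((norm (k p))\<^sup>2) + 2 * ennreal \<bar>norm (h p) * norm (k p)\<bar>) \<partial>lborel)"
  proof (intro nn_integral_mono)
    fix p
    have "(norm (h p + k p))\<^sup>2 \<le> (norm (h p) + norm (k p))\<^sup>2"
      by (intro power_mono norm_triangle_ineq) auto
    then have "(norm (h p + k p))\<^sup>2 \<le> (norm (h p))\<^sup>2 + ((norm (k p))\<^sup>2 + 2 * \<bar>norm (h p) * norm (k p)\<bar>)"
      by (simp add: power2_sum abs_mult)
    then have "ennreal ((norm (h p + k p))\<^sup>2) \<le> ennreal ((norm (h p))\<^sup>2 + ((norm (k p))\<^sup>2 + 2 * \<bar>norm (h p) * norm (k p)\<bar>))"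
      by (rule ennreal_leI)
    also have "\<dots> = ennreal ((norm (h p))\<^sup>2) + (ennreal ((norm (k p))\<^sup>2) + 2 * ennreal \<bar>norm (h p) * norm (k p)\<bar>)"
      by (simp add: ennreal_plus ennreal_mult)
    finally show "ennreal ((norm (h p + k p))\<^sup>2) \<le> \<dots>" .
  qed
  also have "\<dots> = (\<integral>\<^sup>+p. ennreal ((norm (h p))\<^sup>2) \<partial>lborel) + ((\<integral>\<^sup>+p. ennreal ((norm (k p))\<^sup>2) \<partial>lborel) +
      2 * (\<integral>\<^sup>+p. ennreal \<bar>norm (h p) * norm (k p)\<bar> \<partial>lborel))"
    by (subst nn_integral_add; measurable?)+ (simp add: nn_integral_cmult nn_integral_add)
  also have "\<dots> \<le> ennreal (A\<^sup>2) + (ennreal (B\<^sup>2) + 2 * ennreal (A * B))"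
    using L2_leD(3)[OF h] L2_leD(3)[OF k] AB
    by (intro add_mono mult_left_mono nn_integral_Cauchy_Schwarz) auto
  also have "\<dots> = ennreal ((A + B)\<^sup>2)"
    using AB by (simp add: power2_sum ennreal_plus ennreal_mult add.assoc mult.assoc)
  finally show ?thesis using AB by (simp add: L2_le_def)
qed

lemma L2_le_scale:
  assumes "L2_le h A"
  shows "L2_le (\<lambda>p. c *\<^sub>R h p) (\<bar>c\<bar> * A)"
proof -
  have [measurable]: "h \<in> borel_measurable borel" using L2_leD[OF assms] by auto
  show ?thesis by (rule L2_le_dominated[OF assms]) auto
qed

lemma L2_le_diff:
  assumes h: "L2_le h A" and k: "L2_le k B"
  shows "L2_le (\<lambda>p. h p - k p) (A + B)"
  using L2_le_add[OF h L2_le_scale[OF k, of "-1"]] by simp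

text \<open>The passage from regularized or truncated functions to their limits. No majorant is
  asked for, and the bounds may vary with n, which lets error terms disappear in the limit.\<close>

lemma L2_le_Fatou:
  assumes X: "\<And>n. L2_le (X n) (B n)" and B: "B \<longlonglongrightarrow> b"
    and [measurable]: "Y \<in> borel_measurable borel"
    and lim: "AE p in lborel. (\<lambda>n. X n p) \<longlonglongrightarrow> Y p"
  shows "L2_le Y b"
proof -
  have [measurable]: "X n \<in> borel_measurable borel" for n using L2_leD[OF X] by auto
  have b: "0 \<le> b" using L2_leD(2)[OF X] by (intro LIMSEQ_le_const[OF B]) auto
  have "(\<integral>\<^sup>+p. ennreal ((norm (Y p))\<^sup>2) \<partial>lborel) = (\<integral>\<^sup>+p. liminf (\<lambda>n. ennreal ((norm (X n p))\<^sup>2)) \<partial>lborel)"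
  proof (intro nn_integral_cong_AE)
    show "AE p in lborel. ennreal ((norm (Y p))\<^sup>2) = liminf (\<lambda>n. ennreal ((norm (X n p))\<^sup>2))"
      using lim
    proof eventually_elim
      case (elim p)
      have "(\<lambda>n. ennreal ((norm (X n p))\<^sup>2)) \<longlonglongrightarrow> ennreal ((norm (Y p))\<^sup>2)"
        using elim by (intro tendsto_intros)
      then show ?case using lim_imp_Liminf[OF sequentially_bot] by metis
    qed
  qed
  also have "\<dots> \<le> liminf (\<lambda>n. \<integral>\<^sup>+p. ennreal ((norm (X n p))\<^sup>2) \<partial>lborel)"
    by (rule nn_integral_liminf) auto
  also have "\<dots> \<le> liminf (\<lambda>n. ennreal ((B n)\<^sup>2))"
    by (intro Liminf_mono always_eventually allI L2_leD(3)[OF X])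
  also have "\<dots> = ennreal (b\<^sup>2)"
  proof -
    have "(\<lambda>n. ennreal ((B n)\<^sup>2)) \<longlonglongrightarrow> ennreal (b\<^sup>2)" using B by (intro tendsto_intros)
    then show ?thesis using lim_imp_Liminf[OF sequentially_bot] by metis
  qed
  finally show ?thesis using b by (simp add: L2_le_def)
qed

lemma L2_le_limit:
  assumes "\<And>n. L2_le h (B n)" "B \<longlonglongrightarrow> b"
  shows "L2_le h b"
  using L2_le_Fatou[of "\<lambda>_. h" B b h] assms L2_leD(1)[OF assms(1)] by auto

lemma L2_le_mult_integrable:
  assumes f: "L2_le f A" and g: "L2_le g B"
  shows "integrable lborel (\<lambda>p. norm (f p) * norm (g p))"
    and "(\<integral>p. norm (f p) * norm (g p) \<partial>lborel) \<le> A * B"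
proof -
  have [measurable]: "f \<in> borel_measurable borel" "g \<in> borel_measurable borel"
    using L2_leD[OF f] L2_leD[OF g] by auto
  have *: "(\<integral>\<^sup>+p. ennreal \<bar>norm (f p) * norm (g p)\<bar> \<partial>lborel) \<le> ennreal (A * B)"
    using L2_leD[OF f] L2_leD[OF g] by (intro nn_integral_Cauchy_Schwarz) auto
  show int: "integrable lborel (\<lambda>p. norm (f p) * norm (g p))"
    using * by (intro integrableI_bounded) (auto simp: less_top[symmetric] top_unique)
  show "(\<integral>p. norm (f p) * norm (g p) \<partial>lborel) \<le> A * B"
    using * nn_integral_eq_integral[OF int] L2_leD(2)[OF f] L2_leD(2)[OF g]
    by (simp add: ennreal_le_iff)
qed

section \<open>Convolution and the Fourier integral\<close>

lemma integrable_pair_mult: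
  fixes f :: "'a::euclidean_space \<Rightarrow> 'c::{real_normed_algebra,banach,second_countable_topology}"
    and g :: "'b::euclidean_space \<Rightarrow> 'c"
  assumes f: "integrable lborel f" and g: "integrable lborel g"
  shows "integrable (lborel \<Otimes>\<^sub>M lborel) (\<lambda>(x, y). f x * g y)"
proof -
  have [measurable]: "f \<in> borel_measurable borel" "g \<in> borel_measurable borel"
    using f g by (auto dest: borel_measurable_integrable)
  have "(\<integral>\<^sup>+z. ennreal (norm (case z of (x, y) \<Rightarrow> f x * g y)) \<partial>(lborel \<Otimes>\<^sub>M lborel))
      \<le> (\<integral>\<^sup>+z. ennreal (norm (f (fst z))) * ennreal (norm (g (snd z))) \<partial>(lborel \<Otimes>\<^sub>M lborel))"
    by (intro nn_integral_mono) (auto simp: ennreal_mult[symmetric] norm_mult_ineq intro!: ennreal_leI)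
  also have "\<dots> = (\<integral>\<^sup>+x. \<integral>\<^sup>+y. ennreal (norm (f x)) * ennreal (norm (g y)) \<partial>lborel \<partial>lborel)"
    by (subst lborel.nn_integral_fst[symmetric]) auto
  also have "\<dots> = (\<integral>\<^sup>+x. ennreal (norm (f x)) \<partial>lborel) * (\<integral>\<^sup>+y. ennreal (norm (g y)) \<partial>lborel)"
    by (simp add: nn_integral_cmult nn_integral_multc)
  also have "\<dots> < \<infinity>"
    using f g by (auto simp: integrable_iff_bounded ennreal_mult_less_top)
  finally show ?thesis by (intro integrableI_bounded) auto
qed

lemma nn_integral_lborel_reflect:
  fixes f :: "'a::euclidean_space \<Rightarrow> ennreal"
  assumes [measurable]: "f \<in> borel_measurable borel"
  shows "(\<integral>\<^sup>+q. f (p - q) \<partial>lborel) = (\<integral>\<^sup>+q. f q \<partial>lborel)"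
  by (subst lborel_affine[of "-1" p]) (simp_all add: nn_integral_density nn_integral_distr)

lemma integrable_lborel_reflect:
  fixes f :: "'a::euclidean_space \<Rightarrow> 'b::{banach,second_countable_topology}"
  assumes "integrable lborel f"
  shows "integrable lborel (\<lambda>q. f (p - q))"
proof -
  have [measurable]: "f \<in> borel_measurable borel" using assms by (auto dest: borel_measurable_integrable)
  show ?thesis using assms nn_integral_lborel_reflect[of "\<lambda>q. ennreal (norm (f q))" p]
    by (simp add: integrable_iff_bounded)
qed

lemma nn_integral_lborel_shift:
  fixes f :: "'a::euclidean_space \<Rightarrow> ennreal"
  assumes [measurable]: "f \<in> borel_measurable borel"
  shows "(\<integral>\<^sup>+q. f (q - p) \<partial>lborel) = (\<integral>\<^sup>+q. f q \<partial>lborel)"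
  by (subst (2) lborel_affine[of "1" "-p"]) (simp_all add: nn_integral_density nn_integral_distr)

lemma integral_lborel_shift:
  fixes f :: "'a::euclidean_space \<Rightarrow> 'b::{banach,second_countable_topology}"
  assumes [measurable]: "f \<in> borel_measurable borel"
  shows "(\<integral>q. f (q - p) \<partial>lborel) = (\<integral>q. f q \<partial>lborel)"
  by (subst (2) lborel_affine[of "1" "-p"]) (simp_all add: density_1 integral_distr)

text \<open>Without the factor 1/(2 pi), so that a kernel of mass 1 is an averaging operator, and
  with vector values, so that real data and complex functions are treated alike.\<close>

definition convolve ::
    "(real \<times> real \<Rightarrow> real) \<Rightarrow> (real \<times> real \<Rightarrow> 'a::{banach,second_countable_topology}) \<Rightarrow> real \<times> real \<Rightarrow> 'a" where
  "convolve k h p = (\<integral>q. k (p - q) *\<^sub>R h q \<partial>lborel)"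

lemma conv_eq_convolve: "conv h k p = 1 / (2 * pi) * convolve h k p"
  by (cases p) (simp add: conv_def convolve_def case_prod_beta' minus_prod_def)

lemma borel_measurable_convolve [measurable]:
  assumes [measurable]: "k \<in> borel_measurable borel" "h \<in> borel_measurable borel"
  shows "convolve k h \<in> borel_measurable borel"
  unfolding convolve_def by measurable

lemma convolve_cong_AE:
  assumes [measurable]: "k \<in> borel_measurable borel" "h \<in> borel_measurable borel" "h' \<in> borel_measurable borel"
    and "AE q in lborel. h q = h' q"
  shows "convolve k h = convolve k h'"
  unfolding convolve_def using assms(4) by (intro ext integral_cong_AE) auto

lemma Young_L1:
  assumes k: "integrable lborel k" and k0: "\<And>p. 0 \<le> k p" and h: "integrable lborel h"
  shows "integrable lborel (convolve k h)"
    and "(\<integral>\<^sup>+p. ennreal (norm (convolve k h p)) \<partial>lborel)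
           \<le> ennreal (\<integral>p. k p \<partial>lborel) * (\<integral>\<^sup>+p. ennreal (norm (h p)) \<partial>lborel)"
proof -
  have [measurable]: "k \<in> borel_measurable borel" "h \<in> borel_measurable borel"
    using k h by (auto dest: borel_measurable_integrable)
  have "(\<integral>\<^sup>+p. ennreal (norm (convolve k h p)) \<partial>lborel)
      \<le> (\<integral>\<^sup>+p. \<integral>\<^sup>+q. ennreal (k (p - q)) * ennreal (norm (h q)) \<partial>lborel \<partial>lborel)"
  proof (intro nn_integral_mono)
    fix p
    show "ennreal (norm (convolve k h p)) \<le> (\<integral>\<^sup>+q. ennreal (k (p - q)) * ennreal (norm (h q)) \<partial>lborel)"
    \<comment> \<open>A divergent Bochner integral is 0 by convention, so the bound holds at every
      \<open>p\<close>, without an exceptional set.\<close>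
    proof (cases "integrable lborel (\<lambda>q. k (p - q) *\<^sub>R h q)")
      case True
      then show ?thesis
        using integral_norm_bound_ennreal[OF True] k0
        by (simp add: convolve_def ennreal_mult)
    qed (simp add: convolve_def not_integrable_integral_eq)
  qed
  also have "\<dots> = (\<integral>\<^sup>+q. \<integral>\<^sup>+p. ennreal (k (p - q)) * ennreal (norm (h q)) \<partial>lborel \<partial>lborel)"
    by (rule lborel_pair.Fubini'[symmetric]) auto
  also have "\<dots> = (\<integral>\<^sup>+q. ennreal (\<integral>p. k p \<partial>lborel) * ennreal (norm (h q)) \<partial>lborel)"
    using k k0 by (simp add: nn_integral_multc nn_integral_lborel_shift[of "\<lambda>p. ennreal (k p)"] nn_integral_eq_integral)
  also have "\<dots> = ennreal (\<integral>p. k p \<partial>lborel) * (\<integral>\<^sup>+p. ennreal (norm (h p)) \<partial>lborel)"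
    by (rule nn_integral_cmult) auto
  finally show *: "(\<integral>\<^sup>+p. ennreal (norm (convolve k h p)) \<partial>lborel)
           \<le> ennreal (\<integral>p. k p \<partial>lborel) * (\<integral>\<^sup>+p. ennreal (norm (h p)) \<partial>lborel)" .
  also have "\<dots> < \<infinity>" using h by (auto simp: integrable_iff_bounded ennreal_mult_less_top)
  finally show "integrable lborel (convolve k h)" by (intro integrableI_bounded) auto
qed

text \<open>Cauchy--Schwarz for the splitting of \<open>k\<close> into two factors
  \<open>sqrt k\<close> bounds the square of the convolution by the mass of \<open>k\<close> times
  \<open>J\<close>, the convolution of \<open>k\<close> with the square of \<open>h\<close>; Tonelli
  integrates \<open>J\<close>. Finiteness of \<open>J\<close> almost everywhere also yields the
  absolute convergence on which linearity of the convolution rests.\<close>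

lemma Young_L2:
  assumes k: "integrable lborel k" and k0: "\<And>p. 0 \<le> k p" and h: "L2_le h B"
  shows "AE p in lborel. integrable lborel (\<lambda>q. k (p - q) *\<^sub>R h q)"
    and "L2_le (convolve k h) ((\<integral>p. k p \<partial>lborel) * B)"
proof -
  have [measurable]: "k \<in> borel_measurable borel" "h \<in> borel_measurable borel"
    using k L2_leD[OF h] by (auto dest: borel_measurable_integrable)
  have B: "0 \<le> B" using L2_leD[OF h] by auto
  define K where "K = (\<integral>p. k p \<partial>lborel)"
  have K: "0 \<le> K" unfolding K_def using k0 by simp
  have nnK: "(\<integral>\<^sup>+q. ennreal (k (p - q)) \<partial>lborel) = ennreal K"
      "(\<integral>\<^sup>+q. ennreal (k (q - p)) \<partial>lborel) = ennreal K" for p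
    using k k0 by (simp_all add: nn_integral_lborel_shift[of "\<lambda>p. ennreal (k p)"]
        nn_integral_lborel_reflect[of "\<lambda>p. ennreal (k p)"] nn_integral_eq_integral K_def)
  define J where "J p = (\<integral>\<^sup>+q. ennreal (k (p - q)) * ennreal ((norm (h q))\<^sup>2) \<partial>lborel)" for p
  have [measurable]: "J \<in> borel_measurable borel" unfolding J_def by measurable
  have "(\<integral>\<^sup>+p. J p \<partial>lborel) = (\<integral>\<^sup>+q. \<integral>\<^sup>+p. ennreal (k (p - q)) * ennreal ((norm (h q))\<^sup>2) \<partial>lborel \<partial>lborel)"
    unfolding J_def by (rule lborel_pair.Fubini'[symmetric]) auto
  also have "\<dots> = ennreal K * (\<integral>\<^sup>+q. ennreal ((norm (h q))\<^sup>2) \<partial>lborel)"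
    by (simp add: nn_integral_multc nnK nn_integral_cmult)
  also have "\<dots> \<le> ennreal K * ennreal (B\<^sup>2)"
    by (intro mult_left_mono L2_leD(3)[OF h]) auto
  finally have J: "(\<integral>\<^sup>+p. J p \<partial>lborel) \<le> ennreal K * ennreal (B\<^sup>2)" .
  have "AE p in lborel. J p \<noteq> \<infinity>"
  proof (rule nn_integral_noteq_infinite)
    show "(\<integral>\<^sup>+p. J p \<partial>lborel) \<noteq> \<infinity>" using J by (auto simp: ennreal_mult[symmetric] K top_unique)
  qed auto
  then have main: "AE p in lborel. integrable lborel (\<lambda>q. k (p - q) *\<^sub>R h q) \<and>
      ennreal ((norm (convolve k h p))\<^sup>2) \<le> ennreal K * J p"
  proof eventually_elim
    case (elim p)
    then obtain j where j: "J p = ennreal j" "0 \<le> j" by (cases "J p") auto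
    have "(\<integral>\<^sup>+q. ennreal (norm (k (p - q) *\<^sub>R h q)) \<partial>lborel)
        = (\<integral>\<^sup>+q. ennreal \<bar>sqrt (k (p - q)) * (sqrt (k (p - q)) * norm (h q))\<bar> \<partial>lborel)"
      using k0 by (simp add: mult.assoc[symmetric])
    also have "\<dots> \<le> ennreal (sqrt K * sqrt j)"
    proof (rule nn_integral_Cauchy_Schwarz)
      show "(\<integral>\<^sup>+q. ennreal ((sqrt (k (p - q)))\<^sup>2) \<partial>lborel) \<le> ennreal ((sqrt K)\<^sup>2)"
        using k0 K nnK by simp
      show "(\<integral>\<^sup>+q. ennreal ((sqrt (k (p - q)) * norm (h q))\<^sup>2) \<partial>lborel) \<le> ennreal ((sqrt j)\<^sup>2)"
        using k0 j by (simp add: J_def power_mult_distrib ennreal_mult)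
    qed (use K j in auto)
    finally have *: "(\<integral>\<^sup>+q. ennreal (norm (k (p - q) *\<^sub>R h q)) \<partial>lborel) \<le> ennreal (sqrt K * sqrt j)" .
    have int: "integrable lborel (\<lambda>q. k (p - q) *\<^sub>R h q)"
      using * by (intro integrableI_bounded) (auto simp: less_top[symmetric] top_unique)
    have "ennreal (norm (convolve k h p)) \<le> ennreal (sqrt K * sqrt j)"
      using integral_norm_bound_ennreal[OF int] * unfolding convolve_def by (rule order_trans)
    then have "norm (convolve k h p) \<le> sqrt K * sqrt j" using K j by (simp add: ennreal_le_iff)
    then have "(norm (convolve k h p))\<^sup>2 \<le> (sqrt K * sqrt j)\<^sup>2" by (intro power_mono) auto
    then have "(norm (convolve k h p))\<^sup>2 \<le> K * j" using K j by (simp add: power_mult_distrib)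
    with int j K show ?case by (simp add: ennreal_mult[symmetric] ennreal_leI)
  qed
  then show "AE p in lborel. integrable lborel (\<lambda>q. k (p - q) *\<^sub>R h q)" by eventually_elim auto
  have "(\<integral>\<^sup>+p. ennreal ((norm (convolve k h p))\<^sup>2) \<partial>lborel) \<le> (\<integral>\<^sup>+p. ennreal K * J p \<partial>lborel)"
    using main by (intro nn_integral_mono_AE) auto
  also have "\<dots> = ennreal K * (\<integral>\<^sup>+p. J p \<partial>lborel)" by (rule nn_integral_cmult) auto
  also have "\<dots> \<le> ennreal K * (ennreal K * ennreal (B\<^sup>2))" by (intro mult_left_mono J) auto
  also have "\<dots> = ennreal (K * (K * B\<^sup>2))"
    using K by (simp add: ennreal_mult)
  also have "K * (K * B\<^sup>2) = (K * B)\<^sup>2"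
    by (simp add: power2_eq_square)
  finally show "L2_le (convolve k h) ((\<integral>p. k p \<partial>lborel) * B)"
    using K B by (simp add: L2_le_def K_def[symmetric])
qed

section \<open>Fourier integrals of integrable functions\<close>

lemma fourier_eq:
  "fourier h \<zeta> = 1 / (2 * of_real pi) * (\<integral>p. h p * cis (- (p \<bullet> \<zeta>)) \<partial>lborel)"
proof -
  have "exp (- \<i> * of_real (fst p * fst \<zeta> + snd p * snd \<zeta>)) = cis (- (p \<bullet> \<zeta>))" for p
    by (simp add: inner_prod_def cis_conv_exp algebra_simps)
  then show ?thesis by (cases \<zeta>) (simp add: fourier_def case_prod_beta')
qed

lemma borel_measurable_cis [measurable]:
  assumes [measurable]: "f \<in> borel_measurable M"
  shows "(\<lambda>x. cis (f x)) \<in> borel_measurable M"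
  by (rule borel_measurable_continuous_on[OF _ assms]) (intro continuous_intros)

lemma borel_measurable_fourier [measurable]:
  assumes [measurable]: "h \<in> borel_measurable borel"
  shows "fourier h \<in> borel_measurable borel"
  unfolding fourier_eq[abs_def] by measurable

lemma integrable_mult_cis:
  assumes "integrable lborel h" and [measurable]: "f \<in> borel_measurable borel"
  shows "integrable lborel (\<lambda>p. h p * cis (f p))"
proof -
  have [measurable]: "h \<in> borel_measurable borel" using assms by (auto dest: borel_measurable_integrable)
  show ?thesis by (rule Bochner_Integration.integrable_bound[OF assms(1)]) (auto simp: norm_mult)
qed

lemma norm_fourier_le:
  assumes "integrable lborel h"
  shows "norm (fourier h \<zeta>) \<le> 1 / (2 * pi) * (\<integral>p. norm (h p) \<partial>lborel)"
proof -
  have "norm (\<integral>p. h p * cis (- (p \<bullet> \<zeta>)) \<partial>lborel) \<le> (\<integral>p. norm (h p * cis (- (p \<bullet> \<zeta>))) \<partial>lborel)"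
    by (rule integral_norm_bound)
  then show ?thesis by (simp add: fourier_eq norm_mult norm_divide field_simps)
qed

lemma fourier_diff:
  assumes "integrable lborel h" "integrable lborel k"
  shows "fourier (\<lambda>p. h p - k p) \<zeta> = fourier h \<zeta> - fourier k \<zeta>"
  using integrable_mult_cis[OF assms(1), of "\<lambda>p. - (p \<bullet> \<zeta>)"] integrable_mult_cis[OF assms(2), of "\<lambda>p. - (p \<bullet> \<zeta>)"]
  by (simp add: fourier_eq left_diff_distrib right_diff_distrib diff_divide_distrib)

text \<open>Fubini applies because the phase has modulus 1. This multiplication formula is the
  source of both the inversion identity for Gaussian means and the Plancherel inequality.\<close>

lemma integral_fourier_mult:
  assumes h: "integrable lborel h" and W: "integrable lborel W"
  shows "(\<integral>\<zeta>. fourier h \<zeta> * W \<zeta> \<partial>lborel) = (\<integral>p. h p * fourier W p \<partial>lborel)"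
proof -
  have [measurable]: "W \<in> borel_measurable borel" "h \<in> borel_measurable borel"
    using W h by (auto dest: borel_measurable_integrable)
  have int: "integrable (lborel \<Otimes>\<^sub>M lborel) (\<lambda>(\<zeta>, p). h p * cis (- (p \<bullet> \<zeta>)) * W \<zeta>)"
    by (rule Bochner_Integration.integrable_bound[OF integrable_pair_mult[OF W h]]) (auto simp: norm_mult mult.commute)
  have "(\<integral>\<zeta>. fourier h \<zeta> * W \<zeta> \<partial>lborel) =
      1 / (2 * of_real pi) * (\<integral>\<zeta>. \<integral>p. h p * cis (- (p \<bullet> \<zeta>)) * W \<zeta> \<partial>lborel \<partial>lborel)"
    by (simp add: fourier_eq)
  also have "(\<integral>\<zeta>. \<integral>p. h p * cis (- (p \<bullet> \<zeta>)) * W \<zeta> \<partial>lborel \<partial>lborel) =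
      (\<integral>p. \<integral>\<zeta>. h p * cis (- (p \<bullet> \<zeta>)) * W \<zeta> \<partial>lborel \<partial>lborel)"
    by (rule lborel_pair.Fubini_integral[OF int, symmetric])
  also have "\<dots> = (\<integral>p. h p * (\<integral>\<zeta>. W \<zeta> * cis (- (\<zeta> \<bullet> p)) \<partial>lborel) \<partial>lborel)"
  proof (intro Bochner_Integration.integral_cong refl)
    fix p
    have "(\<integral>\<zeta>. h p * cis (- (p \<bullet> \<zeta>)) * W \<zeta> \<partial>lborel) = (\<integral>\<zeta>. h p * (W \<zeta> * cis (- (\<zeta> \<bullet> p))) \<partial>lborel)"
      by (intro Bochner_Integration.integral_cong refl) (simp add: inner_commute)
    then show "(\<integral>\<zeta>. h p * cis (- (p \<bullet> \<zeta>)) * W \<zeta> \<partial>lborel) = h p * (\<integral>\<zeta>. W \<zeta> * cis (- (\<zeta> \<bullet> p)) \<partial>lborel)"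
      by simp
  qed
  also have "1 / (2 * of_real pi) * \<dots> = (\<integral>p. h p * fourier W p \<partial>lborel)"
    unfolding fourier_eq integral_mult_right_zero[symmetric]
    by (intro Bochner_Integration.integral_cong refl) simp
  finally show ?thesis .
qed

text \<open>A reflection of the forward transform, so that every bound for \<open>fourier\<close>
  carries over.\<close>

definition inv_fourier :: "(real \<times> real \<Rightarrow> complex) \<Rightarrow> real \<times> real \<Rightarrow> complex" where
  "inv_fourier w p = fourier w (- p)"

lemma inv_fourier_eq:
  "inv_fourier w p = 1 / (2 * of_real pi) * (\<integral>\<zeta>. w \<zeta> * cis (p \<bullet> \<zeta>) \<partial>lborel)"
  by (simp add: inv_fourier_def fourier_eq inner_commute)

lemma borel_measurable_inv_fourier [measurable]:
  assumes [measurable]: "h \<in> borel_measurable borel"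
  shows "inv_fourier h \<in> borel_measurable borel"
  unfolding inv_fourier_def[abs_def] by measurable

lemma inv_fourier_diff:
  assumes "integrable lborel h" "integrable lborel k"
  shows "inv_fourier (\<lambda>p. h p - k p) \<zeta> = inv_fourier h \<zeta> - inv_fourier k \<zeta>"
  using fourier_diff[OF assms] by (simp add: inv_fourier_def)

text \<open>The multiplication formula with \<open>w\<close> times a character: the modulation
  becomes a translation. A multiplier with integrable symbol is thus a convolution with the inverse
  transform of the symbol.\<close>

lemma inv_fourier_mult_fourier:
  assumes h: "integrable lborel h" and w: "integrable lborel w"
  shows "inv_fourier (\<lambda>\<zeta>. w \<zeta> * fourier h \<zeta>) p =
     1 / (2 * of_real pi) * (\<integral>q. inv_fourier w (p - q) * h q \<partial>lborel)"
proof -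
  have "integrable lborel (\<lambda>\<zeta>. w \<zeta> * cis (p \<bullet> \<zeta>))" by (rule integrable_mult_cis[OF w]) auto
  from integral_fourier_mult[OF h this]
  have "(\<integral>\<zeta>. fourier h \<zeta> * (w \<zeta> * cis (p \<bullet> \<zeta>)) \<partial>lborel) =
      (\<integral>q. h q * fourier (\<lambda>\<zeta>. w \<zeta> * cis (p \<bullet> \<zeta>)) q \<partial>lborel)" .
  moreover have "fourier (\<lambda>\<zeta>. w \<zeta> * cis (p \<bullet> \<zeta>)) q = inv_fourier w (p - q)" for q
    by (simp add: inv_fourier_def fourier_eq mult.assoc cis_mult inner_diff_right inner_commute)
  ultimately show ?thesis
    by (simp add: inv_fourier_eq mult_ac)
qed

section \<open>Gaussian regularization and the Plancherel inequality\<close>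

text \<open>Scaling by \<sigma> reduces the integral to the characteristic function of the standard
  normal law.\<close>

lemma gaussian_fourier_1D:
  fixes \<sigma> z :: real
  assumes \<sigma>: "0 < \<sigma>"
  shows "integrable lborel (\<lambda>x. exp (- x\<^sup>2 / (2 * \<sigma>\<^sup>2)))"
    and "(\<integral>x. of_real (exp (- x\<^sup>2 / (2 * \<sigma>\<^sup>2))) * cis (x * z) \<partial>lborel)
           = complex_of_real (sqrt (2 * pi) * \<sigma> * exp (- (\<sigma>\<^sup>2 * z\<^sup>2) / 2))"
proof -
  have std: "std_normal_density x = 1 / sqrt (2 * pi) * exp (- x\<^sup>2 / 2)" for x
    by (simp add: normal_density_def)
  have "integrable lborel (\<lambda>x. sqrt (2 * pi * \<sigma>\<^sup>2) * normal_density 0 \<sigma> x)"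
    using \<sigma> by (intro integrable_mult_right integrable_normal_density)
  then show "integrable lborel (\<lambda>x. exp (- x\<^sup>2 / (2 * \<sigma>\<^sup>2)))"
    using \<sigma> by (simp add: normal_density_def)
  let ?f = "\<lambda>x. of_real (exp (- x\<^sup>2 / (2 * \<sigma>\<^sup>2))) * cis (x * z)"
  have "(\<integral>x. ?f x \<partial>lborel) = \<sigma> *\<^sub>R (\<integral>x. ?f (0 + \<sigma> * x) \<partial>lborel)"
    using \<sigma> lborel_integral_real_affine[of \<sigma> ?f 0] by simp
  also have "(\<integral>x. ?f (0 + \<sigma> * x) \<partial>lborel) = (\<integral>x. of_real (sqrt (2 * pi)) * (std_normal_density x *\<^sub>R iexp (\<sigma> * z * x)) \<partial>lborel)"
  proof (intro Bochner_Integration.integral_cong refl)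
    fix x
    have "?f (0 + \<sigma> * x) = of_real (exp (- x\<^sup>2 / 2)) * iexp (\<sigma> * z * x)"
      using \<sigma> by (simp add: power_mult_distrib cis_conv_exp mult_ac)
    also have "\<dots> = of_real (sqrt (2 * pi)) * (std_normal_density x *\<^sub>R iexp (\<sigma> * z * x))"
      unfolding std by (simp add: scaleR_conv_of_real del: real_sqrt_mult of_real_mult)
    finally show "?f (0 + \<sigma> * x) = of_real (sqrt (2 * pi)) * (std_normal_density x *\<^sub>R iexp (\<sigma> * z * x))" .
  qed
  also have "\<dots> = of_real (sqrt (2 * pi)) * char std_normal_distribution (\<sigma> * z)"
    unfolding integral_mult_right_zero by (simp add: char_def integral_density)
  also have "char std_normal_distribution (\<sigma> * z) = of_real (exp (- (\<sigma>\<^sup>2 * z\<^sup>2) / 2))"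
    by (simp add: char_std_normal_distribution power_mult_distrib)
  finally show "(\<integral>x. ?f x \<partial>lborel) = of_real (sqrt (2 * pi) * \<sigma> * exp (- (\<sigma>\<^sup>2 * z\<^sup>2) / 2))"
    by (simp add: scaleR_conv_of_real mult_ac)
qed

text \<open>\<open>gauss s\<close> damps frequencies and tends to 1 as s tends to 0;
  \<open>heat s\<close>, the planar normal density with standard deviation \<open>s\<close> in each
  coordinate, is its inverse transform up to the factor 2 pi.\<close>

definition gauss :: "real \<Rightarrow> real \<times> real \<Rightarrow> real" where
  "gauss s p = exp (- (s\<^sup>2 * (norm p)\<^sup>2) / 2)"

definition heat :: "real \<Rightarrow> real \<times> real \<Rightarrow> real" where
  "heat s p = 1 / (2 * pi * s\<^sup>2) * exp (- (norm p)\<^sup>2 / (2 * s\<^sup>2))"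

lemma norm_pair_sq: "(norm (x::real, t::real))\<^sup>2 = x\<^sup>2 + t\<^sup>2"
  by (simp add: norm_Pair)

lemma borel_measurable_gauss [measurable]: "gauss s \<in> borel_measurable borel"
  unfolding gauss_def[abs_def] by measurable

lemma borel_measurable_heat [measurable]: "heat s \<in> borel_measurable borel"
  unfolding heat_def[abs_def] by measurable

lemma gauss_bounds: "0 < gauss s p" "gauss s p \<le> 1"
  by (auto simp: gauss_def)

lemma heat_nonneg: "0 \<le> heat s p"
  by (simp add: heat_def)

lemma fourier_gauss:
  assumes s: "0 < s"
  shows "integrable lborel (gauss s)"
    and "fourier (\<lambda>p. of_real (gauss s p)) q = of_real (2 * pi * heat s q)"
proof -
  define g where "g x = exp (- x\<^sup>2 / (2 * (1 / s)\<^sup>2))" for x :: real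
  have g: "integrable lborel g"
    using gaussian_fourier_1D(1)[of "1 / s"] s by (simp add: g_def[abs_def])
  have gg: "gauss s p = g (fst p) * g (snd p)" for p
    using s by (cases p) (simp add: gauss_def norm_pair_sq g_def exp_add[symmetric] field_simps)
  have "integrable (lborel \<Otimes>\<^sub>M lborel) (\<lambda>(x, y). g x * g y)" by (rule integrable_pair_mult[OF g g])
  then show "integrable lborel (gauss s)"
    by (simp add: lborel_prod gg[abs_def] case_prod_beta')
  obtain a b where q: "q = (a, b)" by (cases q)
  define G where "G c x = of_real (g x) * cis (x * (- c))" for c x :: real
  have G: "integrable lborel (G c)" for c
    unfolding G_def using g by (intro integrable_mult_cis integrable_of_real) auto
  have GI: "(\<integral>x. G c x \<partial>lborel) = of_real (sqrt (2 * pi) / s * exp (- c\<^sup>2 / (2 * s\<^sup>2)))" for c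
    using gaussian_fourier_1D(2)[of "1 / s" "- c"] s
    by (simp add: G_def g_def power_divide mult.commute)
  have "(\<integral>p. of_real (gauss s p) * cis (- (p \<bullet> q)) \<partial>lborel) = (\<integral>p. G a (fst p) * G b (snd p) \<partial>(lborel \<Otimes>\<^sub>M lborel))"
    unfolding lborel_prod
    by (intro Bochner_Integration.integral_cong refl)
      (simp add: gg G_def q inner_prod_def cis_mult algebra_simps)
  also have "\<dots> = (\<integral>x. \<integral>y. G a x * G b y \<partial>lborel \<partial>lborel)"
    using lborel_pair.integral_fst'[OF integrable_pair_mult[OF G G], of a b] by (simp add: case_prod_beta')
  also have "\<dots> = (\<integral>x. G a x \<partial>lborel) * (\<integral>y. G b y \<partial>lborel)"
    by simp
  also have "\<dots> = of_real (2 * pi / s\<^sup>2 * exp (- (norm q)\<^sup>2 / (2 * s\<^sup>2)))"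
  proof -
    have "(sqrt (2 * pi) / s * exp (- a\<^sup>2 / (2 * s\<^sup>2))) * (sqrt (2 * pi) / s * exp (- b\<^sup>2 / (2 * s\<^sup>2)))
        = (sqrt (2 * pi) * sqrt (2 * pi)) / s\<^sup>2 * (exp (- a\<^sup>2 / (2 * s\<^sup>2)) * exp (- b\<^sup>2 / (2 * s\<^sup>2)))"
      by (simp add: power2_eq_square)
    also have "\<dots> = 2 * pi / s\<^sup>2 * exp (- (norm q)\<^sup>2 / (2 * s\<^sup>2))"
      by (simp add: exp_add[symmetric] q norm_pair_sq add_divide_distrib diff_divide_distrib del: real_sqrt_mult)
    finally show ?thesis unfolding GI of_real_mult[symmetric] by simp
  qed
  finally show "fourier (\<lambda>p. of_real (gauss s p)) q = of_real (2 * pi * heat s q)"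
    by (simp add: fourier_eq heat_def power2_eq_square)
qed

lemma heat_eq_gauss: "heat s p = 1 / (2 * pi * s\<^sup>2) * gauss (1 / s) p"
  by (simp add: heat_def gauss_def power_divide)

lemma integrable_heat: "0 < s \<Longrightarrow> integrable lborel (heat s)"
  using fourier_gauss(1)[of "1 / s"] by (simp add: heat_eq_gauss[abs_def])

text \<open>Up to a factor \<open>heat s\<close> is \<open>gauss (1 / s)\<close>, whose integral is
  read off from its transform at frequency 0.\<close>

lemma integral_heat:
  assumes s: "0 < s"
  shows "(\<integral>p. heat s p \<partial>lborel) = 1"
proof -
  have "of_real (1 / (2 * pi) * (\<integral>p. gauss (1 / s) p \<partial>lborel)) = (of_real (2 * pi * heat (1 / s) 0) :: complex)"
    using fourier_gauss(2)[of "1 / s" 0] s by (simp add: fourier_eq)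
  then have "1 / (2 * pi) * (\<integral>p. gauss (1 / s) p \<partial>lborel) = 2 * pi * heat (1 / s) 0"
    unfolding of_real_eq_iff .
  then show ?thesis
    using s by (simp add: heat_eq_gauss[abs_def]) (simp add: gauss_def field_simps)
qed

lemma heat_even: "heat s (- p) = heat s p"
  by (simp add: heat_def)

lemma inv_fourier_gauss_mult:
  assumes h: "integrable lborel h" and s: "0 < s"
  shows "inv_fourier (\<lambda>\<zeta>. of_real (gauss s \<zeta>) * fourier h \<zeta>) p = convolve (heat s) h p"
proof -
  have "inv_fourier (\<lambda>\<zeta>. of_real (gauss s \<zeta>)) q = of_real (2 * pi * heat s q)" for q
    using fourier_gauss(2)[OF s, of "- q"] by (simp add: inv_fourier_def heat_even)
  moreover have "integrable lborel (\<lambda>\<zeta>. complex_of_real (gauss s \<zeta>))"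
    using fourier_gauss(1)[OF s] by (rule integrable_of_real)
  ultimately have "inv_fourier (\<lambda>\<zeta>. of_real (gauss s \<zeta>) * fourier h \<zeta>) p =
      1 / (2 * of_real pi) * (\<integral>q. of_real (2 * pi) * (heat s (p - q) *\<^sub>R h q) \<partial>lborel)"
    using inv_fourier_mult_fourier[OF h, of "\<lambda>\<zeta>. of_real (gauss s \<zeta>)" p]
    by (simp add: scaleR_conv_of_real mult.assoc del: integral_mult_right_zero)
  then show ?thesis unfolding integral_mult_right_zero by (simp add: convolve_def)
qed

lemma integrable_bounded_scaleR:
  fixes h :: "'a \<Rightarrow> 'b::{banach,second_countable_topology}"
  assumes h: "integrable M h" and [measurable]: "k \<in> borel_measurable M" and k: "\<And>x. \<bar>k x\<bar> \<le> c"
  shows "integrable M (\<lambda>x. k x *\<^sub>R h x)"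
proof (rule Bochner_Integration.integrable_bound)
  show "integrable M (\<lambda>x. c *\<^sub>R h x)" using h by (rule integrable_scaleR_right)
  show "(\<lambda>x. k x *\<^sub>R h x) \<in> borel_measurable M" using h by (auto dest: borel_measurable_integrable)
  show "AE x in M. norm (k x *\<^sub>R h x) \<le> norm (c *\<^sub>R h x)"
    using k by (intro always_eventually allI) (auto intro!: mult_right_mono order_trans[OF k])
qed

lemma integrable_heat_mult:
  fixes f :: "real \<times> real \<Rightarrow> 'a::{banach,second_countable_topology}"
  assumes "integrable lborel f" "0 < s"
  shows "integrable lborel (\<lambda>q. heat s (p - q) *\<^sub>R f q)"
proof (rule integrable_bounded_scaleR[OF assms(1)])
  show "\<bar>heat s (p - q)\<bar> \<le> 1 / (2 * pi * s\<^sup>2)" for q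
    using assms(2) by (simp add: heat_def divide_right_mono)
qed auto

text \<open>With the weight \<open>gauss s\<close> the squared norm of the transform equals the
  pairing of \<open>h\<close> with its Gaussian mean, hence is at most \<open>B * B\<close> by
  Cauchy--Schwarz and Young's inequality for a kernel of mass 1. Fatou removes the weight as s tends
  to 0.\<close>

lemma plancherel_le:
  assumes h: "integrable lborel h" and hB: "L2_le h B"
  shows "L2_le (fourier h) B"
proof (rule L2_le_Fatou)
  have [measurable]: "h \<in> borel_measurable borel" using L2_leD[OF hB] by auto
  have B: "0 \<le> B" using L2_leD[OF hB] by auto
  show "fourier h \<in> borel_measurable borel" by measurable
  define s where "s n = 1 / real (Suc n)" for n
  have s: "0 < s n" for n by (simp add: s_def)
  have s0: "s \<longlonglongrightarrow> 0" unfolding s_def[abs_def] by (intro LIMSEQ_Suc lim_1_over_n)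
  show "(\<lambda>n. B) \<longlonglongrightarrow> B" by simp
  show "AE \<zeta> in lborel. (\<lambda>n. sqrt (gauss (s n) \<zeta>) *\<^sub>R fourier h \<zeta>) \<longlonglongrightarrow> fourier h \<zeta>"
  proof (intro always_eventually allI)
    fix \<zeta>
    have "(\<lambda>n. sqrt (gauss (s n) \<zeta>) *\<^sub>R fourier h \<zeta>) \<longlonglongrightarrow> sqrt (exp (- (0\<^sup>2 * (norm \<zeta>)\<^sup>2) / 2)) *\<^sub>R fourier h \<zeta>"
      unfolding gauss_def by (intro tendsto_intros s0) simp
    then show "(\<lambda>n. sqrt (gauss (s n) \<zeta>) *\<^sub>R fourier h \<zeta>) \<longlonglongrightarrow> fourier h \<zeta>" by simp
  qed
  show "L2_le (\<lambda>\<zeta>. sqrt (gauss (s n) \<zeta>) *\<^sub>R fourier h \<zeta>) B" for n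
  proof -
    let ?g = "gauss (s n)" and ?c = "convolve (heat (s n)) h"
    define C where "C = 1 / (2 * pi) * (\<integral>p. norm (h p) \<partial>lborel)"
    have bd: "norm (fourier h \<zeta>) \<le> C" for \<zeta> unfolding C_def by (rule norm_fourier_le[OF h])
    have C: "0 \<le> C" unfolding C_def by simp
    \<comment> \<open>The pairing of the transform of \<open>h\<close> with \<open>W\<close> is the
      weighted squared norm. The weight makes \<open>W\<close> integrable, since the transform of
      \<open>h\<close> is only known to be bounded.\<close>
    define W where "W \<zeta> = of_real (?g \<zeta>) * cnj (fourier h \<zeta>)" for \<zeta>
    have gi: "integrable lborel ?g" by (rule fourier_gauss(1)[OF s])
    have W: "integrable lborel W"
    proof (rule Bochner_Integration.integrable_bound)
      show "integrable lborel (\<lambda>\<zeta>. C *\<^sub>R ?g \<zeta>)" using gi by (rule integrable_scaleR_right)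
      show "W \<in> borel_measurable lborel" unfolding W_def
        by (intro borel_measurable_times borel_measurable_of_real
            borel_measurable_continuous_on[OF continuous_on_cnj[OF continuous_on_id]]) auto
      show "AE \<zeta> in lborel. norm (W \<zeta>) \<le> norm (C *\<^sub>R ?g \<zeta>)"
        using bd C gauss_bounds(1)[of "s n"]
        by (auto simp: W_def norm_mult mult.commute less_imp_le intro!: mult_right_mono always_eventually)
    qed
    have g2: "integrable lborel (\<lambda>\<zeta>. ?g \<zeta> * (norm (fourier h \<zeta>))\<^sup>2)"
    proof (rule Bochner_Integration.integrable_bound)
      show "integrable lborel (\<lambda>\<zeta>. C\<^sup>2 *\<^sub>R ?g \<zeta>)" using gi by (rule integrable_scaleR_right)
      show "AE \<zeta> in lborel. norm (?g \<zeta> * (norm (fourier h \<zeta>))\<^sup>2) \<le> norm (C\<^sup>2 *\<^sub>R ?g \<zeta>)"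
        using bd C gauss_bounds(1)[of "s n"]
        by (auto simp: norm_mult abs_mult mult.commute less_imp_le intro!: mult_right_mono power_mono always_eventually)
    qed measurable
    have FW: "fourier W p = cnj (?c p)" for p
    proof -
      have "fourier W p = cnj (inv_fourier (\<lambda>\<zeta>. of_real (?g \<zeta>) * fourier h \<zeta>) p)"
      proof -
        have "(\<integral>\<zeta>. W \<zeta> * cis (- (\<zeta> \<bullet> p)) \<partial>lborel) =
            (\<integral>\<zeta>. cnj (of_real (?g \<zeta>) * fourier h \<zeta> * cis (p \<bullet> \<zeta>)) \<partial>lborel)"
          by (simp add: W_def cis_cnj inner_commute)
        then show ?thesis unfolding fourier_eq[of W] inv_fourier_eq Bochner_Integration.integral_cnj by simp
      qed
      then show ?thesis by (simp add: inv_fourier_gauss_mult[OF h s])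
    qed
    have cB: "L2_le ?c B"
      using Young_L2(2)[OF integrable_heat[OF s[of n]] heat_nonneg hB] by (simp add: integral_heat[OF s])
    have "of_real (\<integral>\<zeta>. ?g \<zeta> * (norm (fourier h \<zeta>))\<^sup>2 \<partial>lborel) = (\<integral>\<zeta>. fourier h \<zeta> * W \<zeta> \<partial>lborel)"
      unfolding integral_complex_of_real[symmetric]
      by (intro Bochner_Integration.integral_cong refl) (simp add: W_def complex_norm_square mult_ac del: of_real_power)
    also have "\<dots> = (\<integral>p. h p * cnj (?c p) \<partial>lborel)"
      by (simp add: integral_fourier_mult[OF h W] FW)
    finally have eq: "of_real (\<integral>\<zeta>. ?g \<zeta> * (norm (fourier h \<zeta>))\<^sup>2 \<partial>lborel) = (\<integral>p. h p * cnj (?c p) \<partial>lborel)" .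
    have "(\<integral>\<zeta>. ?g \<zeta> * (norm (fourier h \<zeta>))\<^sup>2 \<partial>lborel) \<le> norm (\<integral>p. h p * cnj (?c p) \<partial>lborel)"
      unfolding eq[symmetric] by simp
    also have "\<dots> \<le> (\<integral>p. norm (h p * cnj (?c p)) \<partial>lborel)" by (rule integral_norm_bound)
    also have "\<dots> \<le> B * B" using L2_le_mult_integrable(2)[OF hB cB] by (simp add: norm_mult)
    finally have le: "(\<integral>\<zeta>. ?g \<zeta> * (norm (fourier h \<zeta>))\<^sup>2 \<partial>lborel) \<le> B\<^sup>2" by (simp add: power2_eq_square)
    have "(\<integral>\<^sup>+\<zeta>. ennreal ((norm (sqrt (?g \<zeta>) *\<^sub>R fourier h \<zeta>))\<^sup>2) \<partial>lborel) =
        (\<integral>\<^sup>+\<zeta>. ennreal (?g \<zeta> * (norm (fourier h \<zeta>))\<^sup>2) \<partial>lborel)"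
      using gauss_bounds(1)[of "s n"] by (simp add: power_mult_distrib less_imp_le)
    also have "\<dots> = ennreal (\<integral>\<zeta>. ?g \<zeta> * (norm (fourier h \<zeta>))\<^sup>2 \<partial>lborel)"
      using gauss_bounds(1)[of "s n"] by (intro nn_integral_eq_integral[OF g2]) (auto simp: less_imp_le)
    also have "\<dots> \<le> ennreal (B\<^sup>2)" using le by (rule ennreal_leI)
    finally show ?thesis using B unfolding L2_le_def by (auto intro!: borel_measurable_scaleR)
  qed
qed

lemma inv_plancherel_le:
  assumes h: "integrable lborel h" and hB: "L2_le h B"
  shows "L2_le (inv_fourier h) B"
proof -
  have [measurable]: "h \<in> borel_measurable borel" using L2_leD[OF hB] by auto
  show ?thesis
    using plancherel_le[OF h hB] nn_integral_lborel_reflect[of "\<lambda>q. ennreal ((norm (fourier h q))\<^sup>2)" 0]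
    by (simp add: L2_le_def inv_fourier_def)
qed

section \<open>Gaussian means converge in \<open>L\<^sup>1\<close>\<close>

text \<open>After the substitution the kernel is fixed and \<open>s\<close> enters only through the
  argument of \<open>f\<close>, so the limit s to 0 can be taken under the integral.\<close>

lemma convolve_heat_rescale:
  assumes [measurable]: "f \<in> borel_measurable borel" and s: "0 < s"
  shows "convolve (heat s) f p = (\<integral>q. heat 1 q *\<^sub>R f (p - s *\<^sub>R q) \<partial>lborel)"
proof -
  have "convolve (heat s) f p = (\<integral>q. heat s (p - q) *\<^sub>R f q \<partial>density (distr lborel borel (\<lambda>q. p + (- s) *\<^sub>R q)) (\<lambda>_. ennreal (\<bar>- s\<bar> ^ DIM(real \<times> real))))"
    unfolding convolve_def by (subst lborel_affine[of "- s" p]) (use s in \<open>auto simp: ennreal_power\<close>)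
  also have "\<dots> = (\<integral>q. s\<^sup>2 *\<^sub>R (heat s (s *\<^sub>R q) *\<^sub>R f (p - s *\<^sub>R q)) \<partial>lborel)"
    using s by (subst integral_density) (auto simp: integral_distr power2_eq_square)
  also have "\<dots> = (\<integral>q. heat 1 q *\<^sub>R f (p - s *\<^sub>R q) \<partial>lborel)"
    using s by (intro Bochner_Integration.integral_cong refl) (simp add: heat_def power_mult_distrib)
  finally show ?thesis .
qed

lemma convolve_heat_tendsto_continuous:
  fixes f :: "real \<times> real \<Rightarrow> 'a::{banach,second_countable_topology}"
  assumes f: "continuous_on UNIV f" and bd: "\<And>p. norm (f p) \<le> c"
  shows "(\<lambda>n. convolve (heat (1 / real (Suc n))) f p) \<longlonglongrightarrow> f p"
proof -
  have [measurable]: "f \<in> borel_measurable borel" by (rule borel_measurable_continuous_onI[OF f])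
  have "(\<lambda>n. \<integral>q. heat 1 q *\<^sub>R f (p - (1 / real (Suc n)) *\<^sub>R q) \<partial>lborel) \<longlonglongrightarrow> (\<integral>q. heat 1 q *\<^sub>R f p \<partial>lborel)"
  proof (rule integral_dominated_convergence[where w = "\<lambda>q. heat 1 q * c"])
    show "integrable lborel (\<lambda>q. heat 1 q * c)" by (simp add: integrable_heat)
    show "AE q in lborel. (\<lambda>n. heat 1 q *\<^sub>R f (p - (1 / real (Suc n)) *\<^sub>R q)) \<longlonglongrightarrow> heat 1 q *\<^sub>R f p"
    proof (intro always_eventually allI)
      fix q
      have "(\<lambda>n. p - (1 / real (Suc n)) *\<^sub>R q) \<longlonglongrightarrow> p - 0 *\<^sub>R q"
        by (intro tendsto_intros LIMSEQ_Suc lim_1_over_n)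
      then have "(\<lambda>n. f (p - (1 / real (Suc n)) *\<^sub>R q)) \<longlonglongrightarrow> f p"
        using continuous_on_tendsto_compose[OF f, of "\<lambda>n. p - (1 / real (Suc n)) *\<^sub>R q" p sequentially] by simp
      then show "(\<lambda>n. heat 1 q *\<^sub>R f (p - (1 / real (Suc n)) *\<^sub>R q)) \<longlonglongrightarrow> heat 1 q *\<^sub>R f p"
        by (intro tendsto_intros)
    qed
    show "AE q in lborel. norm (heat 1 q *\<^sub>R f (p - (1 / real (Suc n)) *\<^sub>R q)) \<le> heat 1 q * c" for n
    proof (intro always_eventually allI)
      fix q show "norm (heat 1 q *\<^sub>R f (p - (1 / real (Suc n)) *\<^sub>R q)) \<le> heat 1 q * c"
        unfolding norm_scaleR abs_of_nonneg[OF heat_nonneg] by (intro mult_left_mono bd heat_nonneg)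
    qed
  qed auto
  also have "(\<integral>q. heat 1 q *\<^sub>R f p \<partial>lborel) = f p"
    by (simp add: integral_heat integrable_heat)
  finally show ?thesis by (simp add: convolve_heat_rescale)
qed

text \<open>The L1 distance from \<open>f\<close> to its Gaussian mean. The functions for which it
  tends to 0 are shown to be closed under L1 limits and to contain enough functions; a sequence of
  widths suffices for extracting an almost everywhere convergent subsequence.\<close>

definition heat_error :: "(real \<times> real \<Rightarrow> 'a::{banach,second_countable_topology}) \<Rightarrow> nat \<Rightarrow> real" where
  "heat_error f n = (\<integral>p. norm (convolve (heat (1 / real (Suc n))) f p - f p) \<partial>lborel)"

lemma integrable_heat_error:
  assumes "integrable lborel f"
  shows "integrable lborel (\<lambda>p. convolve (heat (1 / real (Suc n))) f p - f p)"
  using Young_L1(1)[OF integrable_heat heat_nonneg assms, of "1 / real (Suc n)"] assms by auto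

lemma heat_contraction:
  assumes f: "integrable lborel f" and s: "0 < s"
  shows "(\<integral>p. norm (convolve (heat s) f p) \<partial>lborel) \<le> (\<integral>p. norm (f p) \<partial>lborel)"
proof -
  have i: "integrable lborel (convolve (heat s) f)"
    by (rule Young_L1(1)[OF integrable_heat[OF s] heat_nonneg f])
  have "ennreal (\<integral>p. norm (convolve (heat s) f p) \<partial>lborel) \<le> ennreal (\<integral>p. norm (f p) \<partial>lborel)"
    using Young_L1(2)[OF integrable_heat[OF s] heat_nonneg f] i f
    by (simp add: integral_heat[OF s] nn_integral_eq_integral)
  then show ?thesis by (subst (asm) ennreal_le_iff) auto
qed

text \<open>Averaging is an L1 contraction, so replacing \<open>f\<close> by \<open>g\<close> costs
  their distance twice: once for the functions and once for their means.\<close>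

lemma heat_error_diff:
  assumes f: "integrable lborel f" and g: "integrable lborel g"
  shows "heat_error f n \<le> heat_error g n + 2 * (\<integral>p. norm (f p - g p) \<partial>lborel)"
proof -
  let ?s = "1 / real (Suc n)"
  have fg: "integrable lborel (\<lambda>p. f p - g p)" using f g by auto
  have lin: "convolve (heat ?s) (\<lambda>p. f p - g p) p = convolve (heat ?s) f p - convolve (heat ?s) g p" for p
    using integrable_heat_mult[OF f, of ?s p] integrable_heat_mult[OF g, of ?s p]
    by (simp add: convolve_def scaleR_diff_right)
  have ci: "integrable lborel (convolve (heat ?s) (\<lambda>p. f p - g p))"
    by (rule Young_L1(1)[OF integrable_heat heat_nonneg fg]) simp
  have "heat_error f n \<le> (\<integral>p. norm (convolve (heat ?s) g p - g p) + (norm (convolve (heat ?s) (\<lambda>p. f p - g p) p) + norm (f p - g p)) \<partial>lborel)"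
    unfolding heat_error_def
  proof (intro integral_mono)
    fix p
    have "convolve (heat ?s) f p - f p = (convolve (heat ?s) g p - g p) + (convolve (heat ?s) (\<lambda>p. f p - g p) p - (f p - g p))"
      unfolding lin by simp
    then show "norm (convolve (heat ?s) f p - f p) \<le> norm (convolve (heat ?s) g p - g p) + (norm (convolve (heat ?s) (\<lambda>p. f p - g p) p) + norm (f p - g p))"
      using norm_triangle_ineq4 by (auto intro: norm_triangle_mono simp only:)
  next
    show "integrable lborel (\<lambda>p. norm (convolve (heat ?s) f p - f p))"
      by (intro integrable_norm integrable_heat_error f)
    show "integrable lborel (\<lambda>p. norm (convolve (heat ?s) g p - g p) + (norm (convolve (heat ?s) (\<lambda>p. f p - g p) p) + norm (f p - g p)))"
      by (intro Bochner_Integration.integrable_add integrable_norm integrable_heat_error g ci fg)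
  qed
  also have "\<dots> = heat_error g n + ((\<integral>p. norm (convolve (heat ?s) (\<lambda>p. f p - g p) p) \<partial>lborel) + (\<integral>p. norm (f p - g p) \<partial>lborel))"
    unfolding heat_error_def
    by (subst Bochner_Integration.integral_add; (intro Bochner_Integration.integrable_add integrable_norm integrable_heat_error g ci fg)?)
      (subst Bochner_Integration.integral_add; (intro integrable_norm ci fg refl)?)
  also have "\<dots> \<le> heat_error g n + ((\<integral>p. norm (f p - g p) \<partial>lborel) + (\<integral>p. norm (f p - g p) \<partial>lborel))"
    using heat_contraction[OF fg, of ?s] by simp
  finally show ?thesis by simp
qed

lemma heat_error_nonneg: "0 \<le> heat_error f n"
  by (simp add: heat_error_def)

lemma heat_error_closed:
  assumes f: "integrable lborel f"
    and ap: "\<And>e. 0 < e \<Longrightarrow> \<exists>g. integrable lborel g \<and> heat_error g \<longlonglongrightarrow> 0 \<and> (\<integral>p. norm (f p - g p) \<partial>lborel) < e"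
  shows "heat_error f \<longlonglongrightarrow> 0"
proof (rule order_tendstoI)
  fix e :: real assume e: "0 < e"
  obtain g where g: "integrable lborel g" "heat_error g \<longlonglongrightarrow> 0" "(\<integral>p. norm (f p - g p) \<partial>lborel) < e / 3"
    using ap[of "e / 3"] e by auto
  have "\<forall>\<^sub>F n in sequentially. heat_error g n < e / 3" using g(2) e by (intro order_tendstoD) auto
  then show "\<forall>\<^sub>F n in sequentially. heat_error f n < e"
  proof eventually_elim
    case (elim n)
    then show ?case using heat_error_diff[OF f g(1), of n] g(3) by linarith
  qed
next
  fix e :: real assume e: "e < 0"
  show "\<forall>\<^sub>F n in sequentially. e < heat_error f n"
    by (intro always_eventually allI) (use e heat_error_nonneg in \<open>auto intro: less_le_trans\<close>)
qed

text \<open>The domination by \<open>2 * norm (f p)\<close> is the form in which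
  \<open>integrable_induct\<close> supplies approximating sequences.\<close>

lemma heat_error_limit:
  fixes f :: "real \<times> real \<Rightarrow> 'a::{banach,second_countable_topology}"
  assumes g: "\<And>j::nat. integrable lborel (g j)" "\<And>j. heat_error (g j) \<longlonglongrightarrow> 0" and f: "integrable lborel f"
    and lim: "\<And>p. (\<lambda>j. g j p) \<longlonglongrightarrow> f p" and w: "\<And>j p. norm (g j p) \<le> 2 * norm (f p)"
  shows "heat_error f \<longlonglongrightarrow> 0"
proof (rule heat_error_closed[OF f])
  fix e :: real assume e: "0 < e"
  have "(\<lambda>j. \<integral>p. norm (f p - g j p) \<partial>lborel) \<longlonglongrightarrow> (\<integral>p. norm (f p - f p) \<partial>lborel)"
  proof (rule integral_dominated_convergence[where w = "\<lambda>p. 3 * norm (f p)"])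
    show "AE p in lborel. (\<lambda>j. norm (f p - g j p)) \<longlonglongrightarrow> norm (f p - f p)"
      by (intro always_eventually allI tendsto_intros lim)
    show "AE p in lborel. norm (norm (f p - g j p)) \<le> 3 * norm (f p)" for j
    proof (intro always_eventually allI)
      fix p show "norm (norm (f p - g j p)) \<le> 3 * norm (f p)"
        using norm_triangle_ineq4[of "f p" "g j p"] w[of j p] by simp
    qed
  qed (use f g in \<open>auto dest: borel_measurable_integrable\<close>)
  then have "\<forall>\<^sub>F j in sequentially. (\<integral>p. norm (f p - g j p) \<partial>lborel) < e"
    using e by (intro order_tendstoD(2)) auto
  then obtain j where "(\<integral>p. norm (f p - g j p) \<partial>lborel) < e" by (meson eventually_sequentially order_refl)
  with g show "\<exists>g. integrable lborel g \<and> heat_error g \<longlonglongrightarrow> 0 \<and> (\<integral>p. norm (f p - g p) \<partial>lborel) < e" by blast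
qed

text \<open>The means converge pointwise and their L1 norms do not exceed that of \<open>f\<close>;
  Scheffe's lemma turns this into L1 convergence.\<close>

lemma heat_error_continuous:
  fixes f :: "real \<times> real \<Rightarrow> 'a::{banach,second_countable_topology}"
  assumes f: "integrable lborel f" and c: "continuous_on UNIV f" and bd: "\<And>p. norm (f p) \<le> c"
  shows "heat_error f \<longlonglongrightarrow> 0"
proof -
  have "(\<lambda>n. \<integral>\<^sup>+p. norm (convolve (heat (1 / real (Suc n))) f p - f p) \<partial>lborel) \<longlonglongrightarrow> 0"
  proof (rule Scheffe_lemma2)
    show "AE p in lborel. (\<lambda>n. convolve (heat (1 / real (Suc n))) f p) \<longlonglongrightarrow> f p"
      by (intro always_eventually allI convolve_heat_tendsto_continuous[OF c bd])
    show "(\<integral>\<^sup>+p. norm (convolve (heat (1 / real (Suc n))) f p) \<partial>lborel) \<le> (\<integral>\<^sup>+p. norm (f p) \<partial>lborel)" for n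
      using Young_L1(2)[OF integrable_heat heat_nonneg f, of "1 / real (Suc n)"] by (simp add: integral_heat)
  qed (use f in \<open>auto dest: borel_measurable_integrable\<close>)
  then have "(\<lambda>n. ennreal (heat_error f n)) \<longlonglongrightarrow> ennreal 0"
    using integrable_heat_error[OF f] by (simp add: heat_error_def nn_integral_eq_integral)
  then show ?thesis by (subst (asm) tendsto_ennreal_iff) (auto simp: heat_error_nonneg)
qed

text \<open>The indicator is the pointwise limit of the continuous functions obtained by capping
  multiples of the distance to the complement at 1.\<close>

lemma heat_error_open:
  fixes c :: "'a::{banach,second_countable_topology}"
  assumes T: "open T" and fin: "emeasure lborel T < \<infinity>"
  shows "heat_error (\<lambda>p. indicator T p *\<^sub>R c) \<longlonglongrightarrow> 0"
proof -
  have [measurable]: "T \<in> sets borel" using T by simp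
  \<comment> \<open>The distance to the empty set is 0 by convention, so the functions
    \<open>g j\<close> would all vanish if \<open>T\<close> were the whole plane; its finite measure
    excludes this.\<close>
  have ne: "- T \<noteq> {}"
  proof (rule notI)
    assume "- T = {}"
    then have "T = UNIV" by auto
    with fin show False by (simp add: emeasure_lborel_UNIV)
  qed
  define g where "g j p = min 1 (real j * infdist p (- T)) *\<^sub>R c" for j :: nat and p
  have cont: "continuous_on UNIV (g j)" for j
    unfolding g_def by (intro continuous_intros)
  have [measurable]: "g j \<in> borel_measurable borel" for j by (rule borel_measurable_continuous_onI[OF cont])
  have le: "norm (g j p) \<le> norm (indicator T p *\<^sub>R c)" for j p
    using infdist_nonneg[of p "- T"] by (cases "p \<in> T") (auto simp: g_def mult_left_le_one_le)
  have int: "integrable lborel (\<lambda>p. indicator T p *\<^sub>R c)"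
    using fin by (intro integrable_scaleR_left) auto
  have gi: "integrable lborel (g j)" for j
    by (rule Bochner_Integration.integrable_bound[OF int]) (use le in auto)
  have he: "heat_error (g j) \<longlonglongrightarrow> 0" for j
  proof (rule heat_error_continuous[OF gi cont])
    show "norm (g j p) \<le> norm c" for p
      using le[of j p] by (cases "p \<in> T") (auto intro: order_trans)
  qed
  have dom: "norm (g j p) \<le> 2 * norm (indicator T p *\<^sub>R c)" for j p
    using le[of j p] norm_ge_zero[of "indicator T p *\<^sub>R c"] by linarith
  have lim: "(\<lambda>j. g j p) \<longlonglongrightarrow> indicator T p *\<^sub>R c" for p
  proof (cases "p \<in> T")
    case True
    then have d: "0 < infdist p (- T)"
      using infdist_pos_not_in_closed[of "- T" p] T ne by auto
    have "\<forall>\<^sub>F j in sequentially. g j p = c"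
    proof -
      obtain N :: nat where N: "1 / infdist p (- T) < real N" using reals_Archimedean2 by blast
      show ?thesis
      proof (rule eventually_sequentiallyI[of N])
        fix j assume "N \<le> j"
        then have "1 / infdist p (- T) \<le> real j" using N by linarith
        then have "1 \<le> real j * infdist p (- T)" using d by (simp add: field_simps)
        then show "g j p = c" by (simp add: g_def)
      qed
    qed
    then show ?thesis using True by (simp add: tendsto_eventually)
  qed (simp add: g_def)
  show ?thesis by (rule heat_error_limit[of g, OF gi he int lim dom])
qed

text \<open>Induction over integrable functions; outer regularity replaces the indicator of a Borel
  set by that of an open set of finite measure.\<close>

lemma heat_error_tendsto_0:
  fixes f :: "real \<times> real \<Rightarrow> 'a::{banach,second_countable_topology}"
  assumes "integrable lborel f"
  shows "heat_error f \<longlonglongrightarrow> 0"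
  using assms
proof (induction rule: integrable_induct)
  case (base A c)
  show ?case
  proof (rule heat_error_closed)
    have [measurable]: "A \<in> sets borel" using base by simp
    show "integrable lborel (\<lambda>p. indicator A p *\<^sub>R c)"
      using base by (intro integrable_scaleR_left) simp
    fix e :: real assume e: "0 < e"
    \<comment> \<open>The summand 1 covers \<open>c = 0\<close> and makes the final estimate
      strict.\<close>
    define d where "d = e / (norm c + 1)"
    have d: "0 < d" using e by (simp add: d_def add_nonneg_pos)
    obtain T where T: "open T" "A \<subseteq> T" "emeasure lebesgue (T - A) < ennreal d"
      using sets_lebesgue_outer_open[OF sets_completionI_sets[OF base(1)] d] by metis
    have [measurable]: "T \<in> sets borel" using T by simp
    have TA: "emeasure lborel (T - A) < ennreal d"
      using T(3) by (simp add: emeasure_completion)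
    have "emeasure lborel T \<le> emeasure lborel A + emeasure lborel (T - A)"
      using T(2) emeasure_subadditive[of A lborel "T - A"] by (simp add: Un_absorb1 Un_Diff_cancel)
    also have "\<dots> < \<infinity>" using base TA by (auto simp: ennreal_add_less_top intro: order.strict_trans)
    finally have fin: "emeasure lborel T < \<infinity>" .
    have "(\<integral>p. norm (indicator A p *\<^sub>R c - indicator T p *\<^sub>R c) \<partial>lborel) = (\<integral>p. indicator (T - A) p * norm c \<partial>lborel)"
      using T(2) by (intro Bochner_Integration.integral_cong refl) (auto simp: indicator_def)
    also have "\<dots> = measure lborel (T - A) * norm c"
      by simp
    also have "\<dots> \<le> d * norm c"
    proof (intro mult_right_mono)
      have "measure lborel (T - A) \<le> enn2real (ennreal d)"
        unfolding measure_def using TA d by (intro enn2real_mono) auto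
      then show "measure lborel (T - A) \<le> d" using d by simp
    qed auto
    also have "\<dots> < d * (norm c + 1)" using d by simp
    also have "\<dots> = e"
    proof -
      have "norm c + 1 \<noteq> 0" using norm_ge_zero[of c] by linarith
      then show ?thesis by (simp add: d_def)
    qed
    finally have lt: "(\<integral>p. norm (indicator A p *\<^sub>R c - indicator T p *\<^sub>R c) \<partial>lborel) < e" .
    have "integrable lborel (\<lambda>p. indicator T p *\<^sub>R c)"
      using fin by (intro integrable_scaleR_left) auto
    with lt heat_error_open[OF T(1) fin, of c]
    show "\<exists>g. integrable lborel g \<and> heat_error g \<longlonglongrightarrow> 0 \<and> (\<integral>p. norm (indicator A p *\<^sub>R c - g p) \<partial>lborel) < e"
      by blast
  qed
next
  case (add f g)
  have fg: "integrable lborel (\<lambda>p. f p + g p)" using add by auto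
  have le: "heat_error (\<lambda>p. f p + g p) n \<le> heat_error f n + heat_error g n" for n
  proof -
    let ?s = "1 / real (Suc n)"
    have lin: "convolve (heat ?s) (\<lambda>p. f p + g p) p = convolve (heat ?s) f p + convolve (heat ?s) g p" for p
      using integrable_heat_mult[of f ?s p] integrable_heat_mult[of g ?s p] add
      by (simp add: convolve_def scaleR_add_right)
    have "heat_error (\<lambda>p. f p + g p) n \<le> (\<integral>p. norm (convolve (heat ?s) f p - f p) + norm (convolve (heat ?s) g p - g p) \<partial>lborel)"
      unfolding heat_error_def
    proof (intro integral_mono)
      fix p
      have "convolve (heat ?s) (\<lambda>p. f p + g p) p - (f p + g p) = (convolve (heat ?s) f p - f p) + (convolve (heat ?s) g p - g p)"
        unfolding lin by simp
      then show "norm (convolve (heat ?s) (\<lambda>p. f p + g p) p - (f p + g p)) \<le> norm (convolve (heat ?s) f p - f p) + norm (convolve (heat ?s) g p - g p)"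
        by (simp only: norm_triangle_ineq)
    next
      show "integrable lborel (\<lambda>p. norm (convolve (heat ?s) (\<lambda>p. f p + g p) p - (f p + g p)))"
        by (intro integrable_norm integrable_heat_error fg)
      show "integrable lborel (\<lambda>p. norm (convolve (heat ?s) f p - f p) + norm (convolve (heat ?s) g p - g p))"
        by (intro Bochner_Integration.integrable_add integrable_norm integrable_heat_error add)
    qed
    also have "\<dots> = heat_error f n + heat_error g n"
      unfolding heat_error_def
      by (intro Bochner_Integration.integral_add integrable_norm integrable_heat_error add)
    finally show ?thesis .
  qed
  have "(\<lambda>n. heat_error f n + heat_error g n) \<longlonglongrightarrow> 0"
    using tendsto_add[OF add.IH] by simp
  then show ?case
    by (rule tendsto_sandwich[OF _ _ tendsto_const, rotated 2])
      (intro always_eventually allI le heat_error_nonneg)+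
next
  case (lim f s)
  show ?case by (rule heat_error_limit[of s]) (use lim in auto)
qed

section \<open>The Fourier transform of the kernels\<close>

text \<open>An entire function has a primitive on the convex set \<open>UNIV\<close>. Its odd part
  is again a primitive of the even function \<open>exp (- z\<^sup>2)\<close>, and oddness fixes the
  constant of integration.\<close>

lemma complex_erf_exists:
  obtains E :: "complex \<Rightarrow> complex" where
    "\<And>z. (E has_field_derivative exp (- z\<^sup>2)) (at z)" "\<And>z. E (- z) = - E z"
proof -
  have "(\<lambda>z::complex. exp (- z\<^sup>2)) holomorphic_on UNIV" by (intro holomorphic_intros)
  then have "\<exists>G :: complex \<Rightarrow> complex. \<forall>z. (G has_field_derivative exp (- z\<^sup>2)) (at z)"
  proof (rule holomorphic_convex_primitive'[OF convex_UNIV open_UNIV])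
    fix G :: "complex \<Rightarrow> complex"
    assume "\<And>z. z \<in> UNIV \<Longrightarrow> (G has_field_derivative exp (- z\<^sup>2)) (at z)"
    then have "\<forall>z. (G has_field_derivative exp (- z\<^sup>2)) (at z)" by simp
    then show ?thesis by (intro exI[of _ G])
  qed
  then obtain G :: "complex \<Rightarrow> complex" where G: "\<And>z. (G has_field_derivative exp (- z\<^sup>2)) (at z)" by blast
  define E where "E z = (G z - G (- z)) / 2" for z
  show thesis
  proof
    show "E (- z) = - E z" for z by (simp add: E_def field_simps)
    show "(E has_field_derivative exp (- z\<^sup>2)) (at z)" for z
    proof -
      have "((\<lambda>z. - z) has_field_derivative - 1) (at z)" by (auto intro!: derivative_eq_intros)
      then have "((\<lambda>z. G (- z)) has_field_derivative exp (- (- z)\<^sup>2) * (- 1)) (at z)"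
        by (rule DERIV_chain2[where f = G and g = "\<lambda>z. - z" and x = z and Db = "- 1", OF G])
      then have 2: "((\<lambda>z. G (- z)) has_field_derivative exp (- z\<^sup>2) * (- 1)) (at z)" by simp
      show ?thesis unfolding E_def
        by (rule derivative_eq_intros G 2 | simp)+
    qed
  qed
qed

lemma complex_erf_limit_real:
  fixes E :: "complex \<Rightarrow> complex"
  assumes E: "\<And>z. (E has_field_derivative exp (- z\<^sup>2)) (at z)" and odd: "\<And>z. E (- z) = - E z"
  shows "((\<lambda>x. E (of_real x)) \<longlongrightarrow> of_real (sqrt pi / 2)) at_top"
proof -
  let ?f = "\<lambda>x::real. indicator {0..} x *\<^sub>R exp (- x\<^sup>2)"
  have hb: "has_bochner_integral lborel ?f (sqrt pi / 2)" by (rule gaussian_moment_0)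
  then have i: "integrable lborel ?f" and v: "integral\<^sup>L lborel ?f = sqrt pi / 2"
    by (auto simp: has_bochner_integral_iff)
  have "((\<lambda>y. \<integral>x. indicator {..y} x *\<^sub>R ?f x \<partial>lborel) \<longlongrightarrow> sqrt pi / 2) at_top"
    using tendsto_integral_at_top[OF _ i] unfolding v by simp
  then have "((\<lambda>y. complex_of_real (\<integral>x. indicator {..y} x *\<^sub>R ?f x \<partial>lborel)) \<longlongrightarrow> of_real (sqrt pi / 2)) at_top"
    by (rule tendsto_of_real)
  moreover have "\<forall>\<^sub>F y in at_top. complex_of_real (\<integral>x. indicator {..y} x *\<^sub>R ?f x \<partial>lborel) = E (of_real y)"
    using eventually_ge_at_top[of 0]
  proof eventually_elim
    case (elim y)
    have E0: "E 0 = 0" using odd[of 0] by simp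
    have "complex_of_real (\<integral>x. indicator {..y} x *\<^sub>R ?f x \<partial>lborel) = (\<integral>x. indicator {0..y} x *\<^sub>R complex_of_real (exp (- x\<^sup>2)) \<partial>lborel)"
      unfolding integral_complex_of_real[symmetric]
      by (intro Bochner_Integration.integral_cong refl) (auto simp: indicator_def)
    also have "\<dots> = E (of_real y) - E (of_real 0)"
    proof (rule integral_FTC_atLeastAtMost[OF elim])
      fix x :: real
      have "((\<lambda>x. E (of_real x)) has_vector_derivative exp (- (of_real x)\<^sup>2)) (at x within {0..y})"
        using has_vector_derivative_real_field[OF E[of "of_real x"]] by (rule has_vector_derivative_at_within)
      then show "((\<lambda>x. E (of_real x)) has_vector_derivative complex_of_real (exp (- x\<^sup>2))) (at x within {0..y})"
        by (simp add: exp_of_real[symmetric])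
    qed (intro continuous_intros)
    finally show ?case by (simp add: E0)
  qed
  ultimately show ?thesis by (rule Lim_transform_eventually)
qed

text \<open>\<open>E z\<close> is compared with \<open>E (Re z)\<close> along the vertical segment
  between the points. There the derivative has modulus at most
  \<open>exp (- (1 - \<mu>\<^sup>2) * (Re z)\<^sup>2)\<close> by the sector condition, which beats
  the length of the segment, at most \<open>\<mu> * Re z\<close>.\<close>

lemma complex_erf_limit:
  fixes E :: "complex \<Rightarrow> complex"
  assumes E: "\<And>z. (E has_field_derivative exp (- z\<^sup>2)) (at z)" and odd: "\<And>z. E (- z) = - E z"
    and \<kappa>: "\<kappa> < 1"
    and sector: "\<forall>\<^sub>F t in F. \<bar>Im (\<phi> t)\<bar> \<le> \<kappa> * Re (\<phi> t)"
    and Re: "filterlim (\<lambda>t. Re (\<phi> t)) at_top F"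
  shows "((\<lambda>t. E (\<phi> t)) \<longlongrightarrow> of_real (sqrt pi / 2)) F"
proof -
  \<comment> \<open>\<open>\<kappa>\<close> may be negative, while the squares compared below need a
    nonnegative slope.\<close>
  define \<mu> where "\<mu> = max 0 \<kappa>"
  have \<mu>: "0 \<le> \<mu>" "\<mu> < 1" "\<kappa> \<le> \<mu>" using \<kappa> by (auto simp: \<mu>_def)
  have c: "0 < 1 - \<mu>\<^sup>2" using \<mu> by (simp add: abs_square_less_1)
  have bound: "norm (E z - E (of_real (Re z))) \<le> \<mu> * Re z * exp (- (1 - \<mu>\<^sup>2) * (Re z)\<^sup>2)"
    if z: "\<bar>Im z\<bar> \<le> \<kappa> * Re z" "0 \<le> Re z" for z
  proof -
    let ?x = "Re z"
    have y: "\<bar>Im z\<bar> \<le> \<mu> * ?x" using z \<mu> by (meson mult_right_mono order_trans)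
    have "norm (E z - E (of_real ?x)) \<le> exp (- (1 - \<mu>\<^sup>2) * ?x\<^sup>2) * norm (z - of_real ?x)"
    proof (rule field_differentiable_bound)
      show "convex (closed_segment (of_real ?x) z)" by simp
      show "(E has_field_derivative exp (- u\<^sup>2)) (at u within closed_segment (of_real ?x) z)" for u
        using E by (rule has_field_derivative_at_within)
      fix u assume "u \<in> closed_segment (of_real ?x) z"
      then obtain s where s: "0 \<le> s" "s \<le> 1" "u = (1 - s) *\<^sub>R of_real ?x + s *\<^sub>R z"
        by (auto simp: closed_segment_def)
      have ru: "Re u = ?x" and iu: "Im u = s * Im z" unfolding s(3) by (auto simp: algebra_simps)
      have "\<bar>Im u\<bar> \<le> \<bar>Im z\<bar>" using s by (simp add: iu abs_mult mult_left_le_one_le)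
      then have "(Im u)\<^sup>2 \<le> (\<mu> * ?x)\<^sup>2" using y by (intro power2_mono) auto
      then have "- ?x\<^sup>2 + (Im u)\<^sup>2 \<le> - (1 - \<mu>\<^sup>2) * ?x\<^sup>2" by (simp add: power_mult_distrib algebra_simps)
      moreover have "Re (- u\<^sup>2) = - ?x\<^sup>2 + (Im u)\<^sup>2" by (simp add: Re_power2 ru)
      ultimately show "norm (exp (- u\<^sup>2)) \<le> exp (- (1 - \<mu>\<^sup>2) * ?x\<^sup>2)" by simp
    qed auto
    also have "norm (z - of_real ?x) = \<bar>Im z\<bar>"
      by (simp add: norm_complex_def)
    also have "exp (- (1 - \<mu>\<^sup>2) * ?x\<^sup>2) * \<bar>Im z\<bar> \<le> exp (- (1 - \<mu>\<^sup>2) * ?x\<^sup>2) * (\<mu> * ?x)"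
      using y by (intro mult_left_mono) auto
    finally show ?thesis by (simp add: mult_ac)
  qed
  have "((\<lambda>x. \<mu> * x * exp (- (1 - \<mu>\<^sup>2) * x\<^sup>2)) \<longlongrightarrow> 0) at_top"
    using c by real_asymp
  then have l0: "((\<lambda>t. \<mu> * Re (\<phi> t) * exp (- (1 - \<mu>\<^sup>2) * (Re (\<phi> t))\<^sup>2)) \<longlongrightarrow> 0) F"
    by (rule filterlim_compose[OF _ Re])
  have "\<forall>\<^sub>F t in F. 0 \<le> Re (\<phi> t)"
    using Re by (auto simp: filterlim_at_top)
  with sector have "\<forall>\<^sub>F t in F. norm (E (\<phi> t) - E (of_real (Re (\<phi> t)))) \<le> \<mu> * Re (\<phi> t) * exp (- (1 - \<mu>\<^sup>2) * (Re (\<phi> t))\<^sup>2)"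
    by eventually_elim (rule bound)
  then have "((\<lambda>t. E (\<phi> t) - E (of_real (Re (\<phi> t)))) \<longlongrightarrow> 0) F"
    by (rule Lim_null_comparison[OF _ l0])
  moreover have "((\<lambda>t. E (of_real (Re (\<phi> t)))) \<longlongrightarrow> of_real (sqrt pi / 2)) F"
    by (rule filterlim_compose[OF complex_erf_limit_real[OF E odd] Re])
  ultimately have "((\<lambda>t. (E (\<phi> t) - E (of_real (Re (\<phi> t)))) + E (of_real (Re (\<phi> t)))) \<longlongrightarrow> 0 + of_real (sqrt pi / 2)) F"
    by (rule tendsto_add)
  then show ?thesis by simp
qed

text \<open>Up to the factor \<open>2 * sqrt pi\<close> the density of the one-sided stable law of
  index 1/2. It is what remains of \<open>kernel_S\<close>, up to the same factor, after integration
  over x.\<close>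

definition subordinator :: "real \<Rightarrow> real" where
  "subordinator t = (if 0 < t then exp (- 1 / (4 * t)) / (t * sqrt t) else 0)"

lemma borel_measurable_subordinator [measurable]: "subordinator \<in> borel_measurable borel"
  unfolding subordinator_def[abs_def] by measurable

lemma subordinator_nonneg: "0 \<le> subordinator t"
  by (simp add: subordinator_def)

text \<open>Comparison with a multiple of \<open>1 / (sqrt t * (1 + t))\<close>, which has the
  bounded primitive \<open>2 * arctan (sqrt t)\<close>.\<close>

lemma integrable_subordinator: "integrable lborel subordinator"
proof -
  let ?f = "\<lambda>t::real. 1 / (sqrt t * (1 + t))"
  have "set_integrable lborel (einterval (ereal 0) \<infinity>) ?f"
  proof (rule interval_integral_FTC_nonneg)
    show "DERIV (\<lambda>t. 2 * arctan (sqrt t)) t :> ?f t" if "ereal 0 < ereal t" for t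
    proof -
      have "DERIV (\<lambda>t. 2 * arctan (sqrt t)) t :> 2 * (inverse (1 + (sqrt t)\<^sup>2) * (inverse (sqrt t) / 2))"
        using that by (auto intro!: derivative_eq_intros)
      moreover have "2 * (inverse (1 + (sqrt t)\<^sup>2) * (inverse (sqrt t) / 2)) = ?f t"
        using that by (simp add: inverse_eq_divide mult.commute)
      ultimately show ?thesis by simp
    qed
    show "isCont ?f t" if "ereal 0 < ereal t" for t
      using that by (intro continuous_intros) (auto simp: add_pos_pos)
    show "(((\<lambda>t. 2 * arctan (sqrt t)) \<circ> real_of_ereal) \<longlongrightarrow> 0) (at_right (ereal 0))"
      unfolding ereal_tendsto_simps by real_asymp
    show "(((\<lambda>t. 2 * arctan (sqrt t)) \<circ> real_of_ereal) \<longlongrightarrow> pi) (at_left \<infinity>)"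
      unfolding ereal_tendsto_simps by real_asymp
  qed auto
  then have i: "integrable lborel (\<lambda>t. 5 * (indicator (einterval (ereal 0) \<infinity>) t *\<^sub>R ?f t))"
    unfolding set_integrable_def by (rule integrable_mult_right)
  \<comment> \<open>The factor 5 is 4 + 1: 1 is at most \<open>4 * t * exp (1 / (4 * t))\<close> and
    t is at most \<open>t * exp (1 / (4 * t))\<close>.\<close>
  have bd: "subordinator t \<le> 5 * ?f t" if t: "0 < t" for t
  proof -
    have "1 / (4 * t) \<le> exp (1 / (4 * t))" "1 \<le> exp (1 / (4 * t))"
      using exp_ge_add_one_self[of "1 / (4 * t)"] divide_pos_pos[of 1 "4 * t"] t by linarith+
    then have "1 \<le> 4 * t * exp (1 / (4 * t))" "t * 1 \<le> t * exp (1 / (4 * t))"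
      using t by (simp add: field_simps, intro mult_left_mono) auto
    then have "(1 + t) \<le> 5 * t * exp (1 / (4 * t))" by linarith
    then have "exp (- (1 / (4 * t))) * (1 + t) \<le> 5 * t" by (simp add: exp_minus field_simps)
    then have "exp (- (1 / (4 * t))) / t \<le> 5 / (1 + t)" using t by (simp add: divide_simps mult.commute)
    then have "exp (- (1 / (4 * t))) / t / sqrt t \<le> 5 / (1 + t) / sqrt t" using t by (intro divide_right_mono) auto
    then show ?thesis using t by (simp add: subordinator_def mult.commute)
  qed
  show ?thesis
    by (rule Bochner_Integration.integrable_bound[OF i])
      (use bd subordinator_nonneg in \<open>auto intro!: always_eventually simp: einterval_def indicator_def subordinator_def\<close>)
qed

text \<open>Completing the square in two ways,
  \<open>1 / (4 t) + w\<^sup>2 t = (1 / (2 \<surd>t) \<plusminus> w \<surd>t)\<^sup>2 \<minusplus> w\<close>, gives an antiderivative in terms of the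
  complex error function; \<open>\<bar>Im w\<bar> < Re w\<close> keeps its arguments in a sector where that function
  has a limit at infinity.\<close>

lemma laplace_subordinator:
  fixes w :: complex
  assumes w: "\<bar>Im w\<bar> < Re w"
  shows "(\<integral>t. of_real (subordinator t) * exp (- (w\<^sup>2 * of_real t)) \<partial>lborel) = of_real (2 * sqrt pi) * exp (- w)"
proof -
  obtain E :: "complex \<Rightarrow> complex" where
    E: "\<And>z. (E has_field_derivative exp (- z\<^sup>2)) (at z)" and odd: "\<And>z. E (- z) = - E z"
    using complex_erf_exists by blast
  define a where "a = Re w"
  define b where "b = \<bar>Im w\<bar>"
  have ab: "0 < a" "0 \<le> b" "b < a" using w by (auto simp: a_def b_def)
  \<comment> \<open>The midpoint between \<open>b / a\<close> and 1: still below 1, but with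
    \<open>b < \<kappa> * a\<close>, which leaves room to absorb the term
    \<open>1 / (2 * sqrt t)\<close> for large t.\<close>
  define \<kappa> where "\<kappa> = (1 + b / a) / 2"
  have \<kappa>: "0 < \<kappa>" "\<kappa> < 1" "b < \<kappa> * a" using ab by (auto simp: \<kappa>_def field_simps add_pos_nonneg)
  define P where "P t = of_real (1 / (2 * sqrt t)) + w * of_real (sqrt t)" for t
  define Q where "Q t = of_real (1 / (2 * sqrt t)) - w * of_real (sqrt t)" for t
  \<comment> \<open>The prefactors make the two Gaussian terms equal after differentiation. The
    parts with \<open>w\<close> cancel, and \<open>- 1 / (4 * (t * sqrt t))\<close>, taken twice and
    multiplied by -2, gives the density.\<close>
  define F where "F t = - 2 * (exp w * E (P t) + exp (- w) * E (Q t))" for t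
  define f where "f t = of_real (subordinator t) * exp (- (w\<^sup>2 * of_real t))" for t
  have ReIm: "Re (P t) = 1 / (2 * sqrt t) + a * sqrt t" "\<bar>Im (P t)\<bar> = b * \<bar>sqrt t\<bar>"
     "Re (Q t) = 1 / (2 * sqrt t) - a * sqrt t" "\<bar>Im (Q t)\<bar> = b * \<bar>sqrt t\<bar>" for t
    by (auto simp: P_def Q_def a_def b_def abs_mult)
  have P0: "((\<lambda>t. E (P t)) \<longlongrightarrow> of_real (sqrt pi / 2)) (at_right 0)"
  proof (rule complex_erf_limit[OF E odd \<kappa>(2)])
    show "\<forall>\<^sub>F t in at_right 0. \<bar>Im (P t)\<bar> \<le> \<kappa> * Re (P t)"
      unfolding ReIm using ab \<kappa> by real_asymp
    show "filterlim (\<lambda>t. Re (P t)) at_top (at_right 0)"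
      unfolding ReIm using ab by real_asymp
  qed
  have Q0: "((\<lambda>t. E (Q t)) \<longlongrightarrow> of_real (sqrt pi / 2)) (at_right 0)"
  proof (rule complex_erf_limit[OF E odd \<kappa>(2)])
    show "\<forall>\<^sub>F t in at_right 0. \<bar>Im (Q t)\<bar> \<le> \<kappa> * Re (Q t)"
      unfolding ReIm using ab \<kappa> by real_asymp
    show "filterlim (\<lambda>t. Re (Q t)) at_top (at_right 0)"
      unfolding ReIm using ab by real_asymp
  qed
  have Pinf: "((\<lambda>t. E (P t)) \<longlongrightarrow> of_real (sqrt pi / 2)) at_top"
  proof (rule complex_erf_limit[OF E odd \<kappa>(2)])
    show "\<forall>\<^sub>F t in at_top. \<bar>Im (P t)\<bar> \<le> \<kappa> * Re (P t)"
      using eventually_gt_at_top[of 0]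
    proof eventually_elim
      case (elim t)
      have "b * sqrt t \<le> \<kappa> * a * sqrt t" using \<kappa> elim by (intro mult_right_mono) auto
      moreover have "0 \<le> \<kappa> * (1 / (2 * sqrt t))" using \<kappa> elim by simp
      moreover have "\<bar>sqrt t\<bar> = sqrt t" using elim by simp
      ultimately show ?case unfolding ReIm distrib_left mult.assoc[symmetric] by linarith
    qed
    show "filterlim (\<lambda>t. Re (P t)) at_top at_top"
      unfolding ReIm using ab by real_asymp
  qed
  \<comment> \<open>The real part of \<open>Q t\<close> tends to minus infinity, so the limit is
    taken for \<open>- Q t\<close> and transferred by oddness. Because of this change of sign the
    terms with \<open>exp w\<close> cancel between the endpoints while those with
    \<open>exp (- w)\<close> add up.\<close>
  have "((\<lambda>t. E (- Q t)) \<longlongrightarrow> of_real (sqrt pi / 2)) at_top"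
  proof (rule complex_erf_limit[OF E odd \<kappa>(2)])
    show "filterlim (\<lambda>t. Re (- Q t)) at_top at_top"
      unfolding ReIm uminus_complex.simps using ab by real_asymp
    have "\<forall>\<^sub>F t in at_top. \<kappa> / (2 * (\<kappa> * a - b)) \<le> t" by (rule eventually_ge_at_top)
    then show "\<forall>\<^sub>F t in at_top. \<bar>Im (- Q t)\<bar> \<le> \<kappa> * Re (- Q t)"
      using eventually_gt_at_top[of 0]
    proof eventually_elim
      case (elim t)
      \<comment> \<open>The threshold on \<open>t\<close> is exactly the point from which the sector
        condition for \<open>- Q t\<close> holds.\<close>
      have "\<kappa> \<le> 2 * (\<kappa> * a - b) * t" using elim \<kappa> by (simp add: field_simps)
      also have "\<dots> = 2 * (\<kappa> * a - b) * (sqrt t * sqrt t)" using elim by simp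
      finally have "\<kappa> / (2 * sqrt t) \<le> 2 * (\<kappa> * a - b) * (sqrt t * sqrt t) / (2 * sqrt t)"
        using elim by (intro divide_right_mono) auto
      also have "\<dots> = (\<kappa> * a - b) * sqrt t" using elim by (simp del: real_sqrt_mult_self)
      finally have "\<kappa> * (1 / (2 * sqrt t)) \<le> (\<kappa> * a - b) * sqrt t" by simp
      moreover have "\<bar>sqrt t\<bar> = sqrt t" using elim by simp
      ultimately show ?case unfolding ReIm uminus_complex.simps abs_minus_cancel by (simp only:) (simp add: algebra_simps)
    qed
  qed
  then have Qinf: "((\<lambda>t. E (Q t)) \<longlongrightarrow> - of_real (sqrt pi / 2)) at_top"
    using tendsto_minus by (fastforce simp: odd)
  have "(LBINT t=ereal 0..\<infinity>. f t) = - 2 * (exp w * of_real (sqrt pi / 2) + exp (- w) * (- of_real (sqrt pi / 2)))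
       - (- 2 * (exp w * of_real (sqrt pi / 2) + exp (- w) * of_real (sqrt pi / 2)))"
  proof (rule interval_integral_FTC_integrable)
    fix t :: real assume "ereal 0 < ereal t"
    then have t: "0 < t" by simp
    show "(F has_vector_derivative f t) (at t)"
    proof -
      have ds: "((\<lambda>t. 1 / (2 * sqrt t)) has_real_derivative - 1 / (4 * (t * sqrt t))) (at t)"
          "(sqrt has_real_derivative 1 / (2 * sqrt t)) (at t)"
        using t by (auto intro!: derivative_eq_intros simp: field_simps)
      have dP: "(P has_vector_derivative (of_real (- 1 / (4 * (t * sqrt t))) + w * of_real (1 / (2 * sqrt t)))) (at t)"
        unfolding P_def by (intro has_vector_derivative_add has_vector_derivative_mult_right has_vector_derivative_of_real ds)
      have dQ: "(Q has_vector_derivative (of_real (- 1 / (4 * (t * sqrt t))) - w * of_real (1 / (2 * sqrt t)))) (at t)"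
        unfolding Q_def by (intro has_vector_derivative_diff has_vector_derivative_mult_right has_vector_derivative_of_real ds)
      have EP: "((\<lambda>t. E (P t)) has_vector_derivative (of_real (- 1 / (4 * (t * sqrt t))) + w * of_real (1 / (2 * sqrt t))) * exp (- (P t)\<^sup>2)) (at t)"
        using field_vector_diff_chain_at[OF dP E] by (simp add: o_def)
      have EQ: "((\<lambda>t. E (Q t)) has_vector_derivative (of_real (- 1 / (4 * (t * sqrt t))) - w * of_real (1 / (2 * sqrt t))) * exp (- (Q t)\<^sup>2)) (at t)"
        using field_vector_diff_chain_at[OF dQ E] by (simp add: o_def)
      let ?g = "exp (- (of_real (1 / (4 * t)) + w\<^sup>2 * of_real t))"
      have ts: "complex_of_real (sqrt t) * complex_of_real (sqrt t) = of_real t" "complex_of_real (sqrt t) \<noteq> 0"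
        using t by (simp_all add: of_real_mult[symmetric] del: of_real_mult)
      have sqP: "exp w * exp (- (P t)\<^sup>2) = ?g"
      proof -
        have "(P t)\<^sup>2 = of_real (1 / (4 * t)) + w\<^sup>2 * of_real t + w"
          using ts t by (simp add: P_def power2_sum power2_eq_square algebra_simps divide_simps)
        then show ?thesis by (simp add: exp_add[symmetric])
      qed
      have sqQ: "exp (- w) * exp (- (Q t)\<^sup>2) = ?g"
      proof -
        have "(Q t)\<^sup>2 = of_real (1 / (4 * t)) + w\<^sup>2 * of_real t - w"
          using ts t by (simp add: Q_def power2_diff power2_eq_square algebra_simps divide_simps)
        then show ?thesis by (simp add: exp_add[symmetric])
      qed
      have "(F has_vector_derivative (- 2 * (exp w * ((of_real (- 1 / (4 * (t * sqrt t))) + w * of_real (1 / (2 * sqrt t))) * exp (- (P t)\<^sup>2))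
           + exp (- w) * ((of_real (- 1 / (4 * (t * sqrt t))) - w * of_real (1 / (2 * sqrt t))) * exp (- (Q t)\<^sup>2))))) (at t)"
        unfolding F_def by (intro derivative_intros has_vector_derivative_mult_right EP EQ)
      also have "- 2 * (exp w * ((of_real (- 1 / (4 * (t * sqrt t))) + w * of_real (1 / (2 * sqrt t))) * exp (- (P t)\<^sup>2))
           + exp (- w) * ((of_real (- 1 / (4 * (t * sqrt t))) - w * of_real (1 / (2 * sqrt t))) * exp (- (Q t)\<^sup>2)))
           = - 2 * ((of_real (- 1 / (4 * (t * sqrt t))) + w * of_real (1 / (2 * sqrt t))) * (exp w * exp (- (P t)\<^sup>2))
           + (of_real (- 1 / (4 * (t * sqrt t))) - w * of_real (1 / (2 * sqrt t))) * (exp (- w) * exp (- (Q t)\<^sup>2)))"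
        by (simp only: mult_ac)
      also have "\<dots> = of_real (1 / (t * sqrt t)) * ?g"
        unfolding sqP sqQ by (simp add: algebra_simps)
      also have "\<dots> = f t"
        using t by (simp add: f_def subordinator_def exp_add[symmetric] exp_of_real[symmetric] exp_diff exp_minus field_simps)
      finally show ?thesis .
    qed
    show "isCont f t"
    proof -
      have c: "isCont (\<lambda>t. of_real (exp (- 1 / (4 * t)) / (t * sqrt t)) * exp (- (w\<^sup>2 * of_real t))) t"
        using t by (intro continuous_intros) auto
      have ev: "\<forall>\<^sub>F t in nhds t. of_real (exp (- 1 / (4 * t)) / (t * sqrt t)) * exp (- (w\<^sup>2 * of_real t)) = f t"
        using eventually_nhds_in_open[of "{0<..}" t] t
        by (auto simp: f_def subordinator_def elim!: eventually_mono)
      show ?thesis using c unfolding isCont_cong[OF ev] .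
    qed
  next
    \<comment> \<open>The exponential is then bounded by 1 for t \<ge> 0, so
      \<open>subordinator\<close> dominates the integrand and gives the integrability demanded by
      the fundamental theorem on an unbounded interval.\<close>
    have "0 \<le> Re (w\<^sup>2)" using ab power_mono[of b a 2] by (simp add: Re_power2 a_def b_def)
    then have e1: "norm (exp (- (w\<^sup>2 * of_real t))) \<le> 1" if "0 \<le> t" for t
      using that by simp
    have bd: "norm (f t) \<le> norm (subordinator t)" for t
    proof (cases "0 < t")
      case True
      have "\<bar>subordinator t\<bar> * norm (exp (- (w\<^sup>2 * of_real t))) \<le> \<bar>subordinator t\<bar> * 1"
        using True by (intro mult_left_mono e1) auto
      then show ?thesis unfolding f_def norm_mult norm_of_real by simp
    qed (simp add: f_def subordinator_def)
    have "f \<in> borel_measurable borel"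
      unfolding f_def by measurable
    then have fi: "integrable lborel f"
      by (intro Bochner_Integration.integrable_bound[OF integrable_subordinator]) (use bd in auto)
    then show "set_integrable lborel (einterval (ereal 0) \<infinity>) f"
      unfolding set_integrable_def by (intro integrable_mult_indicator) auto
    show "((F \<circ> real_of_ereal) \<longlongrightarrow> - 2 * (exp w * of_real (sqrt pi / 2) + exp (- w) * of_real (sqrt pi / 2))) (at_right (ereal 0))"
      unfolding ereal_tendsto_simps F_def by (intro tendsto_intros P0 Q0)
    show "((F \<circ> real_of_ereal) \<longlongrightarrow> - 2 * (exp w * of_real (sqrt pi / 2) + exp (- w) * (- of_real (sqrt pi / 2)))) (at_left \<infinity>)"
      unfolding ereal_tendsto_simps F_def by (intro tendsto_intros Pinf Qinf)
  qed simp
  also have "\<dots> = of_real (2 * sqrt pi) * exp (- w)" by (simp add: algebra_simps)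
  also have "(LBINT t=ereal 0..\<infinity>. f t) = (\<integral>t. f t \<partial>lborel)"
    unfolding interval_lebesgue_integral_def set_lebesgue_integral_def
    by (auto intro!: Bochner_Integration.integral_cong simp: f_def subordinator_def einterval_def indicator_def)
  finally show ?thesis by (simp add: f_def)
qed

section \<open>Integrability of the kernels and the transform of S\<close>

lemma kernel_S_nonneg: "0 \<le> kernel_S p"
  by (auto simp: kernel_S_def split: prod.split)

lemma kernel_R_nonneg: "0 \<le> kernel_R p"
  by (auto simp: kernel_R_def split: prod.split)

lemma borel_measurable_kernel_S [measurable]: "kernel_S \<in> borel_measurable borel"
proof -
  have eq: "kernel_S = (\<lambda>p. if snd p > 0 then 1 / (snd p)\<^sup>2 * exp (- ((fst p)\<^sup>2 + 1) / (4 * snd p)) else 0)"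
    by (auto simp: kernel_S_def)
  show ?thesis unfolding eq borel_prod[symmetric] by measurable
qed

lemma borel_measurable_kernel_R [measurable]: "kernel_R \<in> borel_measurable borel"
proof -
  have eq: "kernel_R = (\<lambda>p. if snd p > 0 then 1 / (snd p)\<^sup>2 * exp (- ((fst p)\<^sup>2 + 4) / (4 * snd p)) else 0)"
    by (auto simp: kernel_R_def)
  show ?thesis unfolding eq borel_prod[symmetric] by measurable
qed

text \<open>At a fixed time the kernel is a Gaussian in x of variance \<open>2 * t\<close>; its
  norming factor sqrt t turns \<open>1 / t\<^sup>2\<close> into the power -3/2 of the
  subordinator.\<close>

lemma kernel_S_slice:
  assumes t: "0 < t"
  shows "integrable lborel (\<lambda>x. kernel_S (x, t))"
    and "(\<integral>x. kernel_S (x, t) * cis (x * z) \<partial>lborel)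
      = of_real (2 * sqrt pi * subordinator t) * exp (- of_real (t * z\<^sup>2))"
proof -
  let ?\<sigma> = "sqrt (2 * t)"
  have \<sigma>: "0 < ?\<sigma>" using t by simp
  have S: "kernel_S (x, t) = exp (- 1 / (4 * t)) / t\<^sup>2 * exp (- x\<^sup>2 / (2 * ?\<sigma>\<^sup>2))" for x
    using t by (simp add: kernel_S_def exp_add[symmetric] add_divide_distrib diff_divide_distrib)
  show "integrable lborel (\<lambda>x. kernel_S (x, t))"
    unfolding S by (intro integrable_mult_right gaussian_fourier_1D(1) \<sigma>)
  have "(\<integral>x. kernel_S (x, t) * cis (x * z) \<partial>lborel) =
      (\<integral>x. of_real (exp (- 1 / (4 * t)) / t\<^sup>2) * (of_real (exp (- x\<^sup>2 / (2 * ?\<sigma>\<^sup>2))) * cis (x * z)) \<partial>lborel)"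
    unfolding S by (simp only: of_real_mult mult.assoc)
  also have "\<dots> = of_real (exp (- 1 / (4 * t)) / t\<^sup>2) * of_real (sqrt (2 * pi) * ?\<sigma> * exp (- (?\<sigma>\<^sup>2 * z\<^sup>2) / 2))"
    by (simp only: integral_mult_right_zero gaussian_fourier_1D(2)[OF \<sigma>])
  also have "\<dots> = of_real (exp (- 1 / (4 * t)) / t\<^sup>2 * (sqrt (2 * pi) * ?\<sigma> * exp (- (?\<sigma>\<^sup>2 * z\<^sup>2) / 2)))"
    by (simp only: of_real_mult)
  also have "exp (- 1 / (4 * t)) / t\<^sup>2 * (sqrt (2 * pi) * ?\<sigma> * exp (- (?\<sigma>\<^sup>2 * z\<^sup>2) / 2))
      = 2 * sqrt pi * subordinator t * exp (- (t * z\<^sup>2))"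
  proof -
    have "sqrt (2 * pi) * ?\<sigma> = sqrt ((2 * sqrt pi * sqrt t)\<^sup>2)"
      using t unfolding real_sqrt_mult[symmetric] by (simp add: power_mult_distrib mult_ac)
    then have "sqrt (2 * pi) * ?\<sigma> = 2 * sqrt pi * sqrt t" using t by simp
    moreover have "sqrt t / t\<^sup>2 = 1 / (t * sqrt t)" using t by (simp add: field_simps power2_eq_square)
    moreover have "?\<sigma>\<^sup>2 * z\<^sup>2 / 2 = t * z\<^sup>2" using t by simp
    ultimately show ?thesis using t by (simp add: subordinator_def del: real_sqrt_mult) (simp add: field_simps)
  qed
  finally show "(\<integral>x. kernel_S (x, t) * cis (x * z) \<partial>lborel)
      = of_real (2 * sqrt pi * subordinator t) * exp (- of_real (t * z\<^sup>2))"
    by (simp add: exp_of_real[symmetric])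
qed

lemma integral_kernel_S_slice:
  "integrable lborel (\<lambda>x. kernel_S (x, t))" "(\<integral>x. kernel_S (x, t) \<partial>lborel) = 2 * sqrt pi * subordinator t"
proof -
  have "integrable lborel (\<lambda>x. kernel_S (x, t)) \<and> (\<integral>x. kernel_S (x, t) \<partial>lborel) = 2 * sqrt pi * subordinator t"
  proof (cases "0 < t")
    case True
    have "complex_of_real (\<integral>x. kernel_S (x, t) \<partial>lborel) = of_real (2 * sqrt pi * subordinator t)"
      using kernel_S_slice(2)[OF True, of 0] by simp
    then show ?thesis using kernel_S_slice(1)[OF True] unfolding of_real_eq_iff by simp
  qed (simp add: kernel_S_def subordinator_def)
  then show "integrable lborel (\<lambda>x. kernel_S (x, t))" "(\<integral>x. kernel_S (x, t) \<partial>lborel) = 2 * sqrt pi * subordinator t"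
    by auto
qed

lemma integrable_kernel_S: "integrable lborel kernel_S"
proof (rule integrableI_bounded)
  have "(\<integral>\<^sup>+p. ennreal (norm (kernel_S p)) \<partial>lborel) = (\<integral>\<^sup>+t. \<integral>\<^sup>+x. ennreal (kernel_S (x, t)) \<partial>lborel \<partial>lborel)"
    using lborel_pair.nn_integral_snd[of "\<lambda>p. ennreal (kernel_S p)"] by (simp add: lborel_prod kernel_S_nonneg)
  also have "\<dots> = (\<integral>\<^sup>+t. ennreal (2 * sqrt pi * subordinator t) \<partial>lborel)"
    using nn_integral_eq_integral[OF integral_kernel_S_slice(1)] by (simp add: kernel_S_nonneg integral_kernel_S_slice(2))
  also have "\<dots> < \<infinity>"
    by (subst nn_integral_eq_integral[OF integrable_mult_right[OF integrable_subordinator]])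
      (auto simp: subordinator_nonneg)
  finally show "(\<integral>\<^sup>+p. ennreal (norm (kernel_S p)) \<partial>lborel) < \<infinity>" .
qed auto

text \<open>Reduces integrability of R to that of S. R acts on the data only, so its mass is all
  that the estimates use.\<close>

lemma kernel_R_le_S: "kernel_R p \<le> kernel_S p"
  by (auto simp: kernel_R_def kernel_S_def divide_right_mono intro!: mult_left_mono split: prod.split)

lemma integrable_kernel_R: "integrable lborel kernel_R"
  by (rule Bochner_Integration.integrable_bound[OF integrable_kernel_S])
    (auto simp: kernel_R_nonneg kernel_S_nonneg kernel_R_le_S)

text \<open>Integration over x leaves the Laplace transform of the subordinator at
  \<open>w\<^sup>2\<close>. For z \<noteq> 0 its real part is positive, which for the principal root
  means \<open>\<bar>Im w\<bar> < Re w\<close>. The constant is the square of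
  \<open>2 * sqrt pi\<close> divided by 2 pi.\<close>

lemma fourier_kernel_S:
  assumes z: "z \<noteq> 0"
  shows "fourier (\<lambda>p. of_real (kernel_S p)) (z, r) = 2 * exp (- csqrt (Complex (z\<^sup>2) r))"
proof -
  define w where "w = csqrt (Complex (z\<^sup>2) r)"
  have w2: "w\<^sup>2 = Complex (z\<^sup>2) r" by (simp add: w_def)
  have "0 < Re (w\<^sup>2)" using z by (simp add: w2)
  then have "(Im w)\<^sup>2 < (Re w)\<^sup>2" by (simp add: Re_power2)
  moreover have "0 \<le> Re w" by (simp add: w_def)
  ultimately have w: "\<bar>Im w\<bar> < Re w" by (metis abs_of_nonneg abs_le_square_iff not_le)
  let ?f = "\<lambda>p. of_real (kernel_S p) * cis (- (p \<bullet> (z, r)))"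
  have int: "integrable lborel ?f"
    by (intro integrable_mult_cis integrable_of_real integrable_kernel_S) auto
  have slice: "(\<integral>x. ?f (x, t) \<partial>lborel) = of_real (2 * sqrt pi) * (of_real (subordinator t) * exp (- (w\<^sup>2 * of_real t)))" for t
  proof (cases "0 < t")
    case True
    have "(\<integral>x. ?f (x, t) \<partial>lborel) = (\<integral>x. cis (- (t * r)) * (of_real (kernel_S (x, t)) * cis (x * (- z))) \<partial>lborel)"
      by (intro Bochner_Integration.integral_cong refl) (simp add: cis_mult mult_ac)
    also have "\<dots> = cis (- (t * r)) * (of_real (2 * sqrt pi * subordinator t) * exp (- of_real (t * z\<^sup>2)))"
      unfolding integral_mult_right_zero kernel_S_slice(2)[OF True] by simp
    also have "\<dots> = of_real (2 * sqrt pi * subordinator t) * exp (- (w\<^sup>2 * of_real t))"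
      by (simp add: cis_conv_exp exp_add[symmetric] w2 Complex_eq algebra_simps)
    finally show ?thesis by (simp add: mult.assoc)
  qed (simp add: kernel_S_def subordinator_def)
  have split: "(\<lambda>(x, t). ?f (x, t)) = ?f" by (simp only: case_prod_beta' prod.collapse)
  have "(\<integral>p. ?f p \<partial>lborel) = (\<integral>t. \<integral>x. ?f (x, t) \<partial>lborel \<partial>lborel)"
    by (rule lborel_pair.integral_snd[of "\<lambda>x t. ?f (x, t)", unfolded split lborel_prod, OF int, symmetric])
  also have "\<dots> = of_real (2 * sqrt pi) * (of_real (2 * sqrt pi) * exp (- w))"
    unfolding slice integral_mult_right_zero laplace_subordinator[OF w] ..
  also have "\<dots> = of_real (2 * sqrt pi * (2 * sqrt pi)) * exp (- w)" by (simp only: of_real_mult mult.assoc)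
  also have "2 * sqrt pi * (2 * sqrt pi) = 4 * pi" by simp
  finally show ?thesis by (simp add: fourier_eq w_def)
qed

section \<open>Truncated Fourier inversion\<close>

lemma L2_norm_tendsto:
  assumes f: "square_integrable f" and [measurable]: "\<And>n. X n \<in> borel_measurable borel" "Y \<in> borel_measurable borel"
    and lim: "\<And>p. (\<lambda>n. X n p) \<longlonglongrightarrow> Y p" and dom: "\<And>n p. norm (X n p) \<le> norm (f p)"
  shows "(\<lambda>n. L2_norm (X n)) \<longlonglongrightarrow> L2_norm Y"
  unfolding L2_norm_def
proof (intro tendsto_real_sqrt integral_dominated_convergence[where w = "\<lambda>p. (norm (f p))\<^sup>2"])
  show "integrable lborel (\<lambda>p. (norm (f p))\<^sup>2)" using f by (simp add: square_integrable_def)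
  show "AE p in lborel. norm ((norm (X n p))\<^sup>2) \<le> (norm (f p))\<^sup>2" for n
    using dom by (auto intro!: always_eventually power_mono)
  show "AE p in lborel. (\<lambda>n. (norm (X n p))\<^sup>2) \<longlonglongrightarrow> (norm (Y p))\<^sup>2"
    by (intro always_eventually allI tendsto_intros lim)
qed auto

lemma integrable_fourier_indicator:
  assumes v: "integrable lborel v" and [measurable]: "A \<in> sets borel" and fin: "emeasure lborel A < \<infinity>"
  shows "integrable lborel (\<lambda>\<zeta>. indicator A \<zeta> *\<^sub>R fourier v \<zeta>)"
proof -
  have [measurable]: "v \<in> borel_measurable borel" using v by (auto dest: borel_measurable_integrable)
  let ?C = "1 / (2 * pi) * (\<integral>p. norm (v p) \<partial>lborel)"
  have i: "integrable lborel (\<lambda>\<zeta>. indicator A \<zeta> *\<^sub>R ?C)"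
    using fin by (intro integrable_scaleR_left) simp
  show ?thesis
    by (rule Bochner_Integration.integrable_bound[OF i])
      (use norm_fourier_le[OF v] in \<open>auto simp: indicator_def intro!: always_eventually\<close>)
qed

text \<open>Comparing the truncated inversion integral with the Gaussian means of \<open>v\<close>, which converge to \<open>v\<close>
  almost everywhere along a subsequence, makes the reverse Plancherel inequality unnecessary.\<close>

lemma truncated_inversion:
  assumes v: "integrable lborel v" and vb: "L2_le v b"
    and [measurable]: "A \<in> sets borel" and fin: "emeasure lborel A < \<infinity>"
    and t: "L2_le (\<lambda>\<zeta>. indicator (- A) \<zeta> *\<^sub>R fourier v \<zeta>) t"
  shows "L2_le (\<lambda>p. inv_fourier (\<lambda>\<zeta>. indicator A \<zeta> *\<^sub>R fourier v \<zeta>) p - v p) t"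
proof -
  have [measurable]: "v \<in> borel_measurable borel" using L2_leD[OF vb] by auto
  let ?s = "\<lambda>n. 1 / real (Suc n)"
  have "\<exists>r::nat\<Rightarrow>nat. strict_mono r \<and> (AE p in lborel. (\<lambda>n. convolve (heat (?s (r n))) v p - v p) \<longlonglongrightarrow> 0)"
    using heat_error_tendsto_0[OF v] unfolding heat_error_def
    by (intro tendsto_L1_AE_subseq integrable_heat_error v)
  then obtain r :: "nat \<Rightarrow> nat" where r: "strict_mono r"
    and ae: "AE p in lborel. (\<lambda>n. convolve (heat (?s (r n))) v p - v p) \<longlonglongrightarrow> 0" by blast
  define s where "s n = ?s (r n)" for n
  have s: "0 < s n" for n by (simp add: s_def)
  have s0: "s \<longlonglongrightarrow> 0"
    using LIMSEQ_subseq_LIMSEQ[OF LIMSEQ_Suc[OF lim_1_over_n] r] by (simp add: s_def[abs_def] o_def)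
  have vhat: "square_integrable (fourier v)" using plancherel_le[OF v vb] by (rule L2_le_square_integrable)
  let ?F = "\<lambda>\<zeta>. indicator A \<zeta> *\<^sub>R fourier v \<zeta>"
  \<comment> \<open>The difference of a sharp and a Gaussian cutoff is at most 1 in modulus, so the
    transform of \<open>v\<close> dominates every \<open>W n\<close>. As the Gaussian tends to 1,
    only minus the part outside \<open>A\<close> survives.\<close>
  define W where "W n \<zeta> = indicator A \<zeta> *\<^sub>R fourier v \<zeta> - of_real (gauss (s n) \<zeta>) * fourier v \<zeta>" for n \<zeta>
  have Weq: "W n \<zeta> = (indicator A \<zeta> - gauss (s n) \<zeta>) *\<^sub>R fourier v \<zeta>" for n \<zeta>
    unfolding W_def scaleR_diff_left by (simp add: scaleR_conv_of_real)
  have [measurable]: "W n \<in> borel_measurable borel" for n unfolding W_def by measurable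
  have Wle: "norm (W n \<zeta>) \<le> norm (fourier v \<zeta>)" for n \<zeta>
    unfolding Weq norm_scaleR using gauss_bounds[of "s n" \<zeta>]
    by (intro mult_left_le_one_le) (auto simp: indicator_def)
  have gi: "integrable lborel (\<lambda>\<zeta>. of_real (gauss (s n) \<zeta>) * fourier v \<zeta>)" for n
  proof -
    let ?C = "1 / (2 * pi) * (\<integral>p. norm (v p) \<partial>lborel)"
    have i: "integrable lborel (\<lambda>\<zeta>. ?C * gauss (s n) \<zeta>)" by (intro integrable_mult_right fourier_gauss(1) s)
    have "norm (of_real (gauss (s n) \<zeta>) * fourier v \<zeta>) \<le> norm (?C * gauss (s n) \<zeta>)" for \<zeta>
    proof -
      have "gauss (s n) \<zeta> * norm (fourier v \<zeta>) \<le> gauss (s n) \<zeta> * ?C"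
        using gauss_bounds(1)[of "s n" \<zeta>] by (intro mult_left_mono norm_fourier_le[OF v]) auto
      also have "\<dots> \<le> norm (?C * gauss (s n) \<zeta>)" by (simp only: real_norm_def abs_ge_self mult.commute)
      finally show ?thesis using gauss_bounds(1)[of "s n" \<zeta>] by (simp add: norm_mult)
    qed
    then show ?thesis by (intro Bochner_Integration.integrable_bound[OF i]) auto
  qed
  have Wi: "integrable lborel (W n)" for n
    unfolding W_def by (intro Bochner_Integration.integrable_diff integrable_fourier_indicator v fin gi) auto
  have Ws: "square_integrable (W n)" for n
  proof -
    have "L2_le (W n) (1 * L2_norm (fourier v))"
      by (rule L2_le_dominated[OF L2_le_norm[OF vhat]]) (use Wle in auto)
    then show ?thesis by (rule L2_le_square_integrable)
  qed
  have lim: "(\<lambda>n. L2_norm (W n)) \<longlonglongrightarrow> L2_norm (\<lambda>\<zeta>. (indicator A \<zeta> - 1) *\<^sub>R fourier v \<zeta>)"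
  proof (rule L2_norm_tendsto[OF vhat _ _ _ Wle])
    fix \<zeta>
    have "(\<lambda>n. gauss (s n) \<zeta>) \<longlonglongrightarrow> exp (- (0\<^sup>2 * (norm \<zeta>)\<^sup>2) / 2)"
      unfolding gauss_def by (intro tendsto_intros s0) simp
    then have "(\<lambda>n. gauss (s n) \<zeta>) \<longlonglongrightarrow> 1" by simp
    then show "(\<lambda>n. W n \<zeta>) \<longlonglongrightarrow> (indicator A \<zeta> - 1) *\<^sub>R fourier v \<zeta>"
      unfolding Weq by (intro tendsto_intros)
  qed auto
  have "L2_norm (\<lambda>\<zeta>. (indicator A \<zeta> - 1) *\<^sub>R fourier v \<zeta>) = L2_norm (\<lambda>\<zeta>. indicator (- A) \<zeta> *\<^sub>R fourier v \<zeta>)"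
    unfolding L2_norm_def
    by (intro arg_cong[where f = sqrt] Bochner_Integration.integral_cong refl) (auto simp: indicator_def)
  also have "\<dots> \<le> t" using t by (simp add: L2_le_iff)
  finally have le: "L2_norm (\<lambda>\<zeta>. (indicator A \<zeta> - 1) *\<^sub>R fourier v \<zeta>) \<le> t" .
  have "L2_le (\<lambda>p. inv_fourier ?F p - v p) (L2_norm (\<lambda>\<zeta>. (indicator A \<zeta> - 1) *\<^sub>R fourier v \<zeta>))"
  proof (rule L2_le_Fatou[OF _ lim])
    show "L2_le (\<lambda>p. inv_fourier ?F p - convolve (heat (s n)) v p) (L2_norm (W n))" for n
    proof -
      have "L2_le (inv_fourier (W n)) (L2_norm (W n))"
        by (rule inv_plancherel_le[OF Wi L2_le_norm[OF Ws]])
      moreover have "inv_fourier (W n) = (\<lambda>p. inv_fourier ?F p - convolve (heat (s n)) v p)"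
        unfolding W_def
        by (intro ext) (simp only: inv_fourier_diff[OF integrable_fourier_indicator[OF v _ fin] gi] assms(3) inv_fourier_gauss_mult[OF v s])
      ultimately show ?thesis by simp
    qed
    show "AE p in lborel. (\<lambda>n. inv_fourier ?F p - convolve (heat (s n)) v p) \<longlonglongrightarrow> inv_fourier ?F p - v p"
      using ae
    proof eventually_elim
      case (elim p)
      then have "(\<lambda>n. convolve (heat (s n)) v p - v p) \<longlonglongrightarrow> 0" by (simp add: s_def)
      then have "(\<lambda>n. (inv_fourier ?F p - v p) - (convolve (heat (s n)) v p - v p)) \<longlonglongrightarrow> (inv_fourier ?F p - v p) - 0"
        by (intro tendsto_diff tendsto_const)
      then show ?case by (simp add: algebra_simps)
    qed
  qed auto
  then show ?thesis using le by (rule L2_le_mono)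
qed

text \<open>The same cutoff as in \<open>is_fourier_L2\<close>, so the transforms of the truncations
  are the functions whose L2 limit represents the transform.\<close>

definition truncate :: "nat \<Rightarrow> (real \<times> real \<Rightarrow> 'a::real_normed_vector) \<Rightarrow> real \<times> real \<Rightarrow> 'a" where
  "truncate n h p = indicator (ball 0 (real n)) p *\<^sub>R h p"

lemma borel_measurable_truncate [measurable]:
  fixes h :: "real \<times> real \<Rightarrow> 'a::{real_normed_vector,second_countable_topology}"
  shows "h \<in> borel_measurable borel \<Longrightarrow> truncate n h \<in> borel_measurable borel"
proof -
  assume [measurable]: "h \<in> borel_measurable borel"
  have [measurable]: "ball 0 (real n) \<in> sets (borel :: (real \<times> real) measure)" by simp
  show ?thesis unfolding truncate_def[abs_def] by measurable
qed

lemma norm_truncate_le: "norm (truncate n h p) \<le> norm (h p)"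
  by (auto simp: truncate_def indicator_def)

lemma truncate_tendsto: "(\<lambda>n. truncate n h p) \<longlonglongrightarrow> h p"
proof (rule tendsto_eventually)
  obtain N where N: "norm p < real N" using reals_Archimedean2 by blast
  show "\<forall>\<^sub>F n in sequentially. truncate n h p = h p"
    by (rule eventually_sequentiallyI[of N]) (use N in \<open>auto simp: truncate_def indicator_def\<close>)
qed

lemma L2_le_truncate: "L2_le h B \<Longrightarrow> L2_le (truncate n h) B"
  using L2_le_dominated[of h B "truncate n h" 1] L2_leD(1)[of h B] norm_truncate_le[of n h] by simp

lemma integrable_truncate:
  fixes h :: "real \<times> real \<Rightarrow> 'a::{banach,second_countable_topology}"
  assumes "L2_le h B"
  shows "integrable lborel (truncate n h)"
proof -
  have [measurable]: "h \<in> borel_measurable borel" using L2_leD[OF assms] by auto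
  have "emeasure lborel (ball (0 :: real \<times> real) (real n)) < \<infinity>" by (rule emeasure_lborel_ball_finite)
  then have "integrable lborel (indicator (ball (0 :: real \<times> real) (real n)) :: _ \<Rightarrow> real)"
    by (intro integrable_real_indicator) auto
  moreover have "(\<lambda>p. (norm (indicator (ball (0 :: real \<times> real) (real n)) p :: real))\<^sup>2) = indicator (ball 0 (real n))"
    by (auto simp: indicator_def)
  ultimately have "square_integrable (indicator (ball 0 (real n)) :: _ \<Rightarrow> real)"
    by (simp add: square_integrable_def)
  from L2_le_mult_integrable(1)[OF L2_le_norm[OF this] assms]
  show ?thesis
    by (rule Bochner_Integration.integrable_bound) (auto simp: truncate_def)
qed

lemma L2_norm_truncate_tendsto:
  fixes h :: "real \<times> real \<Rightarrow> 'a::{real_normed_vector,second_countable_topology}"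
  assumes h: "square_integrable h"
  shows "(\<lambda>n. L2_norm (\<lambda>p. h p - truncate n h p)) \<longlonglongrightarrow> 0"
proof -
  have [measurable]: "h \<in> borel_measurable borel" using h by (auto simp: square_integrable_def)
  have "(\<lambda>n. L2_norm (\<lambda>p. h p - truncate n h p)) \<longlonglongrightarrow> L2_norm (\<lambda>p. h p - h p)"
  proof (rule L2_norm_tendsto[OF h])
    show "(\<lambda>n. h p - truncate n h p) \<longlonglongrightarrow> h p - h p" for p by (intro tendsto_intros truncate_tendsto)
    show "norm (h p - truncate n h p) \<le> norm (h p)" for n p by (auto simp: truncate_def indicator_def)
  qed auto
  then show ?thesis by (simp add: L2_norm_def)
qed

section \<open>Fourier multipliers with bounded symbol\<close>

abbreviation fourier_real :: "(real \<times> real \<Rightarrow> real) \<Rightarrow> real \<times> real \<Rightarrow> complex" where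
  "fourier_real h \<equiv> fourier (\<lambda>p. of_real (h p))"

lemma L2_le_of_real:
  assumes "L2_le h B"
  shows "L2_le (\<lambda>p. complex_of_real (h p)) B"
proof -
  have [measurable]: "h \<in> borel_measurable borel" using L2_leD[OF assms] by auto
  show ?thesis using L2_le_dominated[OF assms, of "\<lambda>p. complex_of_real (h p)" 1] by simp
qed

lemma L2_le_Re:
  assumes "L2_le h B"
  shows "L2_le (\<lambda>p. Re (h p)) B"
proof -
  have [measurable]: "h \<in> borel_measurable borel" using L2_leD[OF assms] by auto
  show ?thesis using L2_le_dominated[OF assms, of "\<lambda>p. Re (h p)" 1] by (simp add: abs_Re_le_cmod)
qed

lemma L2_le_conv:
  assumes k: "integrable lborel k" "\<And>p. 0 \<le> k p" and h: "L2_le h B"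
  shows "L2_le (conv k h) (1 / (2 * pi) * (\<integral>p. k p \<partial>lborel) * B)"
proof -
  have "L2_le (\<lambda>p. (1 / (2 * pi)) *\<^sub>R convolve k h p) (\<bar>1 / (2 * pi)\<bar> * ((\<integral>p. k p \<partial>lborel) * B))"
    by (intro L2_le_scale Young_L2 k h)
  then show ?thesis by (simp add: conv_eq_convolve[abs_def] mult.assoc)
qed

lemma integrable_conv:
  assumes k: "integrable lborel k" "\<And>p. 0 \<le> k p" and h: "integrable lborel h"
  shows "integrable lborel (conv k h)"
  unfolding conv_eq_convolve[abs_def] by (intro integrable_mult_right Young_L1(1) k h)

text \<open>Only almost everywhere: at points where one of the integrals diverges, the default value
  0 could break linearity.\<close>

lemma conv_diff_AE:
  assumes k: "integrable lborel k" "\<And>p. 0 \<le> k p" and g: "L2_le g A" and h: "L2_le h B"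
  shows "AE p in lborel. conv k (\<lambda>q. g q - h q) p = conv k g p - conv k h p"
  using Young_L2(1)[OF k g] Young_L2(1)[OF k h]
proof eventually_elim
  case (elim p)
  then show ?case by (simp add: conv_eq_convolve convolve_def right_diff_distrib)
qed

text \<open>Fubini and translation invariance. The factor 1/(2 pi) in \<open>conv\<close> together
  with that of the transform provides the two factors of the product.\<close>

lemma fourier_conv:
  assumes k: "integrable lborel k" "\<And>p. 0 \<le> k p" and h: "integrable lborel h"
  shows "fourier_real (conv k h) \<zeta> = fourier_real k \<zeta> * fourier_real h \<zeta>"
proof -
  have [measurable]: "k \<in> borel_measurable borel" "h \<in> borel_measurable borel"
    using k h by (auto dest: borel_measurable_integrable)
  let ?e = "\<lambda>p. cis (- (p \<bullet> \<zeta>))"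
  let ?f = "\<lambda>(p, q). complex_of_real (k (p - q)) * of_real (h q) * ?e p"
  have "integrable (lborel \<Otimes>\<^sub>M lborel) ?f"
  proof (rule integrableI_bounded)
    have "(\<integral>\<^sup>+z. ennreal (norm (?f z)) \<partial>(lborel \<Otimes>\<^sub>M lborel)) = (\<integral>\<^sup>+q. \<integral>\<^sup>+p. ennreal (k (p - q)) * ennreal \<bar>h q\<bar> \<partial>lborel \<partial>lborel)"
      using k(2) by (subst lborel_pair.nn_integral_snd[symmetric]) (auto simp: norm_mult ennreal_mult)
    also have "\<dots> = ennreal (\<integral>p. k p \<partial>lborel) * (\<integral>\<^sup>+q. ennreal \<bar>h q\<bar> \<partial>lborel)"
      using k by (simp add: nn_integral_multc nn_integral_cmult nn_integral_lborel_shift[of "\<lambda>p. ennreal (k p)"] nn_integral_eq_integral)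
    also have "\<dots> < \<infinity>"
      using h by (auto simp: integrable_iff_bounded ennreal_mult_less_top)
    finally show "(\<integral>\<^sup>+z. ennreal (norm (?f z)) \<partial>(lborel \<Otimes>\<^sub>M lborel)) < \<infinity>" .
  qed measurable
  then have int: "integrable (lborel \<Otimes>\<^sub>M lborel) (\<lambda>(p, q). complex_of_real (k (p - q)) * of_real (h q) * ?e p)" .
  have "(\<integral>p. of_real (conv k h p) * ?e p \<partial>lborel) = (\<integral>p. 1 / (2 * of_real pi) * (\<integral>q. of_real (k (p - q)) * of_real (h q) * ?e p \<partial>lborel) \<partial>lborel)"
    by (intro Bochner_Integration.integral_cong refl)
      (simp add: conv_eq_convolve convolve_def integral_complex_of_real[symmetric] del: integral_complex_of_real)
  also have "\<dots> = 1 / (2 * of_real pi) * (\<integral>p. \<integral>q. of_real (k (p - q)) * of_real (h q) * ?e p \<partial>lborel \<partial>lborel)"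
    by (rule integral_mult_right_zero)
  also have "(\<integral>p. \<integral>q. of_real (k (p - q)) * of_real (h q) * ?e p \<partial>lborel \<partial>lborel)
     = (\<integral>q. \<integral>p. of_real (k (p - q)) * of_real (h q) * ?e p \<partial>lborel \<partial>lborel)"
    by (rule lborel_pair.Fubini_integral[OF int, symmetric])
  also have "\<dots> = (\<integral>q. (\<integral>p. of_real (k p) * ?e p \<partial>lborel) * (of_real (h q) * ?e q) \<partial>lborel)"
  proof (intro Bochner_Integration.integral_cong refl)
    fix q
    have "(\<integral>p. of_real (k (p - q)) * of_real (h q) * ?e p \<partial>lborel)
       = (\<integral>p. of_real (k (p - q)) * ?e (p - q) * (of_real (h q) * ?e q) \<partial>lborel)"
      by (intro Bochner_Integration.integral_cong refl) (simp add: inner_diff_left cis_mult mult_ac)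
    also have "\<dots> = (\<integral>p. of_real (k (p - q)) * ?e (p - q) \<partial>lborel) * (of_real (h q) * ?e q)"
      by (rule integral_mult_left_zero)
    also have "(\<integral>p. of_real (k (p - q)) * ?e (p - q) \<partial>lborel) = (\<integral>p. of_real (k p) * ?e p \<partial>lborel)"
      by (rule integral_lborel_shift[of "\<lambda>p. of_real (k p) * ?e p" q]) measurable
    finally show "(\<integral>p. of_real (k (p - q)) * of_real (h q) * ?e p \<partial>lborel)
      = (\<integral>p. of_real (k p) * ?e p \<partial>lborel) * (of_real (h q) * ?e q)" .
  qed
  also have "\<dots> = (\<integral>p. of_real (k p) * ?e p \<partial>lborel) * (\<integral>q. of_real (h q) * ?e q \<partial>lborel)"
    by (rule integral_mult_right_zero)
  finally show ?thesis by (simp add: fourier_eq)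
qed

text \<open>The real part keeps the regularized solution real without any symmetry of
  \<open>u\<close>; norm bounds survive because the real part is at most the modulus.\<close>

definition multiplier_kernel :: "(real \<times> real \<Rightarrow> complex) \<Rightarrow> real \<times> real \<Rightarrow> real" where
  "multiplier_kernel u p = Re (inv_fourier u p)"

text \<open>Integrability and boundedness together put \<open>u\<close>, and hence its kernel, into
  L2. The bound \<open>M\<close> becomes the operator norm of the multiplier.\<close>

locale bounded_symbol =
  fixes u :: "real \<times> real \<Rightarrow> complex" and M :: real
  assumes integrable_u: "integrable lborel u"
    and u_le: "\<And>\<zeta>. norm (u \<zeta>) \<le> M"
begin

lemma measurable_u [measurable]: "u \<in> borel_measurable borel"
  using integrable_u by (auto dest: borel_measurable_integrable)

lemma M_nonneg: "0 \<le> M"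
  using u_le[of 0] norm_ge_zero[of "u 0"] by linarith

lemma measurable_kernel [measurable]: "multiplier_kernel u \<in> borel_measurable borel"
  unfolding multiplier_kernel_def[abs_def] by measurable

lemma square_integrable_kernel: "square_integrable (multiplier_kernel u)"
proof -
  have "integrable lborel (\<lambda>\<zeta>. (norm (u \<zeta>))\<^sup>2)"
  proof (rule Bochner_Integration.integrable_bound)
    show "integrable lborel (\<lambda>\<zeta>. M * norm (u \<zeta>))" using integrable_u by auto
    show "AE \<zeta> in lborel. norm ((norm (u \<zeta>))\<^sup>2) \<le> norm (M * norm (u \<zeta>))"
      using u_le M_nonneg by (auto simp: power2_eq_square abs_mult intro!: mult_right_mono always_eventually)
  qed auto
  then have "L2_le u (L2_norm u)" by (intro L2_le_norm) (auto simp: square_integrable_def)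
  from L2_le_Re[OF inv_plancherel_le[OF integrable_u this]]
  show ?thesis unfolding multiplier_kernel_def[abs_def] by (rule L2_le_square_integrable)
qed

text \<open>Both factors are square integrable, so the convolution converges absolutely at every
  point and is linear everywhere, in contrast to \<open>conv_diff_AE\<close>.\<close>

lemma integrable_kernel_mult:
  assumes "L2_le d B"
  shows "integrable lborel (\<lambda>q. multiplier_kernel u (p - q) * d q)"
proof -
  have [measurable]: "d \<in> borel_measurable borel" using L2_leD[OF assms] by auto
  have "square_integrable (\<lambda>q. multiplier_kernel u (p - q))"
    using square_integrable_kernel integrable_lborel_reflect[of "\<lambda>q. (norm (multiplier_kernel u q))\<^sup>2" p]
    by (simp add: square_integrable_def)
  from L2_le_mult_integrable(1)[OF L2_le_norm[OF this] assms]
  show ?thesis by (rule Bochner_Integration.integrable_bound) (auto simp: abs_mult)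
qed

lemma conv_kernel_diff:
  assumes "L2_le d A" "L2_le e B"
  shows "conv (multiplier_kernel u) (\<lambda>q. d q - e q) p = conv (multiplier_kernel u) d p - conv (multiplier_kernel u) e p"
  using integrable_kernel_mult[OF assms(1), of p] integrable_kernel_mult[OF assms(2), of p]
  by (simp add: conv_eq_convolve convolve_def right_diff_distrib)

lemma conv_kernel_cong_AE:
  assumes "d \<in> borel_measurable borel" "e \<in> borel_measurable borel" "AE q in lborel. d q = e q"
  shows "conv (multiplier_kernel u) d = conv (multiplier_kernel u) e"
  unfolding conv_eq_convolve[abs_def] by (subst convolve_cong_AE[OF measurable_kernel assms]) (rule refl)

lemma conv_kernel_eq:
  assumes d: "integrable lborel d"
  shows "conv (multiplier_kernel u) d p = Re (inv_fourier (\<lambda>\<zeta>. u \<zeta> * fourier_real d \<zeta>) p)"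
proof -
  have [measurable]: "d \<in> borel_measurable borel" using d by (auto dest: borel_measurable_integrable)
  let ?C = "1 / (2 * pi) * (\<integral>p. norm (u p) \<partial>lborel)"
  have "integrable lborel (\<lambda>q. inv_fourier u (p - q) * of_real (d q))"
  proof (rule Bochner_Integration.integrable_bound)
    show "integrable lborel (\<lambda>q. ?C * norm (d q))" using d by auto
    show "AE q in lborel. norm (inv_fourier u (p - q) * of_real (d q)) \<le> norm (?C * norm (d q))"
    proof (intro always_eventually allI)
      fix q
      have "norm (inv_fourier u (p - q)) \<le> ?C" unfolding inv_fourier_def by (rule norm_fourier_le[OF integrable_u])
      then have "norm (inv_fourier u (p - q)) * norm (d q) \<le> ?C * norm (d q)" by (rule mult_right_mono) auto
      then show "norm (inv_fourier u (p - q) * of_real (d q)) \<le> norm (?C * norm (d q))"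
        unfolding norm_mult norm_of_real by simp
    qed
  qed auto
  then have "Re (\<integral>q. inv_fourier u (p - q) * of_real (d q) \<partial>lborel) = (\<integral>q. multiplier_kernel u (p - q) * d q \<partial>lborel)"
    by (subst integral_Re[symmetric]) (auto simp: multiplier_kernel_def)
  moreover have "1 / (2 * of_real pi) = complex_of_real (1 / (2 * pi))" by simp
  ultimately show ?thesis
    by (simp only: inv_fourier_mult_fourier[OF integrable_of_real[OF d] integrable_u])
      (simp add: conv_eq_convolve convolve_def)
qed

text \<open>For truncated \<open>d\<close> the Plancherel inequality is used on both sides of the
  multiplication by \<open>u\<close>, which contributes the factor \<open>M\<close>. The
  convolutions with the truncations converge at every point by dominated convergence, and Fatou
  passes to \<open>d\<close>.\<close>

lemma L2_le_conv_kernel: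
  assumes d: "L2_le d B"
  shows "L2_le (conv (multiplier_kernel u) d) (M * B)"
proof (rule L2_le_Fatou[OF _ tendsto_const])
  have [measurable]: "d \<in> borel_measurable borel" using L2_leD[OF d] by auto
  show "conv (multiplier_kernel u) d \<in> borel_measurable borel"
    unfolding conv_eq_convolve[abs_def] by measurable
  show "L2_le (conv (multiplier_kernel u) (truncate n d)) (M * B)" for n
  proof -
    let ?d = "truncate n d"
    have i: "integrable lborel ?d" and B: "L2_le ?d B"
      using integrable_truncate[OF d] L2_le_truncate[OF d] by auto
    have ic: "integrable lborel (\<lambda>p. complex_of_real (?d p))" using i by (rule integrable_of_real)
    have F: "L2_le (fourier_real ?d) B" by (rule plancherel_le[OF ic L2_le_of_real[OF B]])
    let ?w = "\<lambda>\<zeta>. u \<zeta> * fourier_real ?d \<zeta>"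
    have wM: "L2_le ?w (M * B)"
      by (rule L2_le_dominated[OF F _ _ M_nonneg])
        (auto simp: norm_mult u_le intro!: mult_right_mono always_eventually)
    have wi: "integrable lborel ?w"
    proof (rule Bochner_Integration.integrable_bound)
      let ?C = "1 / (2 * pi) * (\<integral>p. norm (complex_of_real (?d p)) \<partial>lborel)"
      show "integrable lborel (\<lambda>\<zeta>. norm (u \<zeta>) * ?C)" using integrable_u by auto
      show "AE \<zeta> in lborel. norm (?w \<zeta>) \<le> norm (norm (u \<zeta>) * ?C)"
      proof (intro always_eventually allI)
        fix \<zeta>
        have "norm (u \<zeta>) * norm (fourier_real ?d \<zeta>) \<le> norm (u \<zeta>) * ?C"
          by (intro mult_left_mono norm_fourier_le[OF ic]) auto
        then show "norm (?w \<zeta>) \<le> norm (norm (u \<zeta>) * ?C)"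
          unfolding norm_mult by simp
      qed
    qed auto
    show ?thesis
      using L2_le_Re[OF inv_plancherel_le[OF wi wM]] by (simp add: conv_kernel_eq[OF i, abs_def])
  qed
  show "AE p in lborel. (\<lambda>n. conv (multiplier_kernel u) (truncate n d) p) \<longlonglongrightarrow> conv (multiplier_kernel u) d p"
  proof (intro always_eventually allI)
    fix p
    have "(\<lambda>n. \<integral>q. multiplier_kernel u (p - q) *\<^sub>R truncate n d q \<partial>lborel) \<longlonglongrightarrow> (\<integral>q. multiplier_kernel u (p - q) *\<^sub>R d q \<partial>lborel)"
    proof (rule integral_dominated_convergence[where w = "\<lambda>q. norm (multiplier_kernel u (p - q) * d q)"])
      show "integrable lborel (\<lambda>q. norm (multiplier_kernel u (p - q) * d q))"
        by (intro integrable_norm integrable_kernel_mult[OF d])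
      show "AE q in lborel. (\<lambda>n. multiplier_kernel u (p - q) *\<^sub>R truncate n d q) \<longlonglongrightarrow> multiplier_kernel u (p - q) *\<^sub>R d q"
        by (intro always_eventually allI tendsto_scaleR tendsto_const truncate_tendsto)
      show "AE q in lborel. norm (multiplier_kernel u (p - q) *\<^sub>R truncate n d q) \<le> norm (multiplier_kernel u (p - q) * d q)" for n
        using norm_truncate_le[of n d] by (auto simp: abs_mult intro!: mult_left_mono always_eventually)
    qed auto
    then show "(\<lambda>n. conv (multiplier_kernel u) (truncate n d) p) \<longlonglongrightarrow> conv (multiplier_kernel u) d p"
      unfolding conv_eq_convolve convolve_def by (intro tendsto_intros)
  qed
qed

end

section \<open>Regularized inversion of the convolution with \<open>S\<close>\<close>

text \<open>The line \<open>z = 0\<close> is removed because \<open>fourier_kernel_S\<close> only covers \<open>z \<noteq> 0\<close>, where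
  the Laplace integral has its parameter in the open right half plane.\<close>

definition punctured_disc :: "real \<Rightarrow> (real \<times> real) set" where
  "punctured_disc \<rho> = {\<zeta>. norm \<zeta> < \<rho> \<and> fst \<zeta> \<noteq> 0}"

lemma measurable_punctured_disc [measurable]: "punctured_disc \<rho> \<in> sets borel"
proof -
  have "punctured_disc \<rho> = ball 0 \<rho> \<inter> fst -` (- {0})" by (auto simp: punctured_disc_def)
  moreover have "open \<dots>" by (intro open_Int open_ball open_vimage_fst) auto
  ultimately show ?thesis by simp
qed

lemma emeasure_punctured_disc: "emeasure lborel (punctured_disc \<rho>) < \<infinity>"
  by (rule emeasure_bounded_finite[OF bounded_subset[OF bounded_ball[of 0 \<rho>]]]) (auto simp: punctured_disc_def)

text \<open>Removing the line costs nothing: off a null set, the complement of the punctured disc is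
  the region of norm at least \<rho>.\<close>

lemma AE_fst_neq_0: "AE \<zeta> in lborel. fst (\<zeta> :: real \<times> real) \<noteq> 0"
proof -
  let ?N = "{\<zeta> :: real \<times> real. (1, 0) \<bullet> \<zeta> = 0}"
  have "negligible ?N" by (rule negligible_hyperplane) (simp add: zero_prod_def)
  moreover have "?N \<in> sets borel" by (intro borel_closed closed_hyperplane)
  ultimately have "?N \<in> null_sets lborel"
    by (simp add: negligible_iff_null_sets null_sets_def emeasure_completion)
  from AE_not_in[OF this] show ?thesis by eventually_elim (auto simp: inner_prod_def)
qed

text \<open>The squared modulus of \<open>w\<^sup>2\<close> is z^4 + r^2. Since z^2 \<le> \<rho>^2
  and 1 \<le> \<rho>^2, it is at most (z^2 + r^2) \<rho>^2 \<le> \<rho>^4, so the modulus of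
  \<open>w\<close>, and with it its real part, is at most \<rho>.\<close>

lemma fourier_kernel_S_ge:
  assumes \<zeta>: "\<zeta> \<in> punctured_disc \<rho>" and \<rho>: "1 \<le> \<rho>"
  shows "2 * exp (- \<rho>) \<le> norm (fourier_real kernel_S \<zeta>)"
proof -
  obtain z r where zr: "\<zeta> = (z, r)" by (cases \<zeta>)
  have z: "z \<noteq> 0" and lt: "z\<^sup>2 + r\<^sup>2 \<le> \<rho>\<^sup>2"
    using \<zeta> power_mono[of "norm \<zeta>" \<rho> 2] by (auto simp: punctured_disc_def zr norm_pair_sq)
  let ?s = "Complex (z\<^sup>2) r"
  have "1 \<le> \<rho>\<^sup>2" using \<rho> by simp
  then have "(norm ?s)\<^sup>2 \<le> (z\<^sup>2 + r\<^sup>2) * \<rho>\<^sup>2"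
    using mult_left_mono[of "z\<^sup>2" "\<rho>\<^sup>2" "z\<^sup>2"] mult_left_mono[of 1 "\<rho>\<^sup>2" "r\<^sup>2"] lt
    by (simp add: cmod_def power2_eq_square[of "z\<^sup>2"] distrib_right sum_power2_ge_zero)
      (smt (verit) zero_le_power2)
  also have "\<dots> \<le> \<rho>\<^sup>2 * \<rho>\<^sup>2" using lt by (intro mult_right_mono) auto
  finally have "norm ?s \<le> \<rho>\<^sup>2" using power2_le_imp_le[of "norm ?s" "\<rho>\<^sup>2"] by (simp add: power2_eq_square)
  then have "norm (csqrt ?s) \<le> \<rho>" using \<rho> by (simp add: norm_csqrt real_le_lsqrt)
  then have "Re (csqrt ?s) \<le> \<rho>" using complex_Re_le_cmod order_trans by blast
  then show ?thesis using fourier_kernel_S[OF z, of r] by (simp add: zr norm_mult)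
qed

definition inverse_symbol :: "real \<Rightarrow> real \<times> real \<Rightarrow> complex" where
  "inverse_symbol \<rho> \<zeta> = indicator (punctured_disc \<rho>) \<zeta> *\<^sub>R inverse (fourier_real kernel_S \<zeta>)"

lemma borel_measurable_inverse_symbol [measurable]: "inverse_symbol \<rho> \<in> borel_measurable borel"
  unfolding inverse_symbol_def[abs_def] by measurable

lemma inverse_symbol_mult:
  assumes "1 \<le> \<rho>"
  shows "inverse_symbol \<rho> \<zeta> * fourier_real kernel_S \<zeta> = indicator (punctured_disc \<rho>) \<zeta>"
proof (cases "\<zeta> \<in> punctured_disc \<rho>")
  case True
  have "0 < norm (fourier_real kernel_S \<zeta>)"
    by (rule less_le_trans[OF _ fourier_kernel_S_ge[OF True assms]]) simp
  then have "fourier_real kernel_S \<zeta> \<noteq> 0" by simp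
  then show ?thesis using True by (simp add: inverse_symbol_def)
qed (simp add: inverse_symbol_def)

lemma norm_inverse_symbol_le:
  assumes "1 \<le> \<rho>"
  shows "norm (inverse_symbol \<rho> \<zeta>) \<le> indicator (punctured_disc \<rho>) \<zeta> * (exp \<rho> / 2)"
proof (cases "\<zeta> \<in> punctured_disc \<rho>")
  case True
  have "inverse (norm (fourier_real kernel_S \<zeta>)) \<le> inverse (2 * exp (- \<rho>))"
    by (rule le_imp_inverse_le[OF fourier_kernel_S_ge[OF True assms]]) simp
  then show ?thesis using True by (simp add: inverse_symbol_def norm_inverse exp_minus)
qed (simp add: inverse_symbol_def)

lemma bounded_symbol_inverse_symbol:
  assumes "1 \<le> \<rho>"
  shows "bounded_symbol (inverse_symbol \<rho>) (exp \<rho> / 2)"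
proof
  have i: "integrable lborel (\<lambda>\<zeta>. indicator (punctured_disc \<rho>) \<zeta> *\<^sub>R (exp \<rho> / 2))"
    using emeasure_punctured_disc by (intro integrable_scaleR_left) auto
  show "integrable lborel (inverse_symbol \<rho>)"
    by (rule Bochner_Integration.integrable_bound[OF i])
      (use norm_inverse_symbol_le[OF assms] in \<open>auto intro!: always_eventually\<close>)
  show "norm (inverse_symbol \<rho> \<zeta>) \<le> exp \<rho> / 2" for \<zeta>
    by (rule order_trans[OF norm_inverse_symbol_le[OF assms]]) (auto simp: indicator_def)
qed

definition regularized_inverse :: "real \<Rightarrow> (real \<times> real \<Rightarrow> real) \<Rightarrow> real \<times> real \<Rightarrow> real" where
  "regularized_inverse \<rho> = conv (multiplier_kernel (inverse_symbol \<rho>))"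

text \<open>The bound for the norm of convolution with a nonnegative kernel in the normalization of
  \<open>conv\<close>.\<close>

definition conv_mass :: "(real \<times> real \<Rightarrow> real) \<Rightarrow> real" where
  "conv_mass k = 1 / (2 * pi) * (\<integral>p. k p \<partial>lborel)"

lemma L2_le_conv_S: "L2_le h B \<Longrightarrow> L2_le (conv kernel_S h) (conv_mass kernel_S * B)"
  unfolding conv_mass_def by (rule L2_le_conv[OF integrable_kernel_S kernel_S_nonneg])

lemma L2_le_conv_R: "L2_le h B \<Longrightarrow> L2_le (conv kernel_R h) (conv_mass kernel_R * B)"
  unfolding conv_mass_def by (rule L2_le_conv[OF integrable_kernel_R kernel_R_nonneg])

lemma conv_mass_nonneg: "0 \<le> conv_mass kernel_S" "0 \<le> conv_mass kernel_R"
  by (simp_all add: conv_mass_def kernel_S_nonneg kernel_R_nonneg)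

section \<open>The regularized inverse at a fixed radius\<close>

context
  fixes \<rho> :: real
  assumes \<rho>: "1 \<le> \<rho>"
begin

interpretation bounded_symbol "inverse_symbol \<rho>" "exp \<rho> / 2"
  by (rule bounded_symbol_inverse_symbol[OF \<rho>])

lemma L2_le_regularized_inverse: "L2_le d B \<Longrightarrow> L2_le (regularized_inverse \<rho> d) (exp \<rho> / 2 * B)"
  unfolding regularized_inverse_def by (rule L2_le_conv_kernel)

lemma regularized_inverse_diff:
  "L2_le d A \<Longrightarrow> L2_le e B \<Longrightarrow>
    regularized_inverse \<rho> (\<lambda>q. d q - e q) p = regularized_inverse \<rho> d p - regularized_inverse \<rho> e p"
  unfolding regularized_inverse_def by (rule conv_kernel_diff)

lemma regularized_inverse_cong_AE:
  "d \<in> borel_measurable borel \<Longrightarrow> e \<in> borel_measurable borel \<Longrightarrow> AE q in lborel. d q = e q \<Longrightarrow>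
    regularized_inverse \<rho> d = regularized_inverse \<rho> e"
  unfolding regularized_inverse_def by (rule conv_kernel_cong_AE)

text \<open>The symbol cancels the transform of S on the disc, which leaves a sharp low-pass
  filter.\<close>

lemma regularized_inverse_conv_S:
  assumes h: "integrable lborel h"
  shows "regularized_inverse \<rho> (conv kernel_S h) p =
    Re (inv_fourier (\<lambda>\<zeta>. indicator (punctured_disc \<rho>) \<zeta> *\<^sub>R fourier_real h \<zeta>) p)"
proof -
  have "inverse_symbol \<rho> \<zeta> * fourier_real (conv kernel_S h) \<zeta> = indicator (punctured_disc \<rho>) \<zeta> *\<^sub>R fourier_real h \<zeta>" for \<zeta>
    using inverse_symbol_mult[OF \<rho>, of \<zeta>]
    by (simp add: fourier_conv[OF integrable_kernel_S kernel_S_nonneg h] mult.assoc[symmetric] scaleR_conv_of_real indicator_def)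
  then show ?thesis
    unfolding regularized_inverse_def
    using conv_kernel_eq[OF integrable_conv[OF integrable_kernel_S kernel_S_nonneg h]] by simp
qed

text \<open>Convolution with S is linear only almost everywhere, but the regularized inverse does
  not see null sets, so the composition is linear at every point.\<close>

lemma regularized_inverse_conv_S_diff:
  assumes g: "L2_le g A" and h: "L2_le h B"
  shows "regularized_inverse \<rho> (conv kernel_S (\<lambda>q. g q - h q)) p =
    regularized_inverse \<rho> (conv kernel_S g) p - regularized_inverse \<rho> (conv kernel_S h) p"
proof -
  note c = L2_le_conv_S
  have "regularized_inverse \<rho> (conv kernel_S (\<lambda>q. g q - h q)) = regularized_inverse \<rho> (\<lambda>p. conv kernel_S g p - conv kernel_S h p)"
    by (intro regularized_inverse_cong_AE conv_diff_AE[OF integrable_kernel_S kernel_S_nonneg g h]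
        L2_leD(1)[OF c[OF L2_le_diff[OF g h]]] L2_leD(1)[OF L2_le_diff[OF c[OF g] c[OF h]]])
  then show ?thesis by (simp add: regularized_inverse_diff[OF c[OF g] c[OF h]])
qed

text \<open>The bound has no factor \<open>exp \<rho>\<close>. Truncations of \<open>h\<close> are
  low-pass filtered, which costs nothing; the remainder is estimated crudely with
  \<open>exp \<rho>\<close>, which is harmless because \<rho> is fixed while the remainder tends to
  0.\<close>

lemma regularized_inverse_contraction:
  assumes h: "L2_le h B"
  shows "L2_le (regularized_inverse \<rho> (conv kernel_S h)) B"
proof -
  define c where "c = conv_mass kernel_S"
  note c = L2_le_conv_S[folded c_def]
  let ?T = "\<lambda>h. regularized_inverse \<rho> (conv kernel_S h)"
  define e where "e n = L2_norm (\<lambda>p. h p - truncate n h p)" for n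
  have e: "L2_le (\<lambda>p. h p - truncate n h p) (e n)" for n
    unfolding e_def by (intro L2_le_norm L2_le_square_integrable[OF L2_le_diff[OF h L2_le_truncate[OF h]]])
  have e0: "e \<longlonglongrightarrow> 0" unfolding e_def[abs_def] by (rule L2_norm_truncate_tendsto[OF L2_le_square_integrable[OF h]])
  have "L2_le (?T h) (B + exp \<rho> / 2 * (c * e n))" for n
  proof -
    let ?h = "truncate n h"
    have i: "integrable lborel ?h" and hB: "L2_le ?h B" using integrable_truncate[OF h] L2_le_truncate[OF h] by auto
    have ic: "integrable lborel (\<lambda>p. complex_of_real (?h p))" using i by (rule integrable_of_real)
    have F: "L2_le (fourier_real ?h) B" by (rule plancherel_le[OF ic L2_le_of_real[OF hB]])
    have [measurable]: "fourier_real ?h \<in> borel_measurable borel" using L2_leD[OF F] by auto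
    have "L2_le (\<lambda>\<zeta>. indicator (punctured_disc \<rho>) \<zeta> *\<^sub>R fourier_real ?h \<zeta>) (1 * B)"
      by (rule L2_le_dominated[OF F]) (measurable, auto simp: indicator_def)
    then have "L2_le (?T ?h) B"
      unfolding regularized_inverse_conv_S[OF i, abs_def]
      by (intro L2_le_Re inv_plancherel_le integrable_fourier_indicator ic emeasure_punctured_disc) auto
    moreover have "L2_le (?T (\<lambda>p. h p - ?h p)) (exp \<rho> / 2 * (c * e n))"
      by (intro L2_le_regularized_inverse c e)
    ultimately have "L2_le (\<lambda>p. ?T ?h p + ?T (\<lambda>p. h p - ?h p) p) (B + exp \<rho> / 2 * (c * e n))"
      by (rule L2_le_add)
    moreover have "?T ?h p + ?T (\<lambda>p. h p - ?h p) p = ?T h p" for p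
      by (simp add: regularized_inverse_conv_S_diff[OF h hB])
    ultimately show ?thesis by simp
  qed
  moreover have "(\<lambda>n. B + exp \<rho> / 2 * (c * e n)) \<longlonglongrightarrow> B + exp \<rho> / 2 * (c * 0)" by (intro tendsto_add tendsto_mult tendsto_const e0)
  ultimately show ?thesis using L2_le_limit[of "?T h" "\<lambda>n. B + exp \<rho> / 2 * (c * e n)" B] by simp
qed

text \<open>On the truncation the defect is the part of its transform outside the disc. On the
  remainder the defect is at most its filtered image plus itself, hence the factor 2, independent of
  \<rho>.\<close>

lemma regularization_error:
  assumes v: "square_integrable v"
    and t: "L2_le (\<lambda>\<zeta>. indicator (- punctured_disc \<rho>) \<zeta> *\<^sub>R fourier_real (truncate n v) \<zeta>) t"
  shows "L2_le (\<lambda>p. regularized_inverse \<rho> (conv kernel_S v) p - v p) (2 * L2_norm (\<lambda>p. v p - truncate n v p) + t)"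
proof -
  let ?T = "\<lambda>h. regularized_inverse \<rho> (conv kernel_S h)" and ?v = "truncate n v"
  have vB: "L2_le v (L2_norm v)" by (rule L2_le_norm[OF v])
  note tB = L2_le_truncate[OF vB, of n] and i = integrable_truncate[OF vB, of n]
  have ic: "integrable lborel (\<lambda>p. complex_of_real (?v p))" using i by (rule integrable_of_real)
  have e: "L2_le (\<lambda>p. v p - ?v p) (L2_norm (\<lambda>p. v p - ?v p))"
    by (intro L2_le_norm L2_le_square_integrable[OF L2_le_diff[OF vB tB]])
  have "L2_le (\<lambda>p. Re (inv_fourier (\<lambda>\<zeta>. indicator (punctured_disc \<rho>) \<zeta> *\<^sub>R fourier_real ?v \<zeta>) p - of_real (?v p))) t"
    by (intro L2_le_Re truncated_inversion[OF ic L2_le_of_real[OF tB]] emeasure_punctured_disc t) auto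
  then have 1: "L2_le (\<lambda>p. ?T ?v p - ?v p) t"
    by (simp add: regularized_inverse_conv_S[OF i])
  have 2: "L2_le (\<lambda>p. ?T (\<lambda>p. v p - ?v p) p - (v p - ?v p)) (L2_norm (\<lambda>p. v p - ?v p) + L2_norm (\<lambda>p. v p - ?v p))"
    by (intro L2_le_diff regularized_inverse_contraction e)
  have eq: "(?T ?v p - ?v p) + (?T (\<lambda>p. v p - ?v p) p - (v p - ?v p)) = ?T v p - v p" for p
    by (simp add: regularized_inverse_conv_S_diff[OF vB tB])
  show ?thesis by (rule L2_le_mono[OF L2_le_add[OF 1 2, unfolded eq]]) simp
qed

end

text \<open>The order of choices matters: \<open>n\<close> is fixed independently of \<rho>, and
  only then is \<rho> taken beyond the bulk \<open>N\<close> of the transform of that truncation.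
  The remainder is counted twice, hence \<open>e / 4\<close> for it and \<open>e / 2\<close> for the
  tail.\<close>

lemma regularization_error_tendsto_0:
  assumes v: "square_integrable v"
  shows "((\<lambda>\<rho>. L2_norm (\<lambda>p. regularized_inverse \<rho> (conv kernel_S v) p - v p)) \<longlongrightarrow> 0) at_top"
proof (rule order_tendstoI)
  fix e :: real assume e: "0 < e"
  have vB: "L2_le v (L2_norm v)" by (rule L2_le_norm[OF v])
  have "\<forall>\<^sub>F n in sequentially. L2_norm (\<lambda>p. v p - truncate n v p) < e / 4"
    using e by (intro order_tendstoD(2)[OF L2_norm_truncate_tendsto[OF v]]) auto
  then obtain n where n: "L2_norm (\<lambda>p. v p - truncate n v p) < e / 4" by (auto simp: eventually_sequentially)
  let ?F = "fourier_real (truncate n v)"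
  have "L2_le ?F (L2_norm v)"
    by (intro plancherel_le integrable_of_real integrable_truncate[OF vB] L2_le_of_real L2_le_truncate[OF vB])
  then have F: "square_integrable ?F" by (rule L2_le_square_integrable)
  then have [measurable]: "?F \<in> borel_measurable borel" by (simp add: square_integrable_def)
  have FB: "L2_le ?F (L2_norm ?F)" by (rule L2_le_norm[OF F])
  have "\<forall>\<^sub>F N in sequentially. L2_norm (\<lambda>p. ?F p - truncate N ?F p) < e / 2"
    using e by (intro order_tendstoD(2)[OF L2_norm_truncate_tendsto[OF F]]) auto
  then obtain N where N: "L2_norm (\<lambda>p. ?F p - truncate N ?F p) < e / 2" by (auto simp: eventually_sequentially)
  have tail: "L2_le (\<lambda>p. ?F p - truncate N ?F p) (L2_norm (\<lambda>p. ?F p - truncate N ?F p))"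
    by (intro L2_le_norm L2_le_square_integrable[OF L2_le_diff[OF FB L2_le_truncate[OF FB]]])
  have "\<forall>\<^sub>F \<rho> in at_top. max 1 (real N) \<le> \<rho>" by (rule eventually_ge_at_top)
  then show "\<forall>\<^sub>F \<rho> in at_top. L2_norm (\<lambda>p. regularized_inverse \<rho> (conv kernel_S v) p - v p) < e"
  proof eventually_elim
    case (elim \<rho>)
    have "L2_le (\<lambda>\<zeta>. indicator (- punctured_disc \<rho>) \<zeta> *\<^sub>R ?F \<zeta>) (1 * L2_norm (\<lambda>p. ?F p - truncate N ?F p))"
    proof (rule L2_le_dominated[OF tail])
      show "AE \<zeta> in lborel. norm (indicator (- punctured_disc \<rho>) \<zeta> *\<^sub>R ?F \<zeta>) \<le> 1 * norm (?F \<zeta> - truncate N ?F \<zeta>)"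
        using AE_fst_neq_0
        by eventually_elim (use elim in \<open>auto simp: indicator_def punctured_disc_def truncate_def\<close>)
    qed auto
    from regularization_error[OF _ v this]
    show ?case using elim n N by (auto simp: L2_le_iff)
  qed
next
  fix e :: real assume "e < 0"
  then show "\<forall>\<^sub>F \<rho> in at_top. e < L2_norm (\<lambda>p. regularized_inverse \<rho> (conv kernel_S v) p - v p)"
    by (intro always_eventually allI) (rule less_le_trans[OF _ L2_norm_nonneg])
qed

text \<open>Outside the disc the Sobolev weight is at least \<open>\<rho> powr m\<close>. The
  transform \<open>H\<close> is only an L2 limit of transforms of truncations, so the estimate is
  made for truncations with an extra error \<open>\<delta> n\<close>, and n then tends to infinity
  at fixed \<rho>.\<close>

lemma regularization_error_sobolev:
  assumes s: "sobolev m v" and m: "0 < m"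
  obtains K where "0 \<le> K"
    "\<And>\<rho>. 1 \<le> \<rho> \<Longrightarrow> L2_le (\<lambda>p. regularized_inverse \<rho> (conv kernel_S v) p - v p) (\<rho> powr (- m) * K)"
proof -
  have v: "square_integrable v" using s by (simp add: sobolev_def)
  have vB: "L2_le v (L2_norm v)" by (rule L2_le_norm[OF v])
  obtain H where H: "is_fourier_L2 (\<lambda>p. complex_of_real (v p)) H"
    and w: "square_integrable (\<lambda>\<zeta>. (1 + (norm \<zeta>)\<^sup>2) powr (m / 2) *\<^sub>R H \<zeta>)"
    using s by (auto simp: sobolev_def)
  have Hs: "square_integrable H" using H by (simp add: is_fourier_L2_def)
  then have [measurable]: "H \<in> borel_measurable borel" by (simp add: square_integrable_def)
  define K where "K = L2_norm (\<lambda>\<zeta>. (1 + (norm \<zeta>)\<^sup>2) powr (m / 2) *\<^sub>R H \<zeta>)"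
  let ?F = "\<lambda>n. fourier_real (truncate n v)"
  have FB: "L2_le (?F n) (L2_norm v)" for n
    by (intro plancherel_le integrable_of_real integrable_truncate[OF vB] L2_le_of_real L2_le_truncate[OF vB])
  have [measurable]: "?F n \<in> borel_measurable borel" for n using L2_leD[OF FB] by auto
  define \<delta> where "\<delta> n = L2_norm (\<lambda>\<zeta>. H \<zeta> - ?F n \<zeta>)" for n
  have ds: "square_integrable (\<lambda>\<zeta>. H \<zeta> - ?F n \<zeta>)" for n
    by (rule L2_le_square_integrable[OF L2_le_diff[OF L2_le_norm[OF Hs] FB]])
  have "(\<lambda>n. ennreal ((\<delta> n)\<^sup>2)) \<longlonglongrightarrow> 0"
  proof -
    have "indicator (ball 0 (real n)) p * complex_of_real (v p) = of_real (truncate n v p)" for n p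
      by (simp add: truncate_def indicator_def)
    then show ?thesis using H nn_integral_square_integrable[OF ds] by (simp add: is_fourier_L2_def \<delta>_def)
  qed
  then have "(\<lambda>n. (\<delta> n)\<^sup>2) \<longlonglongrightarrow> 0"
    using tendsto_ennreal_iff[of "\<lambda>n. (\<delta> n)\<^sup>2" sequentially 0] by simp
  then have "(\<lambda>n. sqrt ((\<delta> n)\<^sup>2)) \<longlonglongrightarrow> sqrt 0" by (rule tendsto_real_sqrt)
  then have d0: "\<delta> \<longlonglongrightarrow> 0" by (simp add: \<delta>_def[abs_def])
  show thesis
  proof
    show "0 \<le> K" by (simp add: K_def)
    fix \<rho> :: real assume \<rho>: "1 \<le> \<rho>"
    let ?I = "indicator (- punctured_disc \<rho>)"
    have IH: "L2_le (\<lambda>\<zeta>. ?I \<zeta> *\<^sub>R H \<zeta>) (\<rho> powr (- m) * K)"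
    proof (rule L2_le_dominated)
      show "L2_le (\<lambda>\<zeta>. (1 + (norm \<zeta>)\<^sup>2) powr (m / 2) *\<^sub>R H \<zeta>) K" unfolding K_def by (rule L2_le_norm[OF w])
      show "AE \<zeta> in lborel. norm (?I \<zeta> *\<^sub>R H \<zeta>) \<le> \<rho> powr - m * norm ((1 + (norm \<zeta>)\<^sup>2) powr (m / 2) *\<^sub>R H \<zeta>)"
        using AE_fst_neq_0
      proof eventually_elim
        case (elim \<zeta>)
        show ?case
        proof (cases "\<zeta> \<in> punctured_disc \<rho>")
          case False
          then have "\<rho> \<le> norm \<zeta>" using elim by (auto simp: punctured_disc_def)
          then have "\<rho>\<^sup>2 \<le> (norm \<zeta>)\<^sup>2" using \<rho> by (intro power_mono) auto
          then have "\<rho>\<^sup>2 \<le> 1 + (norm \<zeta>)\<^sup>2" by linarith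
          then have "(\<rho>\<^sup>2) powr (m / 2) \<le> (1 + (norm \<zeta>)\<^sup>2) powr (m / 2)" using m by (intro powr_mono2) auto
          moreover have "(\<rho>\<^sup>2) powr (m / 2) = \<rho> powr m" using \<rho> by (simp add: powr_powr flip: powr_numeral)
          ultimately have "1 \<le> \<rho> powr - m * (1 + (norm \<zeta>)\<^sup>2) powr (m / 2)"
            using \<rho> by (simp add: powr_minus field_simps)
          then have "1 * norm (H \<zeta>) \<le> (\<rho> powr - m * (1 + (norm \<zeta>)\<^sup>2) powr (m / 2)) * norm (H \<zeta>)"
            by (rule mult_right_mono) auto
          then show ?thesis using False by (simp add: mult.assoc)
        qed auto
      qed
    qed auto
    show "L2_le (\<lambda>p. regularized_inverse \<rho> (conv kernel_S v) p - v p) (\<rho> powr (- m) * K)"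
    proof (rule L2_le_limit)
      fix n
      have "L2_le (\<lambda>\<zeta>. ?I \<zeta> *\<^sub>R (H \<zeta> - ?F n \<zeta>)) (1 * \<delta> n)"
        unfolding \<delta>_def by (rule L2_le_dominated[OF L2_le_norm[OF ds]]) (measurable, auto simp: indicator_def)
      from L2_le_diff[OF IH this]
      have "L2_le (\<lambda>\<zeta>. ?I \<zeta> *\<^sub>R ?F n \<zeta>) (\<rho> powr (- m) * K + \<delta> n)"
        by (simp add: scaleR_diff_right)
      from regularization_error[OF \<rho> v this]
      show "L2_le (\<lambda>p. regularized_inverse \<rho> (conv kernel_S v) p - v p)
        (2 * L2_norm (\<lambda>p. v p - truncate n v p) + (\<rho> powr (- m) * K + \<delta> n))" .
    next
      have "(\<lambda>n. 2 * L2_norm (\<lambda>p. v p - truncate n v p) + (\<rho> powr (- m) * K + \<delta> n)) \<longlonglongrightarrow> 2 * 0 + (\<rho> powr (- m) * K + 0)"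
        by (intro tendsto_add tendsto_mult tendsto_const d0 L2_norm_truncate_tendsto[OF v])
      then show "(\<lambda>n. 2 * L2_norm (\<lambda>p. v p - truncate n v p) + (\<rho> powr (- m) * K + \<delta> n)) \<longlonglongrightarrow> \<rho> powr (- m) * K"
        by simp
    qed
  qed
qed

section \<open>Error estimates\<close>

definition data_term :: "(real \<times> real \<Rightarrow> real) \<Rightarrow> (real \<times> real \<Rightarrow> real) \<Rightarrow> real \<times> real \<Rightarrow> real" where
  "data_term f g p = 2 * conv kernel_R f p - conv kernel_S g p + 4 * f p"

definition cutoff :: "real \<Rightarrow> real \<Rightarrow> real" where
  "cutoff \<gamma> \<epsilon> = \<gamma> / 2 * ln (1 / \<epsilon>)"

text \<open>The range of \<epsilon> gives ln (1/\<epsilon>) \<ge> 3/\<gamma>, hence a radius of at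
  least 3/2, above the value 1 that the estimates on the disc assume.\<close>

lemma cutoff_ge_1:
  assumes "0 < \<gamma>" "\<epsilon> \<in> {0<..<exp (- 3 / \<gamma>)}"
  shows "1 \<le> cutoff \<gamma> \<epsilon>"
proof -
  have "ln \<epsilon> < ln (exp (- 3 / \<gamma>))" using assms by (subst ln_less_cancel_iff) auto
  then have "3 / \<gamma> \<le> ln (1 / \<epsilon>)" using assms by (simp add: ln_div)
  then have "\<gamma> / 2 * (3 / \<gamma>) \<le> cutoff \<gamma> \<epsilon>" unfolding cutoff_def using assms by (intro mult_left_mono) auto
  then show ?thesis using assms by simp
qed

lemma exp_cutoff:
  assumes "0 < \<epsilon>"
  shows "exp (cutoff \<gamma> \<epsilon>) = \<epsilon> powr (- (\<gamma> / 2))"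
  using assms by (simp add: cutoff_def powr_def ln_div)

lemma cutoff_at_top:
  assumes "0 < \<gamma>"
  shows "filterlim (cutoff \<gamma>) at_top (at_right 0)"
  unfolding cutoff_def[abs_def] using assms by real_asymp

definition data_bound :: real where
  "data_bound = 2 * conv_mass kernel_R + conv_mass kernel_S + 4"

lemma data_bound_pos: "0 < data_bound"
  using conv_mass_nonneg by (simp add: data_bound_def)

lemma L2_le_data_term:
  assumes f: "L2_le f A" and g: "L2_le g A"
  shows "L2_le (data_term f g) (data_bound * A)"
proof -
  have "L2_le (\<lambda>p. 2 *\<^sub>R conv kernel_R f p - conv kernel_S g p + 4 *\<^sub>R f p)
      (\<bar>2\<bar> * (conv_mass kernel_R * A) + conv_mass kernel_S * A + \<bar>4\<bar> * A)"
    by (intro L2_le_add L2_le_diff L2_le_scale L2_le_conv_R L2_le_conv_S f g)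
  then show ?thesis by (simp add: data_term_def[abs_def] data_bound_def algebra_simps)
qed

lemma data_term_cong_AE:
  assumes [measurable]: "f \<in> borel_measurable borel" "f' \<in> borel_measurable borel"
    "g \<in> borel_measurable borel" "g' \<in> borel_measurable borel"
    and ae: "AE p in lborel. f p = f' p" "AE p in lborel. g p = g' p"
  shows "AE p in lborel. data_term f g p = data_term f' g' p"
proof -
  have c: "conv kernel_R f = conv kernel_R f'" "conv kernel_S g = conv kernel_S g'"
    using ae by (simp_all add: conv_eq_convolve[abs_def] convolve_cong_AE[of _ f f'] convolve_cong_AE[of _ g g'])
  show ?thesis using ae(1) by eventually_elim (simp add: data_term_def c)
qed

lemma data_term_diff_AE:
  assumes f: "L2_le f A" and f0: "L2_le f\<^sub>0 A\<^sub>0" and g: "L2_le g B" and g0: "L2_le g\<^sub>0 B\<^sub>0"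
  shows "AE p in lborel. data_term f g p - data_term f\<^sub>0 g\<^sub>0 p = data_term (\<lambda>p. f p - f\<^sub>0 p) (\<lambda>p. g p - g\<^sub>0 p) p"
  using conv_diff_AE[OF integrable_kernel_R kernel_R_nonneg f f0] conv_diff_AE[OF integrable_kernel_S kernel_S_nonneg g g0]
  by eventually_elim (simp add: data_term_def algebra_simps)

text \<open>Since the regularized inverse ignores null sets, the exact data term may be replaced by
  \<open>conv kernel_S v\<^sub>0\<close>. The error is then the image of the data error plus the
  regularization error of \<open>v\<^sub>0\<close>.\<close>

lemma regularized_inverse_stability:
  assumes \<rho>: "1 \<le> \<rho>" and ex: "exact_solution f\<^sub>0 g\<^sub>0 v\<^sub>0"
    and f: "causal_L2 f" and g: "causal_L2 g"
    and fe: "L2_norm (\<lambda>p. f p - f\<^sub>0 p) \<le> \<epsilon>" and ge: "L2_norm (\<lambda>p. g p - g\<^sub>0 p) \<le> \<epsilon>"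
  shows "L2_norm (\<lambda>p. regularized_inverse \<rho> (data_term f g) p - v\<^sub>0 p) \<le>
    exp \<rho> / 2 * (data_bound * \<epsilon>) + L2_norm (\<lambda>p. regularized_inverse \<rho> (conv kernel_S v\<^sub>0) p - v\<^sub>0 p)"
proof -
  have sq: "square_integrable f" "square_integrable g" "square_integrable f\<^sub>0" "square_integrable g\<^sub>0" "square_integrable v\<^sub>0"
    using f g ex by (auto simp: causal_L2_def exact_solution_def)
  note N = sq[THEN L2_le_norm]
  have d: "L2_le (data_term f g) (data_bound * max (L2_norm f) (L2_norm g))"
    by (intro L2_le_data_term L2_le_mono[OF N(1)] L2_le_mono[OF N(2)]) auto
  have d0: "L2_le (data_term f\<^sub>0 g\<^sub>0) (data_bound * max (L2_norm f\<^sub>0) (L2_norm g\<^sub>0))"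
    by (intro L2_le_data_term L2_le_mono[OF N(3)] L2_le_mono[OF N(4)]) auto
  have fd: "L2_le (\<lambda>p. f p - f\<^sub>0 p) \<epsilon>" and gd: "L2_le (\<lambda>p. g p - g\<^sub>0 p) \<epsilon>"
    using L2_le_square_integrable[OF L2_le_diff[OF N(1,3)]] L2_le_square_integrable[OF L2_le_diff[OF N(2,4)]] fe ge
    by (simp_all add: L2_le_iff)
  have "L2_le (\<lambda>p. data_term f g p - data_term f\<^sub>0 g\<^sub>0 p) (data_bound * \<epsilon>)"
    by (rule L2_le_AE_cong[OF L2_le_data_term[OF fd gd] L2_leD(1)[OF L2_le_diff[OF d d0]] data_term_diff_AE[OF N(1,3,2,4)]])
  from L2_le_regularized_inverse[OF \<rho> this]
  have st: "L2_le (\<lambda>p. regularized_inverse \<rho> (data_term f g) p - regularized_inverse \<rho> (data_term f\<^sub>0 g\<^sub>0) p) (exp \<rho> / 2 * (data_bound * \<epsilon>))"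
    by (simp add: regularized_inverse_diff[OF \<rho> d d0, abs_def])
  have "AE p in lborel. conv kernel_S v\<^sub>0 p = data_term f\<^sub>0 g\<^sub>0 p"
    using ex by (simp add: exact_solution_def ae_eq_def data_term_def)
  from regularized_inverse_cong_AE[OF \<rho> L2_leD(1)[OF L2_le_conv_S[OF N(5)]] L2_leD(1)[OF d0] this]
  have eq: "regularized_inverse \<rho> (conv kernel_S v\<^sub>0) = regularized_inverse \<rho> (data_term f\<^sub>0 g\<^sub>0)" .
  have er: "L2_le (\<lambda>p. regularized_inverse \<rho> (conv kernel_S v\<^sub>0) p - v\<^sub>0 p)
      (L2_norm (\<lambda>p. regularized_inverse \<rho> (conv kernel_S v\<^sub>0) p - v\<^sub>0 p))"
    by (intro L2_le_norm L2_le_square_integrable[OF L2_le_diff[OF regularized_inverse_contraction[OF \<rho> N(5)] N(5)]])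
  from L2_le_add[OF st er] show ?thesis by (simp add: eq L2_le_iff)
qed

text \<open>The inequality ln x \<le> x at x = b L / m, exponentiated. With L = ln (1/\<epsilon>) it
  absorbs a positive power of \<epsilon> into the logarithmic rate.\<close>

lemma powr_times_exp_bounded:
  fixes m b L :: real
  assumes "0 < m" "0 < b" "0 < L"
  shows "exp (- b * L) \<le> (m / b) powr m * L powr (- m)"
proof -
  have "ln (b * L / m) \<le> b * L / m" using assms by (intro order_trans[OF ln_le_minus_one]) auto
  then have "m * ln (b * L / m) \<le> b * L" using assms by (simp add: field_simps)
  moreover have "ln (b * L / m) = ln L - ln (m / b)" using assms by (simp add: ln_div ln_mult)
  ultimately have "m * ln L - m * ln (m / b) \<le> b * L" by (simp add: right_diff_distrib)
  then have "- b * L \<le> m * ln (m / b) + - m * ln L" by simp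
  then have "exp (- b * L) \<le> exp (m * ln (m / b)) * exp (- m * ln L)" by (simp flip: exp_add)
  then show ?thesis using assms by (simp add: powr_def)
qed

text \<open>Functions stand for classes in L2, so the clause on \<open>ae_eq\<close> expresses that
  \<open>V\<close> is well defined on classes. Quantifying \<open>V\<close> before the exact data
  expresses its independence of them.\<close>

theorem theorem1:
  fixes \<gamma> :: real
  assumes "0 < \<gamma>" and "\<gamma> < 2"
  shows "\<exists>(C::real) (V :: real \<Rightarrow> (real \<times> real \<Rightarrow> real) \<Rightarrow> (real \<times> real \<Rightarrow> real) \<Rightarrow> (real \<times> real \<Rightarrow> real)).
    C > 0 \<and>
    (\<forall>\<epsilon>\<in>{0<..<exp (- 3 / \<gamma>)}. \<forall>f g. causal_L2 f \<and> causal_L2 g \<longrightarrow>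
       square_integrable (V \<epsilon> f g) \<and>
       (\<forall>f' g'. causal_L2 f' \<and> causal_L2 g' \<and> ae_eq f f' \<and> ae_eq g g' \<longrightarrow>
          ae_eq (V \<epsilon> f g) (V \<epsilon> f' g'))) \<and>
    (\<forall>f\<^sub>0 g\<^sub>0 v\<^sub>0. exact_solution f\<^sub>0 g\<^sub>0 v\<^sub>0 \<longrightarrow>
       (\<exists>\<eta> :: real \<Rightarrow> real.
          (\<forall>\<epsilon>\<in>{0<..<exp (- 3 / \<gamma>)}. \<eta> \<epsilon> \<ge> 0) \<and>
          (\<eta> \<longlongrightarrow> 0) (at_right 0) \<and>
          (\<forall>\<epsilon>\<in>{0<..<exp (- 3 / \<gamma>)}. \<forall>f g.
             causal_L2 f \<and> causal_L2 g \<and>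
             L2_norm (\<lambda>p. f p - f\<^sub>0 p) \<le> \<epsilon> \<and> L2_norm (\<lambda>p. g p - g\<^sub>0 p) \<le> \<epsilon> \<longrightarrow>
               L2_norm (\<lambda>p. V \<epsilon> f g p - v\<^sub>0 p) \<le> sqrt (C * \<epsilon> powr (2 - \<gamma>) + \<eta> \<epsilon>)))) \<and>
    (\<forall>v\<^sub>0. \<forall>m>0. sobolev m v\<^sub>0 \<and> integrable lborel v\<^sub>0 \<longrightarrow>
       (\<exists>D>0. \<forall>f\<^sub>0 g\<^sub>0. exact_solution f\<^sub>0 g\<^sub>0 v\<^sub>0 \<longrightarrow>
          (\<forall>\<epsilon>\<in>{0<..<exp (- 3 / \<gamma>)}. \<epsilon> < min (exp (- exp 2)) (exp (- 4 * m\<^sup>2)) \<longrightarrow>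
             (\<forall>f g.
                causal_L2 f \<and> causal_L2 g \<and>
                L2_norm (\<lambda>p. f p - f\<^sub>0 p) \<le> \<epsilon> \<and> L2_norm (\<lambda>p. g p - g\<^sub>0 p) \<le> \<epsilon> \<longrightarrow>
                  L2_norm (\<lambda>p. V \<epsilon> f g p - v\<^sub>0 p) < D * (ln (1 / \<epsilon>)) powr (- m)))))"
proof -
  let ?\<rho> = "cutoff \<gamma>" and ?E = "{0<..<exp (- 3 / \<gamma>)}"
  define V where "V \<epsilon> f g = regularized_inverse (?\<rho> \<epsilon>) (data_term f g)" for \<epsilon> f g
  define err where "err v \<epsilon> = L2_norm (\<lambda>p. regularized_inverse (?\<rho> \<epsilon>) (conv kernel_S v) p - v p)" for v \<epsilon>
  note \<rho>1 = cutoff_ge_1[OF assms(1)]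
  \<comment> \<open>The amplification \<open>exp \<rho>\<close> times the noise level \<epsilon> is
    a positive power of \<epsilon> because \<gamma> < 2.\<close>
  have main: "L2_norm (\<lambda>p. V \<epsilon> f g p - v\<^sub>0 p) \<le> data_bound / 2 * \<epsilon> powr (1 - \<gamma> / 2) + err v\<^sub>0 \<epsilon>"
    if \<epsilon>: "\<epsilon> \<in> ?E" and ex: "exact_solution f\<^sub>0 g\<^sub>0 v\<^sub>0" and fg: "causal_L2 f" "causal_L2 g"
      "L2_norm (\<lambda>p. f p - f\<^sub>0 p) \<le> \<epsilon>" "L2_norm (\<lambda>p. g p - g\<^sub>0 p) \<le> \<epsilon>" for \<epsilon> f g f\<^sub>0 g\<^sub>0 v\<^sub>0
  proof -
    have "\<epsilon> powr (1 - \<gamma> / 2) = \<epsilon> powr (- (\<gamma> / 2)) * \<epsilon>"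
      using powr_add[of \<epsilon> "- (\<gamma> / 2)" 1] \<epsilon> by simp
    then have eq: "exp (?\<rho> \<epsilon>) / 2 * (data_bound * \<epsilon>) = data_bound / 2 * \<epsilon> powr (1 - \<gamma> / 2)"
      using \<epsilon> by (simp add: exp_cutoff)
    show ?thesis unfolding V_def err_def by (rule regularized_inverse_stability[OF \<rho>1[OF \<epsilon>] ex fg, unfolded eq])
  qed
  have V_sq: "square_integrable (V \<epsilon> f g)"
    if "\<epsilon> \<in> ?E" "causal_L2 f" "causal_L2 g" for \<epsilon> f g
  proof -
    have "L2_le f (max (L2_norm f) (L2_norm g))" "L2_le g (max (L2_norm f) (L2_norm g))"
      using that by (auto simp: causal_L2_def L2_le_iff)
    then show ?thesis
      unfolding V_def using L2_le_square_integrable L2_le_regularized_inverse[OF \<rho>1[OF that(1)]] L2_le_data_term by blast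
  qed
  have V_cong: "ae_eq (V \<epsilon> f g) (V \<epsilon> f' g')"
    if \<epsilon>: "\<epsilon> \<in> ?E" and c: "causal_L2 f" "causal_L2 g" "causal_L2 f'" "causal_L2 g'" and ae: "ae_eq f f'" "ae_eq g g'"
    for \<epsilon> f g f' g'
  proof -
    have m: "f \<in> borel_measurable borel" "f' \<in> borel_measurable borel" "g \<in> borel_measurable borel" "g' \<in> borel_measurable borel"
      using c by (auto simp: causal_L2_def square_integrable_def)
    have m': "data_term f g \<in> borel_measurable borel" if "f \<in> borel_measurable borel" "g \<in> borel_measurable borel" for f g
      using that unfolding data_term_def[abs_def] conv_eq_convolve[abs_def] by measurable
    have "V \<epsilon> f g = V \<epsilon> f' g'"
      unfolding V_def
      by (intro regularized_inverse_cong_AE[OF \<rho>1[OF \<epsilon>]] data_term_cong_AE m m') (use ae in \<open>auto simp: ae_eq_def\<close>)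
    then show ?thesis by (simp add: ae_eq_def)
  qed
  \<comment> \<open>From (a + b)^2 \<le> 2 a^2 + 2 b^2 with a the data error and b the
    regularization error: 2 a^2 gives this constant, and 2 b^2 is the witness for \<eta>.\<close>
  let ?C = "data_bound\<^sup>2 / 2"
  have conv_part: "\<exists>\<eta> :: real \<Rightarrow> real.
          (\<forall>\<epsilon>\<in>?E. \<eta> \<epsilon> \<ge> 0) \<and> (\<eta> \<longlongrightarrow> 0) (at_right 0) \<and>
          (\<forall>\<epsilon>\<in>?E. \<forall>f g. causal_L2 f \<and> causal_L2 g \<and>
             L2_norm (\<lambda>p. f p - f\<^sub>0 p) \<le> \<epsilon> \<and> L2_norm (\<lambda>p. g p - g\<^sub>0 p) \<le> \<epsilon> \<longrightarrow>
               L2_norm (\<lambda>p. V \<epsilon> f g p - v\<^sub>0 p) \<le> sqrt (?C * \<epsilon> powr (2 - \<gamma>) + \<eta> \<epsilon>))"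
    if ex: "exact_solution f\<^sub>0 g\<^sub>0 v\<^sub>0" for f\<^sub>0 g\<^sub>0 v\<^sub>0
  proof (intro exI[of _ "\<lambda>\<epsilon>. 2 * (err v\<^sub>0 \<epsilon>)\<^sup>2"] conjI ballI allI impI)
    have v: "square_integrable v\<^sub>0" using ex by (simp add: exact_solution_def causal_L2_def)
    have "(err v\<^sub>0 \<longlongrightarrow> 0) (at_right 0)"
      unfolding err_def[abs_def]
      by (rule filterlim_compose[OF regularization_error_tendsto_0[OF v] cutoff_at_top[OF assms(1)]])
    then have "((\<lambda>\<epsilon>. 2 * (err v\<^sub>0 \<epsilon>)\<^sup>2) \<longlongrightarrow> 2 * 0\<^sup>2) (at_right 0)" by (intro tendsto_intros)
    then show "((\<lambda>\<epsilon>. 2 * (err v\<^sub>0 \<epsilon>)\<^sup>2) \<longlongrightarrow> 0) (at_right 0)" by simp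
  next
    fix \<epsilon> f g
    assume \<epsilon>: "\<epsilon> \<in> ?E" and fg: "causal_L2 f \<and> causal_L2 g \<and>
             L2_norm (\<lambda>p. f p - f\<^sub>0 p) \<le> \<epsilon> \<and> L2_norm (\<lambda>p. g p - g\<^sub>0 p) \<le> \<epsilon>"
    let ?a = "data_bound / 2 * \<epsilon> powr (1 - \<gamma> / 2)" and ?b = "err v\<^sub>0 \<epsilon>"
    have "L2_norm (\<lambda>p. V \<epsilon> f g p - v\<^sub>0 p) \<le> ?a + ?b" using main[OF \<epsilon> ex] fg by blast
    also have "?a + ?b \<le> sqrt (2 * ?a\<^sup>2 + 2 * ?b\<^sup>2)"
    proof (rule real_le_rsqrt)
      have "0 \<le> (?a - ?b)\<^sup>2" by simp
      then show "(?a + ?b)\<^sup>2 \<le> 2 * ?a\<^sup>2 + 2 * ?b\<^sup>2" unfolding power2_sum power2_diff by linarith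
    qed
    also have "2 * ?a\<^sup>2 = ?C * \<epsilon> powr (2 - \<gamma>)"
    proof -
      have "(\<epsilon> powr (1 - \<gamma> / 2))\<^sup>2 = \<epsilon> powr (2 - \<gamma>)"
        by (simp add: power2_eq_square powr_add[symmetric])
      then show ?thesis unfolding power_mult_distrib by (simp add: power_divide)
    qed
    finally show "L2_norm (\<lambda>p. V \<epsilon> f g p - v\<^sub>0 p) \<le> sqrt (?C * \<epsilon> powr (2 - \<gamma>) + 2 * (err v\<^sub>0 \<epsilon>)\<^sup>2)" .
  qed simp
  have rate_part: "\<exists>D>0. \<forall>f\<^sub>0 g\<^sub>0. exact_solution f\<^sub>0 g\<^sub>0 v\<^sub>0 \<longrightarrow>
          (\<forall>\<epsilon>\<in>?E. \<epsilon> < min (exp (- exp 2)) (exp (- 4 * m\<^sup>2)) \<longrightarrow>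
             (\<forall>f g. causal_L2 f \<and> causal_L2 g \<and>
                L2_norm (\<lambda>p. f p - f\<^sub>0 p) \<le> \<epsilon> \<and> L2_norm (\<lambda>p. g p - g\<^sub>0 p) \<le> \<epsilon> \<longrightarrow>
                  L2_norm (\<lambda>p. V \<epsilon> f g p - v\<^sub>0 p) < D * (ln (1 / \<epsilon>)) powr (- m)))"
    if m: "0 < m" and s: "sobolev m v\<^sub>0" for m v\<^sub>0
  proof -
    obtain K where K: "0 \<le> K"
      "\<And>\<rho>. 1 \<le> \<rho> \<Longrightarrow> L2_le (\<lambda>p. regularized_inverse \<rho> (conv kernel_S v\<^sub>0) p - v\<^sub>0 p) (\<rho> powr (- m) * K)"
      using regularization_error_sobolev[OF s m] by metis
    define b where "b = 1 - \<gamma> / 2"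
    have b: "0 < b" using assms by (simp add: b_def)
    \<comment> \<open>The two error terms contribute the first two summands; the summand 1 makes the
      inequality strict.\<close>
    define D where "D = data_bound / 2 * (m / b) powr m + (\<gamma> / 2) powr (- m) * K + 1"
    have "0 < D" unfolding D_def using K(1) data_bound_pos by (intro add_nonneg_pos add_nonneg_nonneg mult_nonneg_nonneg) auto
    moreover have "L2_norm (\<lambda>p. V \<epsilon> f g p - v\<^sub>0 p) < D * (ln (1 / \<epsilon>)) powr (- m)"
      if ex: "exact_solution f\<^sub>0 g\<^sub>0 v\<^sub>0" and \<epsilon>: "\<epsilon> \<in> ?E" and fg: "causal_L2 f" "causal_L2 g"
        "L2_norm (\<lambda>p. f p - f\<^sub>0 p) \<le> \<epsilon>" "L2_norm (\<lambda>p. g p - g\<^sub>0 p) \<le> \<epsilon>" for f\<^sub>0 g\<^sub>0 \<epsilon> f g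
    proof -
      define L where "L = ln (1 / \<epsilon>)"
      have \<rho>L: "?\<rho> \<epsilon> = \<gamma> / 2 * L" by (simp add: cutoff_def L_def)
      have L: "0 < L"
      proof -
        have "0 < \<gamma> / 2 * L" using \<rho>1[OF \<epsilon>] unfolding \<rho>L by linarith
        then show ?thesis using assms(1) by (simp add: zero_less_mult_iff)
      qed
      have "err v\<^sub>0 \<epsilon> \<le> ?\<rho> \<epsilon> powr (- m) * K"
        using K(2)[OF \<rho>1[OF \<epsilon>]] by (simp add: err_def L2_le_iff)
      also have "?\<rho> \<epsilon> powr (- m) = (\<gamma> / 2) powr (- m) * L powr (- m)"
        unfolding \<rho>L using assms(1) L by (intro powr_mult)
      finally have e1: "err v\<^sub>0 \<epsilon> \<le> (\<gamma> / 2) powr (- m) * K * L powr (- m)" by (simp add: mult_ac)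
      have "\<epsilon> powr (1 - \<gamma> / 2) = exp (- b * L)"
        using \<epsilon> by (simp add: powr_def L_def ln_div b_def algebra_simps)
      also have "\<dots> \<le> (m / b) powr m * L powr (- m)" by (rule powr_times_exp_bounded[OF m b L])
      finally have e2: "data_bound / 2 * \<epsilon> powr (1 - \<gamma> / 2) \<le> data_bound / 2 * ((m / b) powr m * L powr (- m))"
        using data_bound_pos by (intro mult_left_mono) auto
      have "0 < L powr (- m)" using L by simp
      then have "data_bound / 2 * ((m / b) powr m * L powr (- m)) + (\<gamma> / 2) powr (- m) * K * L powr (- m) < D * L powr (- m)"
        by (simp add: D_def distrib_right)
      with main[OF \<epsilon> ex fg] e1 e2 show ?thesis unfolding L_def[symmetric] by linarith
    qed
    ultimately show ?thesis by blast
  qed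
  show ?thesis
    by (rule exI[of _ ?C], rule exI[of _ V])
      (use data_bound_pos V_sq V_cong conv_part rate_part in \<open>simp add: conj_imp_eq_imp_imp\<close>)
qed

end
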